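(* Let $(\mathcal V,\otimes,\mathcal I)$ be a complete and cocomplete symmetric monoidal category and $\kappa$ a regular cardinal. Let $S$ be the collection of canonical morphisms $\mathrm{colim}_{i\in I}(A_i\otimes X)\to(\mathrm{colim}_{i\in I}A_i)\otimes X$, where $I$ runs over all $\kappa$-small categories, $(A_i)_{i\in I}$ over $I$-diagrams in $\mathcal V$, and $X$ over all objects of $\mathcal V$, and let $\overline S$ be its $\kappa$-closed monoidal multiplicative closure. Then: (1) The localization $L:\mathcal V\to L\mathcal V:=\mathcal V[\overline S^{-1}]$ preserves $\kappa$-small limits, $\kappa$-small colimits and the tensor product. (2) For any $\kappa$-small diagram $(A_j)_{j\in J}$ in $\mathcal V$ and object $X\in\mathcal V$, the induced map $\mathrm{colim}_{j\in J}(LA_j\otimes LX)\to\mathrm{colim}_{j\in J}(LA_j)\otimes LX$ is an isomorphism in $L\mathcal V$. (3) For any $\kappa$-small diagram $(B_i)_{i\in I}$ in $L\mathcal V$ and object $X\in L\mathcal V$, the natural map $\mathrm{colim}_{i\in I}(B_i\otimes X)\to(\mathrm{colim}_{i\in I}B_i)\otimes X$ is an isomorphism in $L\mathcal V$.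
   Context: $\mathcal V[T^{-1}]$ denotes the Gabriel–Zisman localization at a collection of morphisms $T$ (same objects as $\mathcal V$, universal for inverting $T$). A collection of morphisms is a multiplicative system if it admits both a calculus of left fractions and a calculus of right fractions (Gabriel–Zisman); it is $\kappa$-closed if closed under $\kappa$-small products and coproducts of morphisms, and monoidal if closed under tensoring with identity maps $\mathrm{id}_X$, $X\in\mathcal V$. The $\kappa$-closed monoidal multiplicative closure $\overline S$ of $S$ (with all identities adjoined to $S$) is the $\kappa$-closed monoidal multiplicative system $\overline S=S_\kappa$ constructed as follows. $S_0=S$; $S_\alpha=\bigcup_{\beta<\alpha}S_\beta$ for limit ordinals $\alpha$; for $\alpha=\beta+1$ let $T_0=S_\beta$; $T_1$ = all pushouts $Y\to Y\sqcup_XZ$ of morphisms $X\to Z$ in $T_0$ along morphisms $X\to Y$ of $\mathcal V$; $T_2$ = $T_1$ and all canonical $\mathrm{coeq}(fs,gs)\to\mathrm{coeq}(f,g)$ with $f,g:X\rightrightarrows Y$ in $\mathcal V$ and $s:W\to X$ in $T_1$; $T_3$ = all pullbacks $Y\times_XZ\to Y$ of morphisms $Z\to X$ in $T_2$ along $Y\to X$ in $\mathcal V$; $T_4$ = $T_3$ and all canonical $\mathrm{eq}(f,g)\to\mathrm{eq}(sf,sg)$ with $f,g:X\rightrightarrows Y$ in $\mathcal V$ and $s:Y\to Z$ in $T_3$; $T_5$ = finite compositions of morphisms in $T_4$; $T_6$ = $T_5$ and all products and coproducts of morphisms of $T_5$ indexed by sets in bijection with an ordinal $<\alpha$; $S_\alpha$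 = $T_6$ and all $\mathrm{id}_X\otimes s$, $s\otimes\mathrm{id}_X$ with $s\in T_6$, $X\in\mathcal V$. It has the universal property that for any $\kappa$-closed monoidal multiplicative system $\overline S'\supseteq S$ the localization $\mathcal V\to\mathcal V[(\overline S')^{-1}]$ factors uniquely through $\mathcal V\to\mathcal V[\overline S^{-1}]$. The tensor product on $L\mathcal V$ is the one induced from $\mathcal V$, with $LA\otimes LB=L(A\otimes B)$. *)

theory Defs
  imports Main
begin

unbundle cardinal_syntax

section \<open>Categories, functors, limits and colimits\<close>

record ('o, 'a) cat =
  Obj :: "'o set"
  Arr :: "'a set"
  Dom :: "'a \<Rightarrow> 'o"
  Cod :: "'a \<Rightarrow> 'o"
  Ident :: "'o \<Rightarrow> 'a"
  Comp :: "'a \<Rightarrow> 'a \<Rightarrow> 'a"  (infixr "\<cdot>\<index>" 72)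

definition hom :: "('o, 'a, 'm) cat_scheme \<Rightarrow> 'o \<Rightarrow> 'o \<Rightarrow> 'a set" where
  "hom C A B = {f \<in> Arr C. Dom C f = A \<and> Cod C f = B}"

locale category =
  fixes C :: "('o, 'a, 'm) cat_scheme" (structure)
  assumes dom_obj: "f \<in> Arr C \<Longrightarrow> Dom C f \<in> Obj C"
    and cod_obj: "f \<in> Arr C \<Longrightarrow> Cod C f \<in> Obj C"
    and ident_hom: "A \<in> Obj C \<Longrightarrow> Ident C A \<in> hom C A A"
    and comp_hom: "\<lbrakk>f \<in> hom C A B; g \<in> hom C B D\<rbrakk> \<Longrightarrow> g \<cdot> f \<in> hom C A D"
    and comp_ident_right: "f \<in> hom C A B \<Longrightarrow> f \<cdot> Ident C A = f"
    and comp_ident_left: "f \<in> hom C A B \<Longrightarrow> Ident C B \<cdot> f = f"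
    and comp_assoc: "\<lbrakk>f \<in> hom C A B; g \<in> hom C B D; h \<in> hom C D E\<rbrakk>
      \<Longrightarrow> (h \<cdot> g) \<cdot> f = h \<cdot> (g \<cdot> f)"

definition iso :: "('o, 'a, 'm) cat_scheme \<Rightarrow> 'a \<Rightarrow> bool" where
  "iso C f \<longleftrightarrow> f \<in> Arr C \<and> (\<exists>g \<in> hom C (Cod C f) (Dom C f).
     g \<cdot>\<^bsub>C\<^esub> f = Ident C (Dom C f) \<and> f \<cdot>\<^bsub>C\<^esub> g = Ident C (Cod C f))"

definition is_functor :: "('o, 'a, 'm) cat_scheme \<Rightarrow> ('p, 'b, 'n) cat_scheme
    \<Rightarrow> ('o \<Rightarrow> 'p) \<Rightarrow> ('a \<Rightarrow> 'b) \<Rightarrow> bool" where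
  "is_functor C D Fo Fa \<longleftrightarrow> category C \<and> category D
     \<and> (\<forall>A \<in> Obj C. Fo A \<in> Obj D)
     \<and> (\<forall>f \<in> Arr C. Fa f \<in> hom D (Fo (Dom C f)) (Fo (Cod C f)))
     \<and> (\<forall>A \<in> Obj C. Fa (Ident C A) = Ident D (Fo A))
     \<and> (\<forall>f \<in> Arr C. \<forall>g \<in> Arr C. Cod C f = Dom C g \<longrightarrow>
          Fa (g \<cdot>\<^bsub>C\<^esub> f) = Fa g \<cdot>\<^bsub>D\<^esub> Fa f)"

definition is_cone :: "('j, 'k, 'l) cat_scheme \<Rightarrow> ('o, 'a, 'm) cat_scheme
    \<Rightarrow> ('j \<Rightarrow> 'o) \<Rightarrow> ('k \<Rightarrow> 'a) \<Rightarrow> 'o \<Rightarrow> ('j \<Rightarrow> 'a) \<Rightarrow> bool" where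
  "is_cone J C Fo Fa X p \<longleftrightarrow> X \<in> Obj C \<and> (\<forall>j \<in> Obj J. p j \<in> hom C X (Fo j))
     \<and> (\<forall>u \<in> Arr J. Fa u \<cdot>\<^bsub>C\<^esub> p (Dom J u) = p (Cod J u))"

definition is_limit :: "('j, 'k, 'l) cat_scheme \<Rightarrow> ('o, 'a, 'm) cat_scheme
    \<Rightarrow> ('j \<Rightarrow> 'o) \<Rightarrow> ('k \<Rightarrow> 'a) \<Rightarrow> 'o \<Rightarrow> ('j \<Rightarrow> 'a) \<Rightarrow> bool" where
  "is_limit J C Fo Fa X p \<longleftrightarrow> is_cone J C Fo Fa X p
     \<and> (\<forall>Y q. is_cone J C Fo Fa Y q \<longrightarrow>
          (\<exists>!h. h \<in> hom C Y X \<and> (\<forall>j \<in> Obj J. p j \<cdot>\<^bsub>C\<^esub> h = q j)))"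

definition is_cocone :: "('j, 'k, 'l) cat_scheme \<Rightarrow> ('o, 'a, 'm) cat_scheme
    \<Rightarrow> ('j \<Rightarrow> 'o) \<Rightarrow> ('k \<Rightarrow> 'a) \<Rightarrow> 'o \<Rightarrow> ('j \<Rightarrow> 'a) \<Rightarrow> bool" where
  "is_cocone J C Fo Fa X c \<longleftrightarrow> X \<in> Obj C \<and> (\<forall>j \<in> Obj J. c j \<in> hom C (Fo j) X)
     \<and> (\<forall>u \<in> Arr J. c (Cod J u) \<cdot>\<^bsub>C\<^esub> Fa u = c (Dom J u))"

definition is_colimit :: "('j, 'k, 'l) cat_scheme \<Rightarrow> ('o, 'a, 'm) cat_scheme
    \<Rightarrow> ('j \<Rightarrow> 'o) \<Rightarrow> ('k \<Rightarrow> 'a) \<Rightarrow> 'o \<Rightarrow> ('j \<Rightarrow> 'a) \<Rightarrow> bool" where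
  "is_colimit J C Fo Fa X c \<longleftrightarrow> is_cocone J C Fo Fa X c
     \<and> (\<forall>Y d. is_cocone J C Fo Fa Y d \<longrightarrow>
          (\<exists>!h. h \<in> hom C X Y \<and> (\<forall>j \<in> Obj J. h \<cdot>\<^bsub>C\<^esub> c j = d j)))"

text \<open>The type \<open>'u\<close> plays the role of the universe of small sets: a small category is one whose
  objects and arrows are elements of \<open>'u\<close>.  No assumption relates \<open>'u\<close> to the types of the
  objects and arrows of the ambient category.\<close>

definition complete :: "'u itself \<Rightarrow> ('o, 'a, 'm) cat_scheme \<Rightarrow> bool" where
  "complete _ C \<longleftrightarrow> (\<forall>(J :: ('u, 'u) cat) Fo Fa.
     is_functor J C Fo Fa \<longrightarrow> (\<exists>X p. is_limit J C Fo Fa X p))"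

definition cocomplete :: "'u itself \<Rightarrow> ('o, 'a, 'm) cat_scheme \<Rightarrow> bool" where
  "cocomplete _ C \<longleftrightarrow> (\<forall>(J :: ('u, 'u) cat) Fo Fa.
     is_functor J C Fo Fa \<longrightarrow> (\<exists>X c. is_colimit J C Fo Fa X c))"

text \<open>Since \<open>Field \<kappa> \<subseteq> UNIV :: 'u set\<close>, every category with fewer than \<open>\<kappa>\<close> arrows is
  isomorphic to one whose objects and arrows are elements of \<open>'u\<close>.\<close>

definition regular_cardinal :: "'u rel \<Rightarrow> bool" where
  "regular_cardinal \<kappa> \<longleftrightarrow> Card_order \<kappa> \<and> infinite (Field \<kappa>) \<and> regularCard \<kappa>"

definition small_cat :: "'u rel \<Rightarrow> ('u, 'u) cat \<Rightarrow> bool" where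
  "small_cat \<kappa> J \<longleftrightarrow> category J \<and> |Arr J| <o \<kappa>"

definition preserves_small_limits :: "'u rel \<Rightarrow> ('o, 'a, 'm) cat_scheme
    \<Rightarrow> ('p, 'b, 'n) cat_scheme \<Rightarrow> ('o \<Rightarrow> 'p) \<Rightarrow> ('a \<Rightarrow> 'b) \<Rightarrow> bool" where
  "preserves_small_limits \<kappa> C D Lo La \<longleftrightarrow> (\<forall>(J :: ('u, 'u) cat) Fo Fa X p.
     small_cat \<kappa> J \<and> is_functor J C Fo Fa \<and> is_limit J C Fo Fa X p \<longrightarrow>
       is_limit J D (\<lambda>j. Lo (Fo j)) (\<lambda>u. La (Fa u)) (Lo X) (\<lambda>j. La (p j)))"

definition preserves_small_colimits :: "'u rel \<Rightarrow> ('o, 'a, 'm) cat_scheme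
    \<Rightarrow> ('p, 'b, 'n) cat_scheme \<Rightarrow> ('o \<Rightarrow> 'p) \<Rightarrow> ('a \<Rightarrow> 'b) \<Rightarrow> bool" where
  "preserves_small_colimits \<kappa> C D Lo La \<longleftrightarrow> (\<forall>(J :: ('u, 'u) cat) Fo Fa X c.
     small_cat \<kappa> J \<and> is_functor J C Fo Fa \<and> is_colimit J C Fo Fa X c \<longrightarrow>
       is_colimit J D (\<lambda>j. Lo (Fo j)) (\<lambda>u. La (Fa u)) (Lo X) (\<lambda>j. La (c j)))"

subsection \<open>Pushouts, coequalizers, products and their duals\<close>

definition parallel :: "('o, 'a, 'm) cat_scheme \<Rightarrow> 'a \<Rightarrow> 'a \<Rightarrow> bool" where
  "parallel C f g \<longleftrightarrow> f \<in> Arr C \<and> g \<in> Arr C \<and> Dom C f = Dom C g \<and> Cod C f = Cod C g"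

definition is_pushout :: "('o, 'a, 'm) cat_scheme \<Rightarrow> 'a \<Rightarrow> 'a \<Rightarrow> 'a \<Rightarrow> 'a \<Rightarrow> bool" where
  "is_pushout C f g i j \<longleftrightarrow> f \<in> Arr C \<and> g \<in> Arr C \<and> i \<in> Arr C \<and> j \<in> Arr C
     \<and> Dom C f = Dom C g \<and> Cod C f = Dom C i \<and> Cod C g = Dom C j \<and> Cod C i = Cod C j
     \<and> i \<cdot>\<^bsub>C\<^esub> f = j \<cdot>\<^bsub>C\<^esub> g
     \<and> (\<forall>Q. \<forall>a \<in> hom C (Cod C f) Q. \<forall>b \<in> hom C (Cod C g) Q.
          a \<cdot>\<^bsub>C\<^esub> f = b \<cdot>\<^bsub>C\<^esub> g \<longrightarrow>
          (\<exists>!h. h \<in> hom C (Cod C i) Q \<and> h \<cdot>\<^bsub>C\<^esub> i = a \<and> h \<cdot>\<^bsub>C\<^esub> j = b))"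

definition is_pullback :: "('o, 'a, 'm) cat_scheme \<Rightarrow> 'a \<Rightarrow> 'a \<Rightarrow> 'a \<Rightarrow> 'a \<Rightarrow> bool" where
  "is_pullback C f g p q \<longleftrightarrow> f \<in> Arr C \<and> g \<in> Arr C \<and> p \<in> Arr C \<and> q \<in> Arr C
     \<and> Cod C f = Cod C g \<and> Cod C p = Dom C f \<and> Cod C q = Dom C g \<and> Dom C p = Dom C q
     \<and> f \<cdot>\<^bsub>C\<^esub> p = g \<cdot>\<^bsub>C\<^esub> q
     \<and> (\<forall>Q. \<forall>a \<in> hom C Q (Dom C f). \<forall>b \<in> hom C Q (Dom C g).
          f \<cdot>\<^bsub>C\<^esub> a = g \<cdot>\<^bsub>C\<^esub> b \<longrightarrow>
          (\<exists>!h. h \<in> hom C Q (Dom C p) \<and> p \<cdot>\<^bsub>C\<^esub> h = a \<and> q \<cdot>\<^bsub>C\<^esub> h = b))"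

definition is_coequalizer :: "('o, 'a, 'm) cat_scheme \<Rightarrow> 'a \<Rightarrow> 'a \<Rightarrow> 'a \<Rightarrow> bool" where
  "is_coequalizer C f g q \<longleftrightarrow> parallel C f g \<and> q \<in> Arr C \<and> Dom C q = Cod C f
     \<and> q \<cdot>\<^bsub>C\<^esub> f = q \<cdot>\<^bsub>C\<^esub> g
     \<and> (\<forall>Q. \<forall>a \<in> hom C (Cod C f) Q. a \<cdot>\<^bsub>C\<^esub> f = a \<cdot>\<^bsub>C\<^esub> g \<longrightarrow>
          (\<exists>!h. h \<in> hom C (Cod C q) Q \<and> h \<cdot>\<^bsub>C\<^esub> q = a))"

definition is_equalizer :: "('o, 'a, 'm) cat_scheme \<Rightarrow> 'a \<Rightarrow> 'a \<Rightarrow> 'a \<Rightarrow> bool" where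
  "is_equalizer C f g e \<longleftrightarrow> parallel C f g \<and> e \<in> Arr C \<and> Cod C e = Dom C f
     \<and> f \<cdot>\<^bsub>C\<^esub> e = g \<cdot>\<^bsub>C\<^esub> e
     \<and> (\<forall>Q. \<forall>a \<in> hom C Q (Dom C f). f \<cdot>\<^bsub>C\<^esub> a = g \<cdot>\<^bsub>C\<^esub> a \<longrightarrow>
          (\<exists>!h. h \<in> hom C Q (Dom C e) \<and> e \<cdot>\<^bsub>C\<^esub> h = a))"

definition is_product :: "('o, 'a, 'm) cat_scheme \<Rightarrow> 'i set \<Rightarrow> ('i \<Rightarrow> 'o) \<Rightarrow> 'o \<Rightarrow> ('i \<Rightarrow> 'a) \<Rightarrow> bool" where
  "is_product C I A P p \<longleftrightarrow> P \<in> Obj C \<and> (\<forall>i \<in> I. p i \<in> hom C P (A i))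
     \<and> (\<forall>Q \<in> Obj C. \<forall>q. (\<forall>i \<in> I. q i \<in> hom C Q (A i)) \<longrightarrow>
          (\<exists>!h. h \<in> hom C Q P \<and> (\<forall>i \<in> I. p i \<cdot>\<^bsub>C\<^esub> h = q i)))"

definition is_coproduct :: "('o, 'a, 'm) cat_scheme \<Rightarrow> 'i set \<Rightarrow> ('i \<Rightarrow> 'o) \<Rightarrow> 'o \<Rightarrow> ('i \<Rightarrow> 'a) \<Rightarrow> bool" where
  "is_coproduct C I A P c \<longleftrightarrow> P \<in> Obj C \<and> (\<forall>i \<in> I. c i \<in> hom C (A i) P)
     \<and> (\<forall>Q \<in> Obj C. \<forall>q. (\<forall>i \<in> I. q i \<in> hom C (A i) Q) \<longrightarrow>
          (\<exists>!h. h \<in> hom C P Q \<and> (\<forall>i \<in> I. h \<cdot>\<^bsub>C\<^esub> c i = q i)))"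

definition is_product_map :: "('o, 'a, 'm) cat_scheme \<Rightarrow> 'i set \<Rightarrow> ('i \<Rightarrow> 'a) \<Rightarrow> 'a \<Rightarrow> bool" where
  "is_product_map C I s m \<longleftrightarrow> (\<exists>P p Q q.
     is_product C I (\<lambda>i. Dom C (s i)) P p \<and> is_product C I (\<lambda>i. Cod C (s i)) Q q
     \<and> m \<in> hom C P Q \<and> (\<forall>i \<in> I. q i \<cdot>\<^bsub>C\<^esub> m = s i \<cdot>\<^bsub>C\<^esub> p i))"

definition is_coproduct_map :: "('o, 'a, 'm) cat_scheme \<Rightarrow> 'i set \<Rightarrow> ('i \<Rightarrow> 'a) \<Rightarrow> 'a \<Rightarrow> bool" where
  "is_coproduct_map C I s m \<longleftrightarrow> (\<exists>P c Q d.
     is_coproduct C I (\<lambda>i. Dom C (s i)) P c \<and> is_coproduct C I (\<lambda>i. Cod C (s i)) Q d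
     \<and> m \<in> hom C P Q \<and> (\<forall>i \<in> I. m \<cdot>\<^bsub>C\<^esub> c i = d i \<cdot>\<^bsub>C\<^esub> s i))"

section \<open>Symmetric monoidal categories\<close>

record ('o, 'a) moncat = "('o, 'a) cat" +
  tobj :: "'o \<Rightarrow> 'o \<Rightarrow> 'o"  (infixr "\<otimes>\<^sub>o\<index>" 74)
  tarr :: "'a \<Rightarrow> 'a \<Rightarrow> 'a"  (infixr "\<otimes>\<index>" 74)
  unit_obj :: "'o"
  assoc :: "'o \<Rightarrow> 'o \<Rightarrow> 'o \<Rightarrow> 'a"
  lunit :: "'o \<Rightarrow> 'a"
  runit :: "'o \<Rightarrow> 'a"
  braid :: "'o \<Rightarrow> 'o \<Rightarrow> 'a"

locale symmetric_monoidal_category = category M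
  for M :: "('o, 'a, 'm) moncat_scheme" (structure) +
  assumes tobj_obj: "\<lbrakk>A \<in> Obj M; B \<in> Obj M\<rbrakk> \<Longrightarrow> A \<otimes>\<^sub>o B \<in> Obj M"
    and tarr_hom: "\<lbrakk>f \<in> hom M A A'; g \<in> hom M B B'\<rbrakk> \<Longrightarrow> f \<otimes> g \<in> hom M (A \<otimes>\<^sub>o B) (A' \<otimes>\<^sub>o B')"
    and tarr_ident: "\<lbrakk>A \<in> Obj M; B \<in> Obj M\<rbrakk> \<Longrightarrow> Ident M A \<otimes> Ident M B = Ident M (A \<otimes>\<^sub>o B)"
    and interchange: "\<lbrakk>f \<in> hom M A A'; f' \<in> hom M A' A''; g \<in> hom M B B'; g' \<in> hom M B' B''\<rbrakk>
      \<Longrightarrow> (f' \<cdot> f) \<otimes> (g' \<cdot> g) = (f' \<otimes> g') \<cdot> (f \<otimes> g)"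
    and unit_obj: "unit_obj M \<in> Obj M"
    and assoc_hom: "\<lbrakk>A \<in> Obj M; B \<in> Obj M; D \<in> Obj M\<rbrakk>
      \<Longrightarrow> assoc M A B D \<in> hom M ((A \<otimes>\<^sub>o B) \<otimes>\<^sub>o D) (A \<otimes>\<^sub>o (B \<otimes>\<^sub>o D))"
    and assoc_iso: "\<lbrakk>A \<in> Obj M; B \<in> Obj M; D \<in> Obj M\<rbrakk> \<Longrightarrow> iso M (assoc M A B D)"
    and assoc_natural: "\<lbrakk>f \<in> hom M A A'; g \<in> hom M B B'; h \<in> hom M D D'\<rbrakk>
      \<Longrightarrow> assoc M A' B' D' \<cdot> ((f \<otimes> g) \<otimes> h) = (f \<otimes> (g \<otimes> h)) \<cdot> assoc M A B D"
    and lunit_hom: "A \<in> Obj M \<Longrightarrow> lunit M A \<in> hom M (unit_obj M \<otimes>\<^sub>o A) A"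
    and lunit_iso: "A \<in> Obj M \<Longrightarrow> iso M (lunit M A)"
    and lunit_natural: "f \<in> hom M A A'
      \<Longrightarrow> lunit M A' \<cdot> (Ident M (unit_obj M) \<otimes> f) = f \<cdot> lunit M A"
    and runit_hom: "A \<in> Obj M \<Longrightarrow> runit M A \<in> hom M (A \<otimes>\<^sub>o unit_obj M) A"
    and runit_iso: "A \<in> Obj M \<Longrightarrow> iso M (runit M A)"
    and runit_natural: "f \<in> hom M A A'
      \<Longrightarrow> runit M A' \<cdot> (f \<otimes> Ident M (unit_obj M)) = f \<cdot> runit M A"
    and pentagon: "\<lbrakk>A \<in> Obj M; B \<in> Obj M; D \<in> Obj M; E \<in> Obj M\<rbrakk>
      \<Longrightarrow> (Ident M A \<otimes> assoc M B D E) \<cdot> assoc M A (B \<otimes>\<^sub>o D) E \<cdot> (assoc M A B D \<otimes> Ident M E)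
        = assoc M A B (D \<otimes>\<^sub>o E) \<cdot> assoc M (A \<otimes>\<^sub>o B) D E"
    and triangle: "\<lbrakk>A \<in> Obj M; B \<in> Obj M\<rbrakk>
      \<Longrightarrow> (Ident M A \<otimes> lunit M B) \<cdot> assoc M A (unit_obj M) B = runit M A \<otimes> Ident M B"
    and braid_hom: "\<lbrakk>A \<in> Obj M; B \<in> Obj M\<rbrakk> \<Longrightarrow> braid M A B \<in> hom M (A \<otimes>\<^sub>o B) (B \<otimes>\<^sub>o A)"
    and braid_natural: "\<lbrakk>f \<in> hom M A A'; g \<in> hom M B B'\<rbrakk>
      \<Longrightarrow> braid M A' B' \<cdot> (f \<otimes> g) = (g \<otimes> f) \<cdot> braid M A B"
    and braid_symmetric: "\<lbrakk>A \<in> Obj M; B \<in> Obj M\<rbrakk>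
      \<Longrightarrow> braid M B A \<cdot> braid M A B = Ident M (A \<otimes>\<^sub>o B)"
    and hexagon: "\<lbrakk>A \<in> Obj M; B \<in> Obj M; D \<in> Obj M\<rbrakk>
      \<Longrightarrow> assoc M B D A \<cdot> braid M A (B \<otimes>\<^sub>o D) \<cdot> assoc M A B D
        = (Ident M B \<otimes> braid M A D) \<cdot> assoc M B A D \<cdot> (braid M A B \<otimes> Ident M D)"

definition strict_symmetric_monoidal_functor :: "('o, 'a, 'm) moncat_scheme
    \<Rightarrow> ('p, 'b, 'n) moncat_scheme \<Rightarrow> ('o \<Rightarrow> 'p) \<Rightarrow> ('a \<Rightarrow> 'b) \<Rightarrow> bool" where
  "strict_symmetric_monoidal_functor M N Fo Fa \<longleftrightarrow> is_functor M N Fo Fa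
     \<and> (\<forall>A \<in> Obj M. \<forall>B \<in> Obj M. Fo (A \<otimes>\<^sub>o\<^bsub>M\<^esub> B) = Fo A \<otimes>\<^sub>o\<^bsub>N\<^esub> Fo B)
     \<and> (\<forall>f \<in> Arr M. \<forall>g \<in> Arr M. Fa (f \<otimes>\<^bsub>M\<^esub> g) = Fa f \<otimes>\<^bsub>N\<^esub> Fa g)
     \<and> Fo (unit_obj M) = unit_obj N
     \<and> (\<forall>A \<in> Obj M. \<forall>B \<in> Obj M. \<forall>D \<in> Obj M. Fa (assoc M A B D) = assoc N (Fo A) (Fo B) (Fo D))
     \<and> (\<forall>A \<in> Obj M. Fa (lunit M A) = lunit N (Fo A))
     \<and> (\<forall>A \<in> Obj M. Fa (runit M A) = runit N (Fo A))
     \<and> (\<forall>A \<in> Obj M. \<forall>B \<in> Obj M. Fa (braid M A B) = braid N (Fo A) (Fo B))"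

text \<open>\<open>tensor_colim_map M J Fo Fa X K c D d u\<close>: for colimit cocones \<open>(K, c)\<close> of the diagram \<open>F\<close>
  and \<open>(D, d)\<close> of the diagram \<open>F(-) \<otimes> X\<close>, the arrow \<open>u : D \<rightarrow> K \<otimes> X\<close> is the canonical comparison,
  i.e. the one induced by the cocone \<open>c j \<otimes> X\<close>.\<close>

definition tensor_colim_map :: "('o, 'a, 'm) moncat_scheme \<Rightarrow> ('j, 'k, 'l) cat_scheme
    \<Rightarrow> ('j \<Rightarrow> 'o) \<Rightarrow> ('k \<Rightarrow> 'a) \<Rightarrow> 'o \<Rightarrow> 'o \<Rightarrow> ('j \<Rightarrow> 'a) \<Rightarrow> 'o \<Rightarrow> ('j \<Rightarrow> 'a) \<Rightarrow> 'a \<Rightarrow> bool" where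
  "tensor_colim_map M J Fo Fa X K c D d u \<longleftrightarrow>
     is_colimit J M Fo Fa K c
     \<and> is_colimit J M (\<lambda>j. Fo j \<otimes>\<^sub>o\<^bsub>M\<^esub> X) (\<lambda>a. Fa a \<otimes>\<^bsub>M\<^esub> Ident M X) D d
     \<and> u \<in> hom M D (K \<otimes>\<^sub>o\<^bsub>M\<^esub> X)
     \<and> (\<forall>j \<in> Obj J. u \<cdot>\<^bsub>M\<^esub> d j = c j \<otimes>\<^bsub>M\<^esub> Ident M X)"

definition tensor_colim_maps :: "'u rel \<Rightarrow> ('o, 'a, 'm) moncat_scheme \<Rightarrow> 'a set" where
  "tensor_colim_maps \<kappa> M = {u. \<exists>(J :: ('u, 'u) cat) Fo Fa X K c D d.
     small_cat \<kappa> J \<and> is_functor J M Fo Fa \<and> X \<in> Obj M \<and> tensor_colim_map M J Fo Fa X K c D d u}"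

text \<open>Both colimits exist, and the canonical comparison between any two choices of them is an
  isomorphism.\<close>

definition tensor_commutes_with_colim :: "('o, 'a, 'm) moncat_scheme \<Rightarrow> ('j, 'k, 'l) cat_scheme
    \<Rightarrow> ('j \<Rightarrow> 'o) \<Rightarrow> ('k \<Rightarrow> 'a) \<Rightarrow> 'o \<Rightarrow> bool" where
  "tensor_commutes_with_colim M J Fo Fa X \<longleftrightarrow>
     (\<exists>K c. is_colimit J M Fo Fa K c)
     \<and> (\<exists>D d. is_colimit J M (\<lambda>j. Fo j \<otimes>\<^sub>o\<^bsub>M\<^esub> X) (\<lambda>a. Fa a \<otimes>\<^bsub>M\<^esub> Ident M X) D d)
     \<and> (\<forall>K c D d u. tensor_colim_map M J Fo Fa X K c D d u \<longrightarrow> iso M u)"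

section \<open>The \<open>\<kappa>\<close>-closed monoidal multiplicative closure\<close>

text \<open>Limits and colimits are determined only up to isomorphism; every construction below (and
  \<^const>\<open>tensor_colim_maps\<close>) is applied to all possible choices of them.\<close>

definition add_pushouts :: "('o, 'a, 'm) cat_scheme \<Rightarrow> 'a set \<Rightarrow> 'a set" where
  "add_pushouts C T = {t. \<exists>s \<in> T. \<exists>g i. is_pushout C s g i t}"

definition add_coequalizer_maps :: "('o, 'a, 'm) cat_scheme \<Rightarrow> 'a set \<Rightarrow> 'a set" where
  "add_coequalizer_maps C T = T \<union> {t. \<exists>f g. \<exists>s \<in> T. \<exists>q q'.
     parallel C f g \<and> Cod C s = Dom C f
     \<and> is_coequalizer C (f \<cdot>\<^bsub>C\<^esub> s) (g \<cdot>\<^bsub>C\<^esub> s) q \<and> is_coequalizer C f g q'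
     \<and> t \<in> hom C (Cod C q) (Cod C q') \<and> t \<cdot>\<^bsub>C\<^esub> q = q'}"

definition add_pullbacks :: "('o, 'a, 'm) cat_scheme \<Rightarrow> 'a set \<Rightarrow> 'a set" where
  "add_pullbacks C T = {t. \<exists>s \<in> T. \<exists>g p. is_pullback C s g p t}"

definition add_equalizer_maps :: "('o, 'a, 'm) cat_scheme \<Rightarrow> 'a set \<Rightarrow> 'a set" where
  "add_equalizer_maps C T = T \<union> {t. \<exists>f g. \<exists>s \<in> T. \<exists>e e'.
     parallel C f g \<and> Dom C s = Cod C f
     \<and> is_equalizer C f g e \<and> is_equalizer C (s \<cdot>\<^bsub>C\<^esub> f) (s \<cdot>\<^bsub>C\<^esub> g) e'
     \<and> t \<in> hom C (Dom C e) (Dom C e') \<and> e' \<cdot>\<^bsub>C\<^esub> t = e}"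

inductive_set finite_comps :: "('o, 'a, 'm) cat_scheme \<Rightarrow> 'a set \<Rightarrow> 'a set"
  for C :: "('o, 'a, 'm) cat_scheme" and T :: "'a set" where
  "t \<in> T \<Longrightarrow> t \<in> finite_comps C T"
| "\<lbrakk>t \<in> finite_comps C T; t' \<in> T; Cod C t = Dom C t'\<rbrakk> \<Longrightarrow> t' \<cdot>\<^bsub>C\<^esub> t \<in> finite_comps C T"

text \<open>An element \<open>a\<close> of \<open>Field \<kappa>\<close> stands for the ordinal of its set \<open>underS \<kappa> a\<close> of strict
  predecessors; as \<open>\<kappa>\<close> is a cardinal, these are exactly the ordinals below \<open>\<kappa>\<close>.\<close>

definition index_set_below :: "'u rel \<Rightarrow> 'u \<Rightarrow> 'u set \<Rightarrow> bool" where
  "index_set_below \<kappa> a I \<longleftrightarrow> (\<exists>b \<in> underS \<kappa> a. \<exists>h. bij_betw h I (underS \<kappa> b))"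

definition add_products :: "'u rel \<Rightarrow> 'u \<Rightarrow> ('o, 'a, 'm) cat_scheme \<Rightarrow> 'a set \<Rightarrow> 'a set" where
  "add_products \<kappa> a C T = T \<union> {m. \<exists>I s. index_set_below \<kappa> a I \<and> (\<forall>i \<in> I. s i \<in> T)
     \<and> (is_product_map C I s m \<or> is_coproduct_map C I s m)}"

definition add_tensors :: "('o, 'a, 'm) moncat_scheme \<Rightarrow> 'a set \<Rightarrow> 'a set" where
  "add_tensors M T = T \<union> {Ident M X \<otimes>\<^bsub>M\<^esub> s | X s. X \<in> Obj M \<and> s \<in> T}
     \<union> {s \<otimes>\<^bsub>M\<^esub> Ident M X | X s. X \<in> Obj M \<and> s \<in> T}"

definition closure_step :: "'u rel \<Rightarrow> ('o, 'a, 'm) moncat_scheme \<Rightarrow> 'u \<Rightarrow> 'a set \<Rightarrow> 'a set" where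
  "closure_step \<kappa> M a T = add_tensors M (add_products \<kappa> a M (finite_comps M
     (add_equalizer_maps M (add_pullbacks M (add_coequalizer_maps M (add_pushouts M T))))))"

definition immediate_pred :: "'u rel \<Rightarrow> 'u \<Rightarrow> 'u \<Rightarrow> bool" where
  "immediate_pred \<kappa> b a \<longleftrightarrow> b \<in> underS \<kappa> a \<and> (\<forall>c \<in> underS \<kappa> a. (c, b) \<in> \<kappa>)"

definition closure_stage :: "'u rel \<Rightarrow> ('o, 'a, 'm) moncat_scheme \<Rightarrow> 'a set \<Rightarrow> 'u \<Rightarrow> 'a set" where
  "closure_stage \<kappa> M S = wfrec (\<kappa> - Id) (\<lambda>F a.
     if underS \<kappa> a = {} then S \<union> Ident M ` Obj M
     else if \<exists>b. immediate_pred \<kappa> b a then closure_step \<kappa> M a (F (THE b. immediate_pred \<kappa> b a))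
     else \<Union>b \<in> underS \<kappa> a. F b)"

definition mult_closure :: "'u rel \<Rightarrow> ('o, 'a, 'm) moncat_scheme \<Rightarrow> 'a set \<Rightarrow> 'a set" where
  "mult_closure \<kappa> M S = (\<Union>a \<in> Field \<kappa>. closure_stage \<kappa> M S a)"

lemma
  assumes "Well_order \<kappa>"
  shows closure_stage_zero:
      "underS \<kappa> a = {} \<Longrightarrow> closure_stage \<kappa> M S a = S \<union> Ident M ` Obj M"
    and closure_stage_succ:
      "immediate_pred \<kappa> b a \<Longrightarrow> closure_stage \<kappa> M S a = closure_step \<kappa> M a (closure_stage \<kappa> M S b)"
    and closure_stage_limit:
      "\<lbrakk>underS \<kappa> a \<noteq> {}; \<nexists>b. immediate_pred \<kappa> b a\<rbrakk>
        \<Longrightarrow> closure_stage \<kappa> M S a = (\<Union>b \<in> underS \<kappa> a. closure_stage \<kappa> M S b)"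
proof -
  have wf: "wf (\<kappa> - Id)" and anti: "antisym \<kappa>"
    using assms by (auto simp: order_on_defs)
  have the: "(THE b. immediate_pred \<kappa> b a) = b" if "immediate_pred \<kappa> b a" for a b
    using that anti by (intro the_equality) (auto simp: immediate_pred_def dest: antisymD)
  have rel: "(b, a) \<in> \<kappa> - Id" if "b \<in> underS \<kappa> a" for a b
    using that by (auto simp: underS_def)
  show "underS \<kappa> a = {} \<Longrightarrow> closure_stage \<kappa> M S a = S \<union> Ident M ` Obj M"
    unfolding closure_stage_def by (subst wfrec[OF wf]) simp
  show "closure_stage \<kappa> M S a = closure_step \<kappa> M a (closure_stage \<kappa> M S b)"
    if p: "immediate_pred \<kappa> b a"
  proof -
    have "b \<in> underS \<kappa> a" using p by (simp add: immediate_pred_def)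
    with p the[OF p] rel show ?thesis
      unfolding closure_stage_def by (subst wfrec[OF wf]) (auto simp: cut_apply)
  qed
  show "closure_stage \<kappa> M S a = (\<Union>b \<in> underS \<kappa> a. closure_stage \<kappa> M S b)"
    if "underS \<kappa> a \<noteq> {}" "\<nexists>b. immediate_pred \<kappa> b a"
    using that rel unfolding closure_stage_def by (subst wfrec[OF wf]) (simp add: cut_apply)
qed

section \<open>Gabriel--Zisman localization\<close>

text \<open>A zigzag is a list of steps read from source to target: \<open>Fwd f\<close> follows the arrow \<open>f\<close>, and
  \<open>Bwd s\<close> follows the formal inverse of \<open>s \<in> T\<close>.  The relation \<open>zigzag_eq C T A B\<close> is the
  congruence on zigzags from \<open>A\<close> to \<open>B\<close> generated by the relations of \<open>C\<close> together with the
  requirement that \<open>Bwd s\<close> be a two-sided inverse of \<open>Fwd s\<close>.\<close>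

datatype 'a zstep = Fwd 'a | Bwd 'a

inductive zigzag :: "('o, 'a, 'm) cat_scheme \<Rightarrow> 'a set \<Rightarrow> 'o \<Rightarrow> 'o \<Rightarrow> 'a zstep list \<Rightarrow> bool"
  for C :: "('o, 'a, 'm) cat_scheme" and T :: "'a set" where
  nil: "A \<in> Obj C \<Longrightarrow> zigzag C T A A []"
| fwd: "\<lbrakk>f \<in> hom C A B; zigzag C T B D p\<rbrakk> \<Longrightarrow> zigzag C T A D (Fwd f # p)"
| bwd: "\<lbrakk>s \<in> T; s \<in> hom C B A; zigzag C T B D p\<rbrakk> \<Longrightarrow> zigzag C T A D (Bwd s # p)"

inductive zigzag_eq :: "('o, 'a, 'm) cat_scheme \<Rightarrow> 'a set \<Rightarrow> 'o \<Rightarrow> 'o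
    \<Rightarrow> 'a zstep list \<Rightarrow> 'a zstep list \<Rightarrow> bool"
  for C :: "('o, 'a, 'm) cat_scheme" and T :: "'a set" where
  refl: "zigzag C T A B p \<Longrightarrow> zigzag_eq C T A B p p"
| sym: "zigzag_eq C T A B p q \<Longrightarrow> zigzag_eq C T A B q p"
| trans: "\<lbrakk>zigzag_eq C T A B p q; zigzag_eq C T A B q r\<rbrakk> \<Longrightarrow> zigzag_eq C T A B p r"
| append: "\<lbrakk>zigzag_eq C T A B p p'; zigzag_eq C T B D q q'\<rbrakk>
    \<Longrightarrow> zigzag_eq C T A D (p @ q) (p' @ q')"
| ident: "A \<in> Obj C \<Longrightarrow> zigzag_eq C T A A [Fwd (Ident C A)] []"
| comp: "\<lbrakk>f \<in> hom C A B; g \<in> hom C B D\<rbrakk> \<Longrightarrow> zigzag_eq C T A D [Fwd f, Fwd g] [Fwd (g \<cdot>\<^bsub>C\<^esub> f)]"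
| inverse_right: "\<lbrakk>s \<in> T; s \<in> hom C A B\<rbrakk> \<Longrightarrow> zigzag_eq C T A A [Fwd s, Bwd s] []"
| inverse_left: "\<lbrakk>s \<in> T; s \<in> hom C A B\<rbrakk> \<Longrightarrow> zigzag_eq C T B B [Bwd s, Fwd s] []"

definition zigzag_class :: "('o, 'a, 'm) cat_scheme \<Rightarrow> 'a set \<Rightarrow> 'o \<Rightarrow> 'o
    \<Rightarrow> 'a zstep list \<Rightarrow> 'a zstep list set" where
  "zigzag_class C T A B p = {q. zigzag_eq C T A B p q}"

type_synonym ('o, 'a) zarr = "'o \<times> 'o \<times> 'a zstep list set"

fun loc_comp :: "('o, 'a, 'm) cat_scheme \<Rightarrow> 'a set
    \<Rightarrow> ('o, 'a) zarr \<Rightarrow> ('o, 'a) zarr \<Rightarrow> ('o, 'a) zarr" where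
  "loc_comp C T (B', D, Q) (A, B, P) = (A, D, \<Union>p \<in> P. \<Union>q \<in> Q. zigzag_class C T A D (p @ q))"

definition loc_arr :: "('o, 'a, 'm) cat_scheme \<Rightarrow> 'a set \<Rightarrow> 'a \<Rightarrow> ('o, 'a) zarr" where
  "loc_arr C T f = (Dom C f, Cod C f, zigzag_class C T (Dom C f) (Cod C f) [Fwd f])"

text \<open>The tensor product of arrows induced from \<open>M\<close>: for zigzags \<open>p : A \<rightarrow> A'\<close> and \<open>q : B \<rightarrow> B'\<close>
  it is the composite of \<open>p \<otimes> B\<close> and \<open>A' \<otimes> q\<close>, formed stepwise.\<close>

fun loc_tarr :: "('o, 'a, 'm) moncat_scheme \<Rightarrow> 'a set
    \<Rightarrow> ('o, 'a) zarr \<Rightarrow> ('o, 'a) zarr \<Rightarrow> ('o, 'a) zarr" where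
  "loc_tarr M T (A, A', P) (B, B', Q) = (A \<otimes>\<^sub>o\<^bsub>M\<^esub> B, A' \<otimes>\<^sub>o\<^bsub>M\<^esub> B',
     \<Union>p \<in> P. \<Union>q \<in> Q. zigzag_class M T (A \<otimes>\<^sub>o\<^bsub>M\<^esub> B) (A' \<otimes>\<^sub>o\<^bsub>M\<^esub> B')
       (map (map_zstep (\<lambda>f. f \<otimes>\<^bsub>M\<^esub> Ident M B)) p @ map (map_zstep (\<lambda>g. Ident M A' \<otimes>\<^bsub>M\<^esub> g)) q))"

text \<open>The localization \<open>M[T\<inverse>]\<close> with its induced monoidal structure.  The localization functor is
  the identity on objects and \<^const>\<open>loc_arr\<close> on arrows.\<close>

definition localization :: "('o, 'a, 'm) moncat_scheme \<Rightarrow> 'a set \<Rightarrow> ('o, ('o, 'a) zarr) moncat" where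
  "localization M T = \<lparr>
     Obj = Obj M,
     Arr = {(A, B, zigzag_class M T A B p) | A B p. zigzag M T A B p},
     Dom = fst,
     Cod = fst \<circ> snd,
     Ident = (\<lambda>A. (A, A, zigzag_class M T A A [])),
     Comp = loc_comp M T,
     tobj = tobj M,
     tarr = loc_tarr M T,
     unit_obj = unit_obj M,
     assoc = (\<lambda>A B D. loc_arr M T (assoc M A B D)),
     lunit = (\<lambda>A. loc_arr M T (lunit M A)),
     runit = (\<lambda>A. loc_arr M T (runit M A)),
     braid = (\<lambda>A B. loc_arr M T (braid M A B))\<rparr>"

end

theory Submission
  imports Defs
begin

text \<open>
  Let \<open>W\<close> be the closure of \<open>S\<close>.  Its construction makes it a multiplicative system that is closed
  under \<open>\<kappa>\<close>-small products and coproducts and under tensoring with objects: every pushout, pullback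
  and canonical map between (co)equalizers of an arrow that has appeared at some stage is added at
  the next one, and regularity of \<open>\<kappa>\<close> lets the same be said of \<open>\<kappa>\<close>-small families of arrows
  (\<open>closure_multiplicative_system\<close>, \<open>closure_products\<close>, \<open>closure_tensor\<close>).

  Hence every arrow of \<open>V[W\<inverse>]\<close> is a left fraction \<open>t\<inverse> f\<close> and also a right fraction \<open>f s\<inverse>\<close>, and two
  parallel arrows of \<open>V\<close> have the same image if and only if some element of \<open>W\<close> equalizes
  them, on whichever side one likes (\<open>localization_fraction_functor\<close>).  A functor with these properties preserves
  coequalizers, because a map out of a coequalizer can be corrected by a denominator until it comes
  from \<open>V\<close>.  It preserves \<open>\<kappa>\<close>-small coproducts, because the coproduct of a family of denominators is
  a denominator for the whole family at once.  As a \<open>\<kappa>\<close>-small colimit is the coequalizer of two maps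
  between \<open>\<kappa>\<close>-small coproducts (\<open>colimit_iff_coequalizer\<close>), it preserves all of these; and as the
  properties used are self-dual, limits are preserved as well (\<open>preserves_colimit\<close>,
  \<open>preserves_limit\<close>).

  Tensoring with an object maps \<open>W\<close> into itself and therefore extends to the localization.  The
  coherence laws there are images of those of \<open>V\<close>; naturality and the interchange law pass to all
  arrows because these are composed of images of arrows of \<open>V\<close> and of inverses of such
  (\<open>naturality_extends\<close>).

  Finally, let a \<open>\<kappa>\<close>-small diagram in \<open>V[W\<inverse>]\<close> be given.  Its colimit is the coequalizer of two maps
  \<open>\<alpha>, \<beta>\<close> between coproducts formed in \<open>V\<close>, and a common denominator of \<open>\<alpha>\<close> and \<open>\<beta>\<close> replaces them, up
  to isomorphism, by two arrows that come from \<open>V\<close>.  So colimits in the localization are made of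
  images of coproducts and coequalizers of \<open>V\<close>.  These are respected by the tensor product, for the
  comparison maps in question belong to \<open>S\<close> and have become invertible
  (\<open>localization_colimit_tensor\<close>).  The assertion about diagrams in \<open>V\<close> is the special case of a
  diagram \<open>L \<circ> A\<close>.
\<close>

section \<open>Arrows, isomorphisms and opposite categories\<close>

lemma in_hom: "f \<in> hom C A B \<longleftrightarrow> f \<in> Arr C \<and> Dom C f = A \<and> Cod C f = B"
  by (simp add: hom_def)

lemma isoI:
  "\<lbrakk>f \<in> Arr C; g \<in> Arr C; Dom C g = Cod C f; Cod C g = Dom C f;
    g \<cdot>\<^bsub>C\<^esub> f = Ident C (Dom C f); f \<cdot>\<^bsub>C\<^esub> g = Ident C (Cod C f)\<rbrakk> \<Longrightarrow> iso C f"
  unfolding iso_def hom_def by blast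

context category
begin

lemma comp_arr [simp]:
  assumes "f \<in> Arr C" "g \<in> Arr C" "Cod C f = Dom C g"
  shows "g \<cdot> f \<in> Arr C" and "Dom C (g \<cdot> f) = Dom C f" and "Cod C (g \<cdot> f) = Cod C g"
  using assms comp_hom[of f "Dom C f" "Dom C g" g "Cod C g"] by (auto simp: in_hom)

lemma ident_arr [simp]:
  assumes "A \<in> Obj C"
  shows "Ident C A \<in> Arr C" and "Dom C (Ident C A) = A" and "Cod C (Ident C A) = A"
  using ident_hom[OF assms] by (auto simp: in_hom)

lemma ident_left [simp]: "\<lbrakk>f \<in> Arr C; Cod C f = A\<rbrakk> \<Longrightarrow> Ident C A \<cdot> f = f"
  using comp_ident_left[of f "Dom C f" A] by (simp add: in_hom)

lemma ident_right [simp]: "\<lbrakk>f \<in> Arr C; Dom C f = A\<rbrakk> \<Longrightarrow> f \<cdot> Ident C A = f"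
  using comp_ident_right[of f A "Cod C f"] by (simp add: in_hom)

lemma comp_assoc_arr:
  "\<lbrakk>f \<in> Arr C; g \<in> Arr C; h \<in> Arr C; Cod C f = Dom C g; Cod C g = Dom C h\<rbrakk>
    \<Longrightarrow> (h \<cdot> g) \<cdot> f = h \<cdot> (g \<cdot> f)"
  using comp_assoc[of f "Dom C f" "Dom C g" g "Dom C h" h "Cod C h"] by (simp add: in_hom)

text \<open>Composites are normalized to the right; this form of an equation \<open>g \<cdot> f = k\<close> applies inside a
  longer composite.\<close>

lemma comp_rewrite:
  assumes "g \<cdot> f = k" "f \<in> Arr C" "g \<in> Arr C" "x \<in> Arr C" "Cod C f = Dom C g" "Cod C x = Dom C f"
  shows "g \<cdot> (f \<cdot> x) = k \<cdot> x"
  using assms comp_assoc_arr[of x f g] by simp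

lemma dom_cod_obj [simp]: "f \<in> Arr C \<Longrightarrow> Dom C f \<in> Obj C" "f \<in> Arr C \<Longrightarrow> Cod C f \<in> Obj C"
  by (simp_all add: dom_obj cod_obj)

lemma isoE:
  assumes "iso C f"
  obtains g where "f \<in> Arr C" "g \<in> Arr C" "Dom C g = Cod C f" "Cod C g = Dom C f"
    "g \<cdot> f = Ident C (Dom C f)" "f \<cdot> g = Ident C (Cod C f)"
proof -
  from assms obtain g where "f \<in> Arr C" "g \<in> hom C (Cod C f) (Dom C f)"
    "g \<cdot> f = Ident C (Dom C f)" "f \<cdot> g = Ident C (Cod C f)" by (auto simp: iso_def)
  then show ?thesis by (intro that[of g]) (simp_all add: in_hom)
qed

lemma iso_cancel_left:
  assumes "iso C s" "s \<cdot> x = s \<cdot> y" "x \<in> Arr C" "y \<in> Arr C" "Cod C x = Dom C s" "Cod C y = Dom C s"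
  shows "x = y"
proof -
  obtain r where r: "s \<in> Arr C" "r \<in> Arr C" "Dom C r = Cod C s" "Cod C r = Dom C s"
    "r \<cdot> s = Ident C (Dom C s)" "s \<cdot> r = Ident C (Cod C s)"
    using assms(1) by (rule isoE)
  have "r \<cdot> (s \<cdot> x) = x" "r \<cdot> (s \<cdot> y) = y"
    using r assms(3-) by (simp_all add: comp_rewrite[OF r(5)])
  then show ?thesis using assms(2) by metis
qed

lemma iso_cancel_right:
  assumes "iso C s" "x \<cdot> s = y \<cdot> s" "x \<in> Arr C" "y \<in> Arr C" "Dom C x = Cod C s" "Dom C y = Cod C s"
  shows "x = y"
proof -
  obtain r where r: "s \<in> Arr C" "r \<in> Arr C" "Dom C r = Cod C s" "Cod C r = Dom C s"
    "r \<cdot> s = Ident C (Dom C s)" "s \<cdot> r = Ident C (Cod C s)"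
    using assms(1) by (rule isoE)
  have "(x \<cdot> s) \<cdot> r = x" "(y \<cdot> s) \<cdot> r = y"
    using r assms(3-) by (simp_all add: comp_assoc_arr)
  then show ?thesis using assms(2) by metis
qed

end

lemma functorD:
  assumes "is_functor C D Fo Fa"
  shows "category C" and "category D" and "A \<in> Obj C \<Longrightarrow> Fo A \<in> Obj D"
    and "f \<in> Arr C \<Longrightarrow> Fa f \<in> Arr D" and "f \<in> Arr C \<Longrightarrow> Dom D (Fa f) = Fo (Dom C f)"
    and "f \<in> Arr C \<Longrightarrow> Cod D (Fa f) = Fo (Cod C f)"
    and "A \<in> Obj C \<Longrightarrow> Fa (Ident C A) = Ident D (Fo A)"
    and "\<lbrakk>f \<in> Arr C; g \<in> Arr C; Cod C f = Dom C g\<rbrakk> \<Longrightarrow> Fa (g \<cdot>\<^bsub>C\<^esub> f) = Fa g \<cdot>\<^bsub>D\<^esub> Fa f"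
  using assms by (simp_all add: is_functor_def in_hom)

lemma functorI:
  assumes "category C" "category D" "\<And>A. A \<in> Obj C \<Longrightarrow> Fo A \<in> Obj D"
    and "\<And>f. f \<in> Arr C \<Longrightarrow> Fa f \<in> Arr D"
    and "\<And>f. f \<in> Arr C \<Longrightarrow> Dom D (Fa f) = Fo (Dom C f)"
    and "\<And>f. f \<in> Arr C \<Longrightarrow> Cod D (Fa f) = Fo (Cod C f)"
    and "\<And>A. A \<in> Obj C \<Longrightarrow> Fa (Ident C A) = Ident D (Fo A)"
    and "\<And>f g. \<lbrakk>f \<in> Arr C; g \<in> Arr C; Cod C f = Dom C g\<rbrakk> \<Longrightarrow> Fa (g \<cdot>\<^bsub>C\<^esub> f) = Fa g \<cdot>\<^bsub>D\<^esub> Fa f"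
  shows "is_functor C D Fo Fa"
  using assms by (simp add: is_functor_def in_hom)

lemma functor_iso:
  assumes F: "is_functor C D Fo Fa" and s: "iso C s"
  shows "iso D (Fa s)"
proof -
  interpret C: category C by (rule functorD[OF F])
  obtain r where r: "s \<in> Arr C" "r \<in> Arr C" "Dom C r = Cod C s" "Cod C r = Dom C s"
    "r \<cdot>\<^bsub>C\<^esub> s = Ident C (Dom C s)" "s \<cdot>\<^bsub>C\<^esub> r = Ident C (Cod C s)"
    using s by (rule C.isoE)
  have "Fa r \<cdot>\<^bsub>D\<^esub> Fa s = Ident D (Fo (Dom C s))"
    using r functorD(8)[OF F, of s r] functorD(7)[OF F, of "Dom C s"] by simp
  moreover have "Fa s \<cdot>\<^bsub>D\<^esub> Fa r = Ident D (Fo (Cod C s))"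
    using r functorD(8)[OF F, of r s] functorD(7)[OF F, of "Cod C s"] by simp
  ultimately show ?thesis
    using r by (intro isoI[of _ _ "Fa r"]) (simp_all add: functorD(4-6)[OF F])
qed

lemma functor_comp:
  assumes F: "is_functor C D Fo Fa" and G: "is_functor D E Go Ga"
  shows "is_functor C E (\<lambda>A. Go (Fo A)) (\<lambda>f. Ga (Fa f))"
  by (rule functorI) (simp_all add: functorD[OF F] functorD[OF G])

text \<open>All notions of limit type are handled as colimits in the opposite category.  The type is
  that of plain categories, so that the opposite of a small index category is again one and
  \<open>opcat\<close> is an involution on these.\<close>

definition opcat :: "('o, 'a, 'm) cat_scheme \<Rightarrow> ('o, 'a) cat" where
  "opcat C = \<lparr>Obj = Obj C, Arr = Arr C, Dom = Cod C, Cod = Dom C, Ident = Ident C,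
     Comp = (\<lambda>g f. f \<cdot>\<^bsub>C\<^esub> g)\<rparr>"

lemma opcat_simps [simp]:
  "Obj (opcat C) = Obj C" "Arr (opcat C) = Arr C" "Dom (opcat C) = Cod C" "Cod (opcat C) = Dom C"
  "Ident (opcat C) = Ident C" "Comp (opcat C) g f = f \<cdot>\<^bsub>C\<^esub> g" "hom (opcat C) A B = hom C B A"
  by (auto simp: opcat_def hom_def)

lemma opcat_opcat [simp]: "opcat (opcat (C :: ('o, 'a) cat)) = C"
  by (simp add: opcat_def)

lemma category_opcat [simp]:
  assumes "category C"
  shows "category (opcat C)"
proof -
  interpret category C by fact
  show ?thesis
    by unfold_locales (auto simp: in_hom comp_assoc_arr)
qed

lemma iso_opcat [simp]: "iso (opcat C) f \<longleftrightarrow> iso C f"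
  unfolding iso_def by auto

lemma functor_opcat: "is_functor C D Fo Fa \<Longrightarrow> is_functor (opcat C) (opcat D) Fo Fa"
  by (rule functorI) (simp_all add: functorD)

lemma is_limit_opcat: "is_limit J C Fo Fa X p \<longleftrightarrow> is_colimit (opcat J) (opcat C) Fo Fa X p"
  unfolding is_limit_def is_colimit_def is_cone_def is_cocone_def by simp

lemma is_pullback_opcat: "is_pullback C f g p q \<longleftrightarrow> is_pushout (opcat C) f g p q"
  unfolding is_pullback_def is_pushout_def
  by (simp add: eq_commute[of "Dom C f" "Cod C p"] eq_commute[of "Dom C g" "Cod C q"])

lemma parallel_opcat [simp]: "parallel (opcat C) f g \<longleftrightarrow> parallel C f g"
  unfolding parallel_def by auto

lemma is_equalizer_opcat: "is_equalizer C f g e \<longleftrightarrow> is_coequalizer (opcat C) f g e"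
proof (cases "parallel C f g \<and> Cod C e = Dom C f")
  case True
  then show ?thesis
    unfolding is_equalizer_def is_coequalizer_def by (simp add: parallel_def)
next
  case False
  then show ?thesis
    unfolding is_equalizer_def is_coequalizer_def by (auto simp: parallel_def)
qed

lemma is_product_opcat: "is_product C I A P p \<longleftrightarrow> is_coproduct (opcat C) I A P p"
  unfolding is_product_def is_coproduct_def by simp

lemma is_product_map_opcat: "is_product_map C I s m \<longleftrightarrow> is_coproduct_map (opcat C) I s m"
  unfolding is_product_map_def is_coproduct_map_def is_product_opcat opcat_simps by blast

lemma small_cat_opcat [simp]: "small_cat \<kappa> J \<Longrightarrow> small_cat \<kappa> (opcat J)"
  unfolding small_cat_def by simp

lemma complete_opcat: "complete TYPE('u) C \<Longrightarrow> cocomplete TYPE('u) (opcat C)"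
  if "category C"
  unfolding complete_def cocomplete_def
proof (intro allI impI)
  fix J :: "('u, 'u) cat" and Fo Fa
  assume lim: "\<forall>(J :: ('u, 'u) cat) Fo Fa. is_functor J C Fo Fa \<longrightarrow> (\<exists>X p. is_limit J C Fo Fa X p)"
    and F: "is_functor J (opcat C) Fo Fa"
  have "is_functor (opcat J) C Fo Fa"
    using functor_opcat[OF F] that unfolding is_functor_def by simp
  with lim have "\<exists>X p. is_limit (opcat J) C Fo Fa X p" by blast
  then show "\<exists>X c. is_colimit J (opcat C) Fo Fa X c"
    by (simp add: is_limit_opcat)
qed

section \<open>Coproducts, coequalizers and colimits\<close>

lemma ex1_eq: "\<lbrakk>\<exists>!x. P x; P a; P b\<rbrakk> \<Longrightarrow> a = b"
  by blast

context category
begin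

lemma coequalizerD:
  assumes "is_coequalizer C f g q"
  shows "f \<in> Arr C" "g \<in> Arr C" "q \<in> Arr C" "Dom C f = Dom C g" "Cod C f = Cod C g"
    "Dom C q = Cod C g" "q \<cdot> f = q \<cdot> g"
  using assms unfolding is_coequalizer_def parallel_def by auto

lemma coequalizerI:
  assumes "f \<in> Arr C" "g \<in> Arr C" "q \<in> Arr C" "Dom C f = Dom C g" "Cod C f = Cod C g"
    "Dom C q = Cod C g" "q \<cdot> f = q \<cdot> g"
    and ex: "\<And>a. \<lbrakk>a \<in> Arr C; Dom C a = Cod C g; a \<cdot> f = a \<cdot> g\<rbrakk>
      \<Longrightarrow> \<exists>h \<in> Arr C. Dom C h = Cod C q \<and> Cod C h = Cod C a \<and> h \<cdot> q = a"
    and un: "\<And>h h'. \<lbrakk>h \<in> Arr C; h' \<in> Arr C; Dom C h = Cod C q; Dom C h' = Cod C q; Cod C h = Cod C h';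
        h \<cdot> q = h' \<cdot> q\<rbrakk> \<Longrightarrow> h = h'"
  shows "is_coequalizer C f g q"
  unfolding is_coequalizer_def parallel_def
proof (intro conjI allI ballI impI)
  fix Q a
  assume a: "a \<in> hom C (Cod C f) Q" "a \<cdot> f = a \<cdot> g"
  then obtain h where "h \<in> Arr C" "Dom C h = Cod C q" "Cod C h = Cod C a" "h \<cdot> q = a"
    using ex[of a] assms(5) by (auto simp: in_hom)
  then show "\<exists>!h. h \<in> hom C (Cod C q) Q \<and> h \<cdot> q = a"
    using a by (intro ex1I[of _ h]) (simp add: in_hom, rule un, auto simp: in_hom)
qed (use assms(1-7) in auto)

lemma coequalizer_ex:
  assumes "is_coequalizer C f g q" "a \<in> Arr C" "Dom C a = Cod C g" "a \<cdot> f = a \<cdot> g"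
  obtains h where "h \<in> Arr C" "Dom C h = Cod C q" "Cod C h = Cod C a" "h \<cdot> q = a"
proof -
  have "a \<in> hom C (Cod C f) (Cod C a)" using assms coequalizerD[OF assms(1)] by (simp add: in_hom)
  moreover have "\<forall>Q. \<forall>a \<in> hom C (Cod C f) Q. a \<cdot> f = a \<cdot> g \<longrightarrow> (\<exists>!h. h \<in> hom C (Cod C q) Q \<and> h \<cdot> q = a)"
    using assms(1) by (simp add: is_coequalizer_def)
  ultimately have "\<exists>!h. h \<in> hom C (Cod C q) (Cod C a) \<and> h \<cdot> q = a"
    using assms(4) by blast
  then obtain h where "h \<in> hom C (Cod C q) (Cod C a)" "h \<cdot> q = a" by blast
  then show ?thesis by (intro that[of h]) (simp_all add: in_hom)
qed

lemma coequalizer_unique: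
  assumes q: "is_coequalizer C f g q" and h: "h \<in> Arr C" "h' \<in> Arr C" "Dom C h = Cod C q"
    "Dom C h' = Cod C q" "Cod C h = Cod C h'" "h \<cdot> q = h' \<cdot> q"
  shows "h = h'"
proof -
  note D = coequalizerD[OF q]
  have "h' \<cdot> q \<in> hom C (Cod C f) (Cod C h')" using D h by (simp add: in_hom)
  moreover have "(h' \<cdot> q) \<cdot> f = (h' \<cdot> q) \<cdot> g"
    using D h by (simp add: comp_assoc_arr)
  moreover have "\<forall>Q. \<forall>a \<in> hom C (Cod C f) Q. a \<cdot> f = a \<cdot> g \<longrightarrow> (\<exists>!h. h \<in> hom C (Cod C q) Q \<and> h \<cdot> q = a)"
    using q by (simp add: is_coequalizer_def)
  ultimately have "\<exists>!k. k \<in> hom C (Cod C q) (Cod C h') \<and> k \<cdot> q = h' \<cdot> q"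
    by blast
  then show ?thesis by (rule ex1_eq) (use h in \<open>simp_all add: in_hom\<close>)
qed

text \<open>Composing both arrows with the same isomorphism does not change which maps coequalize them,
  up to that isomorphism.  This will turn a pair of fractions into a pair of numerators.\<close>

lemma coequalizer_precomp_iso:
  assumes q: "is_coequalizer C (s \<cdot> f) (s \<cdot> g) q" and s: "iso C s"
    and f: "f \<in> Arr C" "g \<in> Arr C" "Dom C f = Dom C g" "Cod C f = Dom C s" "Cod C g = Dom C s"
  shows "is_coequalizer C f g (q \<cdot> s)"
proof -
  obtain r where r: "s \<in> Arr C" "r \<in> Arr C" "Dom C r = Cod C s" "Cod C r = Dom C s"
    "r \<cdot> s = Ident C (Dom C s)" "s \<cdot> r = Ident C (Cod C s)"
    using s by (rule isoE)
  have D: "q \<in> Arr C" "Dom C q = Cod C s" "q \<cdot> (s \<cdot> f) = q \<cdot> (s \<cdot> g)"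
    using coequalizerD[OF q] f r by simp_all
  show ?thesis
  proof (rule coequalizerI)
    show "(q \<cdot> s) \<cdot> f = (q \<cdot> s) \<cdot> g" using D f r by (simp add: comp_assoc_arr)
    fix a assume a: "a \<in> Arr C" "Dom C a = Cod C g" "a \<cdot> f = a \<cdot> g"
    have "(a \<cdot> r) \<cdot> (s \<cdot> f) = a \<cdot> (r \<cdot> (s \<cdot> f))" "(a \<cdot> r) \<cdot> (s \<cdot> g) = a \<cdot> (r \<cdot> (s \<cdot> g))"
      using a(1,2) f r(1-4) by (simp_all add: comp_assoc_arr)
    moreover have "r \<cdot> (s \<cdot> f) = f" "r \<cdot> (s \<cdot> g) = g"
      using f r(1-4) by (simp_all add: comp_rewrite[OF r(5)])
    ultimately have e: "(a \<cdot> r) \<cdot> (s \<cdot> f) = (a \<cdot> r) \<cdot> (s \<cdot> g)" using a(3) by simp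
    obtain k where k: "k \<in> Arr C" "Dom C k = Cod C q" "Cod C k = Cod C (a \<cdot> r)" "k \<cdot> q = a \<cdot> r"
      by (rule coequalizer_ex[OF q _ _ e]) (use a(1,2) f r in simp_all)
    have "k \<cdot> (q \<cdot> s) = (a \<cdot> r) \<cdot> s" using k D r by (intro comp_rewrite) simp_all
    also have "\<dots> = a" using a(1,2) f r by (simp add: comp_assoc_arr)
    finally show "\<exists>k \<in> Arr C. Dom C k = Cod C (q \<cdot> s) \<and> Cod C k = Cod C a \<and> k \<cdot> (q \<cdot> s) = a"
      using k D r a f by (intro bexI[of _ k]) simp_all
  next
    fix k k' assume k: "k \<in> Arr C" "k' \<in> Arr C" "Dom C k = Cod C (q \<cdot> s)" "Dom C k' = Cod C (q \<cdot> s)"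
      "Cod C k = Cod C k'" "k \<cdot> (q \<cdot> s) = k' \<cdot> (q \<cdot> s)"
    have d: "Dom C k = Cod C q" "Dom C k' = Cod C q" using k(3,4) r D by simp_all
    have ks: "(k \<cdot> q) \<cdot> s = (k' \<cdot> q) \<cdot> s" using k(1,2,6) d r(1) D(1,2) by (simp add: comp_assoc_arr)
    have "k \<cdot> q = k' \<cdot> q" by (rule iso_cancel_right[OF s ks]) (use k(1,2) d D in simp_all)
    then show "k = k'" using coequalizer_unique[OF q, of k k'] k(1,2,5) d by simp
  qed (use D f r in simp_all)
qed

lemma coproductD:
  assumes "is_coproduct C I A P c"
  shows "P \<in> Obj C" "i \<in> I \<Longrightarrow> c i \<in> Arr C" "i \<in> I \<Longrightarrow> Dom C (c i) = A i" "i \<in> I \<Longrightarrow> Cod C (c i) = P"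
    "i \<in> I \<Longrightarrow> A i \<in> Obj C"
proof -
  show "P \<in> Obj C" and 1: "i \<in> I \<Longrightarrow> c i \<in> Arr C" and 2: "i \<in> I \<Longrightarrow> Dom C (c i) = A i"
    and "i \<in> I \<Longrightarrow> Cod C (c i) = P"
    using assms unfolding is_coproduct_def in_hom by auto
  show "A i \<in> Obj C" if "i \<in> I" using dom_obj[OF 1[OF that]] 2[OF that] by simp
qed

lemma coproduct_ex:
  assumes "is_coproduct C I A P c" "Q \<in> Obj C"
    "\<And>i. i \<in> I \<Longrightarrow> q i \<in> Arr C" "\<And>i. i \<in> I \<Longrightarrow> Dom C (q i) = A i" "\<And>i. i \<in> I \<Longrightarrow> Cod C (q i) = Q"
  obtains h where "h \<in> Arr C" "Dom C h = P" "Cod C h = Q" "\<And>i. i \<in> I \<Longrightarrow> h \<cdot> c i = q i"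
proof -
  have "\<forall>i \<in> I. q i \<in> hom C (A i) Q" using assms by (simp add: in_hom)
  then obtain h where "h \<in> hom C P Q" "\<forall>i \<in> I. h \<cdot> c i = q i"
    using assms(1,2) unfolding is_coproduct_def by blast
  then show ?thesis by (intro that[of h]) (simp_all add: in_hom)
qed

lemma coproduct_unique:
  assumes P: "is_coproduct C I A P c" and h: "h \<in> Arr C" "h' \<in> Arr C" "Dom C h = P" "Dom C h' = P"
    "Cod C h = Cod C h'" "\<And>i. i \<in> I \<Longrightarrow> h \<cdot> c i = h' \<cdot> c i"
  shows "h = h'"
proof -
  note D = coproductD[OF P]
  have "\<forall>i \<in> I. h' \<cdot> c i \<in> hom C (A i) (Cod C h')" using D h by (simp add: in_hom)
  moreover have "\<forall>Q \<in> Obj C. \<forall>q. (\<forall>i \<in> I. q i \<in> hom C (A i) Q) \<longrightarrow>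
          (\<exists>!h. h \<in> hom C P Q \<and> (\<forall>i \<in> I. h \<cdot> c i = q i))"
    using P by (simp add: is_coproduct_def)
  ultimately have "\<exists>!k. k \<in> hom C P (Cod C h') \<and> (\<forall>i \<in> I. k \<cdot> c i = h' \<cdot> c i)"
    using h by auto
  then show ?thesis by (rule ex1_eq) (use h in \<open>simp_all add: in_hom\<close>)
qed

lemma coproductI:
  assumes "P \<in> Obj C" "\<And>i. i \<in> I \<Longrightarrow> c i \<in> Arr C" "\<And>i. i \<in> I \<Longrightarrow> Dom C (c i) = A i"
    "\<And>i. i \<in> I \<Longrightarrow> Cod C (c i) = P"
    and ex: "\<And>Q q. \<lbrakk>Q \<in> Obj C; \<And>i. i \<in> I \<Longrightarrow> q i \<in> Arr C; \<And>i. i \<in> I \<Longrightarrow> Dom C (q i) = A i;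
        \<And>i. i \<in> I \<Longrightarrow> Cod C (q i) = Q\<rbrakk>
      \<Longrightarrow> \<exists>h \<in> Arr C. Dom C h = P \<and> Cod C h = Q \<and> (\<forall>i \<in> I. h \<cdot> c i = q i)"
    and un: "\<And>h h'. \<lbrakk>h \<in> Arr C; h' \<in> Arr C; Dom C h = P; Dom C h' = P; Cod C h = Cod C h';
        \<And>i. i \<in> I \<Longrightarrow> h \<cdot> c i = h' \<cdot> c i\<rbrakk> \<Longrightarrow> h = h'"
  shows "is_coproduct C I A P c"
  unfolding is_coproduct_def
proof (intro conjI allI ballI impI)
  fix Q q
  assume a: "Q \<in> Obj C" "\<forall>i\<in>I. q i \<in> hom C (A i) Q"
  then obtain h where "h \<in> Arr C" "Dom C h = P" "Cod C h = Q" "\<forall>i \<in> I. h \<cdot> c i = q i"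
    using ex[of Q q] by (auto simp: in_hom)
  then show "\<exists>!h. h \<in> hom C P Q \<and> (\<forall>i \<in> I. h \<cdot> c i = q i)"
    using a by (intro ex1I[of _ h]) (simp add: in_hom, rule un, auto simp: in_hom)
qed (use assms(1-4) in \<open>auto simp: in_hom\<close>)

lemma coproduct_map_ex:
  assumes P: "is_coproduct C I (\<lambda>i. Dom C (s i)) P c" and Q: "is_coproduct C I (\<lambda>i. Cod C (s i)) Q d"
    and s: "\<And>i. i \<in> I \<Longrightarrow> s i \<in> Arr C"
  obtains m where "is_coproduct_map C I s m" "m \<in> Arr C" "Dom C m = P" "Cod C m = Q"
    "\<And>i. i \<in> I \<Longrightarrow> m \<cdot> c i = d i \<cdot> s i"
proof -
  note D = coproductD[OF P] coproductD[OF Q]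
  obtain m where m: "m \<in> Arr C" "Dom C m = P" "Cod C m = Q" "\<And>i. i \<in> I \<Longrightarrow> m \<cdot> c i = d i \<cdot> s i"
    by (rule coproduct_ex[OF P D(6), of "\<lambda>i. d i \<cdot> s i"]) (use D s in auto)
  moreover have "is_coproduct_map C I s m"
    unfolding is_coproduct_map_def in_hom using P Q m by blast
  ultimately show ?thesis using that by blast
qed

lemma colimitD:
  assumes "is_colimit J C Fo Fa X c"
  shows "X \<in> Obj C" "j \<in> Obj J \<Longrightarrow> c j \<in> Arr C" "j \<in> Obj J \<Longrightarrow> Dom C (c j) = Fo j"
    "j \<in> Obj J \<Longrightarrow> Cod C (c j) = X" "u \<in> Arr J \<Longrightarrow> c (Cod J u) \<cdot> Fa u = c (Dom J u)"
  using assms unfolding is_colimit_def is_cocone_def in_hom by auto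

lemma colimit_ex:
  assumes "is_colimit J C Fo Fa X c" "is_cocone J C Fo Fa Y d"
  obtains h where "h \<in> Arr C" "Dom C h = X" "Cod C h = Y" "\<And>j. j \<in> Obj J \<Longrightarrow> h \<cdot> c j = d j"
proof -
  obtain h where "h \<in> hom C X Y" "\<forall>j \<in> Obj J. h \<cdot> c j = d j"
    using assms unfolding is_colimit_def by blast
  then show ?thesis by (intro that[of h]) (simp_all add: in_hom)
qed

lemma colimit_arr_cong:
  assumes "\<And>u. u \<in> Arr J \<Longrightarrow> Fa u = Fa' u"
  shows "is_colimit J C Fo Fa X c \<longleftrightarrow> is_colimit J C Fo Fa' X c"
proof -
  have "is_cocone J C Fo Fa Y d \<longleftrightarrow> is_cocone J C Fo Fa' Y d" for Y d
    using assms by (simp add: is_cocone_def)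
  then show ?thesis by (simp add: is_colimit_def)
qed

lemma cocone_comp:
  assumes F: "is_functor J C Fo Fa" and d: "is_cocone J C Fo Fa X d"
    and h: "h \<in> Arr C" "Dom C h = X" "Cod C h = Y"
  shows "is_cocone J C Fo Fa Y (\<lambda>j. h \<cdot> d j)"
  unfolding is_cocone_def
proof (intro conjI ballI)
  interpret J: category J by (rule functorD[OF F])
  note D = d[unfolded is_cocone_def in_hom]
  fix u assume u: "u \<in> Arr J"
  then show "(h \<cdot> d (Cod J u)) \<cdot> Fa u = h \<cdot> d (Dom J u)"
    using D h functorD(4-6)[OF F, of u] by (simp add: comp_assoc_arr)
qed (use d h in \<open>auto simp: is_cocone_def in_hom\<close>)

lemma colimit_unique:
  assumes F: "is_functor J C Fo Fa" and X: "is_colimit J C Fo Fa X c"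
    and h: "h \<in> Arr C" "h' \<in> Arr C" "Dom C h = X" "Dom C h' = X"
    "Cod C h = Cod C h'" "\<And>j. j \<in> Obj J \<Longrightarrow> h \<cdot> c j = h' \<cdot> c j"
  shows "h = h'"
proof -
  have "is_cocone J C Fo Fa (Cod C h') (\<lambda>j. h' \<cdot> c j)"
    using X h by (intro cocone_comp[OF F, of X]) (auto simp: is_colimit_def)
  then have "\<exists>!k. k \<in> hom C X (Cod C h') \<and> (\<forall>j \<in> Obj J. k \<cdot> c j = h' \<cdot> c j)"
    using X unfolding is_colimit_def by simp
  then show ?thesis by (rule ex1_eq) (use h in \<open>simp_all add: in_hom\<close>)
qed

lemma colimitI:
  assumes F: "is_functor J C Fo Fa" and c: "is_cocone J C Fo Fa X c"
    and ex: "\<And>Y d. is_cocone J C Fo Fa Y d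
      \<Longrightarrow> \<exists>h \<in> Arr C. Dom C h = X \<and> Cod C h = Y \<and> (\<forall>j \<in> Obj J. h \<cdot> c j = d j)"
    and un: "\<And>h h'. \<lbrakk>h \<in> Arr C; h' \<in> Arr C; Dom C h = X; Dom C h' = X; Cod C h = Cod C h';
        \<And>j. j \<in> Obj J \<Longrightarrow> h \<cdot> c j = h' \<cdot> c j\<rbrakk> \<Longrightarrow> h = h'"
  shows "is_colimit J C Fo Fa X c"
  unfolding is_colimit_def
proof (intro conjI allI impI)
  fix Y d
  assume a: "is_cocone J C Fo Fa Y d"
  then obtain h where "h \<in> Arr C" "Dom C h = X" "Cod C h = Y" "\<forall>j \<in> Obj J. h \<cdot> c j = d j"
    using ex[of Y d] by auto
  then show "\<exists>!h. h \<in> hom C X Y \<and> (\<forall>j \<in> Obj J. h \<cdot> c j = d j)"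
    by (intro ex1I[of _ h]) (simp add: in_hom, rule un, auto simp: in_hom)
qed (rule c)

text \<open>The inverse is the comparison map in the other direction, as both composites respect the cocones.\<close>

lemma colimit_comparison_iso:
  assumes F: "is_functor J C Fo Fa" and X: "is_colimit J C Fo Fa X c" and Y: "is_colimit J C Fo Fa Y d"
    and h: "h \<in> Arr C" "Dom C h = X" "Cod C h = Y" "\<And>j. j \<in> Obj J \<Longrightarrow> h \<cdot> c j = d j"
  shows "iso C h"
proof -
  note D = colimitD[OF X] colimitD[OF Y]
  obtain k where k: "k \<in> Arr C" "Dom C k = Y" "Cod C k = X" "\<And>j. j \<in> Obj J \<Longrightarrow> k \<cdot> d j = c j"
    by (rule colimit_ex[OF Y]) (use X in \<open>auto simp: is_colimit_def\<close>)
  have "k \<cdot> h = Ident C X"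
    by (rule colimit_unique[OF F X]) (use h k D in \<open>simp_all add: comp_assoc_arr\<close>)
  moreover have "h \<cdot> k = Ident C Y"
    by (rule colimit_unique[OF F Y]) (use h k D in \<open>simp_all add: comp_assoc_arr\<close>)
  ultimately show ?thesis using h k by (intro isoI[of _ _ k]) simp_all
qed

lemma colimit_iso:
  assumes F: "is_functor J C Fo Fa" and X: "is_colimit J C Fo Fa X c"
    and h: "iso C h" "Dom C h = X" "Cod C h = Y" and d: "\<And>j. j \<in> Obj J \<Longrightarrow> h \<cdot> c j = d j"
  shows "is_colimit J C Fo Fa Y d"
proof -
  interpret J: category J by (rule functorD[OF F])
  note D = colimitD[OF X]
  obtain r where r: "h \<in> Arr C" "r \<in> Arr C" "Dom C r = Cod C h" "Cod C r = Dom C h"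
    "r \<cdot> h = Ident C (Dom C h)" "h \<cdot> r = Ident C (Cod C h)"
    using h(1) by (rule isoE)
  have d': "j \<in> Obj J \<Longrightarrow> d j = h \<cdot> c j" for j using d by simp
  have rd: "r \<cdot> d j = c j" if "j \<in> Obj J" for j
    using that D r h by (simp add: d' comp_rewrite[OF r(5)])
  show ?thesis
  proof (rule colimitI[OF F])
    have "is_cocone J C Fo Fa Y (\<lambda>j. h \<cdot> c j)"
      using X h r by (intro cocone_comp[OF F, of X]) (auto simp: is_colimit_def)
    then show "is_cocone J C Fo Fa Y d"
      unfolding is_cocone_def using d by simp
    fix Z e assume "is_cocone J C Fo Fa Z e"
    then obtain k where k: "k \<in> Arr C" "Dom C k = X" "Cod C k = Z" "\<And>j. j \<in> Obj J \<Longrightarrow> k \<cdot> c j = e j"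
      using colimit_ex[OF X] by blast
    have "(k \<cdot> r) \<cdot> d j = e j" if "j \<in> Obj J" for j
    proof -
      have "(k \<cdot> r) \<cdot> d j = k \<cdot> (r \<cdot> d j)"
        using that k r h D by (intro comp_assoc_arr) (simp_all add: d')
      then show ?thesis using that k rd by simp
    qed
    then show "\<exists>k \<in> Arr C. Dom C k = Y \<and> Cod C k = Z \<and> (\<forall>j \<in> Obj J. k \<cdot> d j = e j)"
      using k r h by (intro bexI[of _ "k \<cdot> r"]) simp_all
  next
    fix k k' assume k: "k \<in> Arr C" "k' \<in> Arr C" "Dom C k = Y" "Dom C k' = Y" "Cod C k = Cod C k'"
      "\<And>j. j \<in> Obj J \<Longrightarrow> k \<cdot> d j = k' \<cdot> d j"
    have *: "(k \<cdot> h) \<cdot> c j = (k' \<cdot> h) \<cdot> c j" if "j \<in> Obj J" for j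
      using that k(1-5) k(6)[OF that] r(1) h(2,3) D(1-4) by (simp add: d' comp_assoc_arr)
    have "k \<cdot> h = k' \<cdot> h"
      by (rule colimit_unique[OF F X]) (use k(1-5) r(1) h(2,3) * in simp_all)
    then show "k = k'"
      by (rule iso_cancel_right[OF h(1)]) (use k h in simp_all)
  qed
qed

end

subsection \<open>Discrete diagrams and parallel pairs\<close>

definition discrete_cat :: "'u set \<Rightarrow> ('u, 'u) cat" where
  "discrete_cat I = \<lparr>Obj = I, Arr = I, Dom = id, Cod = id, Ident = id, Comp = (\<lambda>g f. f)\<rparr>"

text \<open>The objects are \<open>x\<close> and \<open>y\<close>, which also serve as names of their identities; the two
  parallel arrows \<open>x \<rightarrow> y\<close> are \<open>a\<close> and \<open>b\<close>.\<close>

definition parallel_pair_cat :: "'u \<Rightarrow> 'u \<Rightarrow> 'u \<Rightarrow> 'u \<Rightarrow> ('u, 'u) cat" where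
  "parallel_pair_cat x y a b = \<lparr>Obj = {x, y}, Arr = {x, y, a, b},
     Dom = (\<lambda>u. if u = y then y else x), Cod = (\<lambda>u. if u = x then x else y), Ident = id,
     Comp = (\<lambda>g f. if g \<in> {x, y} then f else g)\<rparr>"

lemma discrete_cat_category: "category (discrete_cat I)"
  by unfold_locales (auto simp: discrete_cat_def in_hom)

lemma parallel_pair_cat_category:
  "distinct [x, y, a, b] \<Longrightarrow> category (parallel_pair_cat x y a b)"
  by unfold_locales (auto simp: parallel_pair_cat_def in_hom split: if_splits)

lemma small_discrete_cat: "|I| <o \<kappa> \<Longrightarrow> small_cat \<kappa> (discrete_cat I)"
  unfolding small_cat_def using discrete_cat_category by (simp add: discrete_cat_def)

lemma small_parallel_pair_cat:
  assumes "regular_cardinal \<kappa>" "distinct [x, y, a, b]"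
  shows "small_cat \<kappa> (parallel_pair_cat x y a b)"
proof -
  have "|{x, y, a, b}| <o \<kappa>"
    using assms(1) by (intro finite_ordLess_infinite card_of_Well_order)
      (auto simp: regular_cardinal_def card_order_on_def Field_card_of)
  then show ?thesis
    unfolding small_cat_def using parallel_pair_cat_category[OF assms(2)] by (simp add: parallel_pair_cat_def)
qed

lemma small_cat_obj:
  assumes "small_cat \<kappa> J"
  shows "|Obj J| <o \<kappa>" and "|Arr J| <o \<kappa>"
proof -
  interpret category J using assms by (simp add: small_cat_def)
  show 1: "|Arr J| <o \<kappa>" using assms by (simp add: small_cat_def)
  have "inj_on (Ident J) (Obj J)" by (rule inj_on_inverseI[of _ "Dom J"]) simp
  then have "|Obj J| \<le>o |Arr J|" using card_of_ordLeq[of "Obj J" "Arr J"] by auto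
  then show "|Obj J| <o \<kappa>" using 1 by (rule ordLeq_ordLess_trans)
qed

context category
begin

lemma discrete_functor:
  assumes "\<And>i. i \<in> I \<Longrightarrow> A i \<in> Obj C" "\<And>i. i \<in> I \<Longrightarrow> Fa i = Ident C (A i)"
  shows "is_functor (discrete_cat I) C A Fa"
  by (rule functorI[OF discrete_cat_category category_axioms])
    (use assms in \<open>auto simp: discrete_cat_def\<close>)

lemma discrete_colimit:
  assumes "\<And>i. i \<in> I \<Longrightarrow> A i \<in> Obj C" "\<And>i. i \<in> I \<Longrightarrow> Fa i = Ident C (A i)"
  shows "is_colimit (discrete_cat I) C A Fa P c \<longleftrightarrow> is_coproduct C I A P c"
proof -
  have *: "is_cocone (discrete_cat I) C A Fa P c \<longleftrightarrow> P \<in> Obj C \<and> (\<forall>i \<in> I. c i \<in> hom C (A i) P)" for P c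
    using assms by (auto simp: is_cocone_def discrete_cat_def in_hom)
  define E where "E Y d \<longleftrightarrow> (\<exists>!h. h \<in> hom C P Y \<and> (\<forall>i \<in> I. h \<cdot> c i = d i))" for Y d
  have "is_colimit (discrete_cat I) C A Fa P c \<longleftrightarrow> is_cocone (discrete_cat I) C A Fa P c
      \<and> (\<forall>Y d. is_cocone (discrete_cat I) C A Fa Y d \<longrightarrow> E Y d)"
    by (simp add: is_colimit_def E_def discrete_cat_def)
  moreover have "is_coproduct C I A P c \<longleftrightarrow> P \<in> Obj C \<and> (\<forall>i \<in> I. c i \<in> hom C (A i) P)
      \<and> (\<forall>Q \<in> Obj C. \<forall>q. (\<forall>i \<in> I. q i \<in> hom C (A i) Q) \<longrightarrow> E Q q)"
    by (simp add: is_coproduct_def E_def)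
  ultimately show ?thesis unfolding * by blast
qed

lemma parallel_pair_functor:
  assumes "distinct [x, y, a, b]" "parallel C f g"
    and F: "Fo x = Dom C f" "Fo y = Cod C f" "Fa x = Ident C (Dom C f)" "Fa y = Ident C (Cod C f)"
      "Fa a = f" "Fa b = g"
  shows "is_functor (parallel_pair_cat x y a b) C Fo Fa"
  by (rule functorI[OF parallel_pair_cat_category[OF assms(1)] category_axioms])
    (use assms in \<open>auto simp: parallel_pair_cat_def parallel_def split: if_splits\<close>)

lemma parallel_pair_cocone:
  assumes "distinct [x, y, a, b]" "parallel C f g"
    and F: "Fo x = Dom C f" "Fo y = Cod C f" "Fa x = Ident C (Dom C f)" "Fa y = Ident C (Cod C f)"
      "Fa a = f" "Fa b = g"
  shows "is_cocone (parallel_pair_cat x y a b) C Fo Fa X c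
    \<longleftrightarrow> c y \<in> hom C (Cod C f) X \<and> c x = c y \<cdot> f \<and> c y \<cdot> f = c y \<cdot> g"
  using assms by (auto simp: is_cocone_def parallel_pair_cat_def in_hom parallel_def)

lemma parallel_pair_colimit:
  assumes "distinct [x, y, a, b]" "parallel C f g"
    and F: "Fo x = Dom C f" "Fo y = Cod C f" "Fa x = Ident C (Dom C f)" "Fa y = Ident C (Cod C f)"
      "Fa a = f" "Fa b = g"
  shows "is_colimit (parallel_pair_cat x y a b) C Fo Fa X c
    \<longleftrightarrow> is_coequalizer C f g (c y) \<and> Cod C (c y) = X \<and> c x = c y \<cdot> f" (is "?l \<longleftrightarrow> ?r")
proof -
  note F' = parallel_pair_functor[OF assms]
  note coc = parallel_pair_cocone[OF assms]
  have ob: "Obj (parallel_pair_cat x y a b) = {x, y}" by (simp add: parallel_pair_cat_def)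
  have p: "f \<in> Arr C" "g \<in> Arr C" "Dom C f = Dom C g" "Cod C f = Cod C g"
    using assms(2) by (auto simp: parallel_def)
  have xy: "x \<noteq> y" using assms(1) by simp
  show ?thesis
  proof
    assume l: ?l
    then have "is_cocone (parallel_pair_cat x y a b) C Fo Fa X c" by (simp add: is_colimit_def)
    then have c: "c y \<in> hom C (Cod C f) X" "c x = c y \<cdot> f" "c y \<cdot> f = c y \<cdot> g" by (simp_all add: coc)
    have "is_coequalizer C f g (c y)"
    proof (rule coequalizerI)
      fix d assume d: "d \<in> Arr C" "Dom C d = Cod C g" "d \<cdot> f = d \<cdot> g"
      have "is_cocone (parallel_pair_cat x y a b) C Fo Fa (Cod C d) (\<lambda>j. if j = y then d else d \<cdot> f)"
        unfolding coc using d xy p by (simp add: in_hom)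
      from colimit_ex[OF l this] obtain h where "h \<in> Arr C" "Dom C h = X" "Cod C h = Cod C d"
        "\<And>j. j \<in> {x, y} \<Longrightarrow> h \<cdot> c j = (if j = y then d else d \<cdot> f)" unfolding ob by blast
      moreover from this(4)[of y] have "h \<cdot> c y = d" by simp
      ultimately
      show "\<exists>h\<in>Arr C. Dom C h = Cod C (c y) \<and> Cod C h = Cod C d \<and> h \<cdot> c y = d"
        using c by (auto simp: in_hom)
    next
      fix h h' assume h: "h \<in> Arr C" "h' \<in> Arr C" "Dom C h = Cod C (c y)" "Dom C h' = Cod C (c y)"
        "Cod C h = Cod C h'" "h \<cdot> c y = h' \<cdot> c y"
      have "h \<cdot> (c y \<cdot> f) = (h \<cdot> c y) \<cdot> f" "h' \<cdot> (c y \<cdot> f) = (h' \<cdot> c y) \<cdot> f"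
        using h(1-5) c(1) p by (simp_all add: in_hom comp_assoc_arr)
      then have "h \<cdot> c j = h' \<cdot> c j" if "j \<in> {x, y}" for j
        using that h(6) c(2) by auto
      note eq = this[folded ob]
      show "h = h'"
        by (rule colimit_unique[OF F' l]) (use h c eq in \<open>simp_all add: in_hom\<close>)
    qed (use c p in \<open>auto simp: in_hom\<close>)
    then show ?r using c by (simp add: in_hom)
  next
    assume r: ?r
    then have q: "is_coequalizer C f g (c y)" by simp
    note D = coequalizerD[OF q]
    show ?l
    proof (rule colimitI[OF F'])
      show "is_cocone (parallel_pair_cat x y a b) C Fo Fa X c"
        unfolding coc using r D by (simp add: in_hom)
      fix Y d assume d: "is_cocone (parallel_pair_cat x y a b) C Fo Fa Y d"
      then obtain h where h: "h \<in> Arr C" "Dom C h = Cod C (c y)" "Cod C h = Cod C (d y)" "h \<cdot> c y = d y"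
        using coequalizer_ex[OF q, of "d y"] D unfolding coc in_hom by metis
      then have "h \<cdot> (c y \<cdot> f) = d y \<cdot> f"
        using D by (intro comp_rewrite) simp_all
      then show "\<exists>h \<in> Arr C. Dom C h = X \<and> Cod C h = Y 
          \<and> (\<forall>j \<in> Obj (parallel_pair_cat x y a b). h \<cdot> c j = d j)"
        using h d r unfolding coc in_hom ob by auto
    next
      fix h h' assume h: "h \<in> Arr C" "h' \<in> Arr C" "Dom C h = X" "Dom C h' = X"
        "Cod C h = Cod C h'" "\<And>j. j \<in> Obj (parallel_pair_cat x y a b) \<Longrightarrow> h \<cdot> c j = h' \<cdot> c j"
      show "h = h'"
        by (rule coequalizer_unique[OF q]) (use r h(1-5) h(6)[of y] in \<open>auto simp: ob\<close>)
    qed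
  qed
qed

end

text \<open>The index category of parallel pairs has four arrows, so it fits into any infinite universe.\<close>

lemma infinite_obtains_four:
  assumes "infinite (UNIV :: 'u set)"
  obtains x y a b :: 'u where "distinct [x, y, a, b]"
proof -
  obtain X :: "'u set" where "finite X" "card X = 4"
    using infinite_arbitrarily_large[OF assms] by blast
  then obtain xs where xs: "set xs = X" "distinct xs" using finite_distinct_list by blast
  then have "length xs = 4" using \<open>card X = 4\<close> distinct_card by fastforce
  then obtain x y a b where "xs = [x, y, a, b]"
    by (auto simp: eval_nat_numeral length_Suc_conv)
  with xs show ?thesis using that by blast
qed

context category
begin

lemma coproduct_exists:
  fixes I :: "'u set"
  assumes "cocomplete TYPE('u) C" "\<And>i. i \<in> I \<Longrightarrow> A i \<in> Obj C"
  shows "\<exists>P c. is_coproduct C I A P c"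
proof -
  have "is_functor (discrete_cat I) C A (\<lambda>i. Ident C (A i))"
    using assms(2) by (intro discrete_functor) auto
  then show ?thesis
    using assms(1) discrete_colimit[of I A "\<lambda>i. Ident C (A i)"] assms(2)
    unfolding cocomplete_def by metis
qed

lemma coequalizer_exists:
  assumes "cocomplete TYPE('u) C" "infinite (UNIV :: 'u set)" "parallel C f g"
  shows "\<exists>q. is_coequalizer C f g q"
proof -
  obtain x y a b :: 'u where d: "distinct [x, y, a, b]" using infinite_obtains_four[OF assms(2)] .
  define Fo where "Fo = (\<lambda>j. if j = x then Dom C f else Cod C f)"
  define Fa where "Fa = (\<lambda>u. if u = x then Ident C (Dom C f) else if u = y then Ident C (Cod C f)
    else if u = a then f else g)"
  have F: "Fo x = Dom C f" "Fo y = Cod C f" "Fa x = Ident C (Dom C f)" "Fa y = Ident C (Cod C f)"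
      "Fa a = f" "Fa b = g"
    using d by (auto simp: Fo_def Fa_def)
  from parallel_pair_functor[OF d assms(3) F] assms(1)
  obtain X c where "is_colimit (parallel_pair_cat x y a b) C Fo Fa X c"
    unfolding cocomplete_def by blast
  then show ?thesis using parallel_pair_colimit[OF d assms(3) F] by blast
qed

text \<open>A pushout is the coequalizer of the two composites into the coproduct of the targets.\<close>

lemma pushout_exists:
  assumes "cocomplete TYPE('u) C" "infinite (UNIV :: 'u set)" "f \<in> Arr C" "g \<in> Arr C"
    "Dom C f = Dom C g"
  shows "\<exists>i j. is_pushout C f g i j"
proof -
  obtain x y a b :: 'u where d: "distinct [x, y, a, b]" using infinite_obtains_four[OF assms(2)] .
  define A where "A = (\<lambda>j. if j = x then Cod C f else Cod C g)"
  have "\<exists>P c. is_coproduct C {x, y} A P c"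
    using assms by (intro coproduct_exists) (auto simp: A_def)
  then obtain P c where P: "is_coproduct C {x, y} A P c" by blast
  have c: "c x \<in> Arr C" "c y \<in> Arr C" "Dom C (c x) = Cod C f" "Dom C (c y) = Cod C g"
    "Cod C (c x) = P" "Cod C (c y) = P" "P \<in> Obj C"
    using coproductD[OF P] d by (auto simp: A_def)
  have "parallel C (c x \<cdot> f) (c y \<cdot> g)"
    using c assms by (simp add: parallel_def)
  then obtain q where q: "is_coequalizer C (c x \<cdot> f) (c y \<cdot> g) q"
    using coequalizer_exists[OF assms(1,2)] by blast
  have D: "q \<in> Arr C" "Dom C q = P" "q \<cdot> (c x \<cdot> f) = q \<cdot> (c y \<cdot> g)"
    using coequalizerD[OF q] c assms by auto
  have "is_pushout C f g (q \<cdot> c x) (q \<cdot> c y)"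
    unfolding is_pushout_def
  proof (intro conjI allI ballI impI)
    show "(q \<cdot> c x) \<cdot> f = (q \<cdot> c y) \<cdot> g"
      using c D assms by (simp add: comp_assoc_arr)
    fix Q k l assume kl: "k \<in> hom C (Cod C f) Q" "l \<in> hom C (Cod C g) Q" "k \<cdot> f = l \<cdot> g"
    have kl': "k \<in> Arr C" "Dom C k = Cod C f" "l \<in> Arr C" "Dom C l = Cod C g" "Cod C l = Q" "Cod C k = Q"
      using kl by (auto simp: in_hom)
    define z where "z = (\<lambda>j. if j = x then k else l)"
    obtain h where h: "h \<in> Arr C" "Dom C h = P" "Cod C h = Q" "\<And>i. i \<in> {x, y} \<Longrightarrow> h \<cdot> c i = z i"
      by (rule coproduct_ex[OF P, of Q z]) (use d kl' in \<open>auto simp: A_def z_def\<close>)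
    have h2: "h \<cdot> c x = k" "h \<cdot> c y = l" using h(4)[of x] h(4)[of y] d by (auto simp: z_def)
    have "h \<cdot> (c x \<cdot> f) = k \<cdot> f" "h \<cdot> (c y \<cdot> g) = l \<cdot> g"
      using h h2 c assms by (auto intro: comp_rewrite)
    then have "h \<cdot> (c x \<cdot> f) = h \<cdot> (c y \<cdot> g)" using kl by simp
    then obtain m where m: "m \<in> Arr C" "Dom C m = Cod C q" "Cod C m = Cod C h" "m \<cdot> q = h"
      using coequalizer_ex[OF q h(1)] h c assms by auto
    show "\<exists>!h. h \<in> hom C (Cod C (q \<cdot> c x)) Q \<and> h \<cdot> q \<cdot> c x = k \<and> h \<cdot> q \<cdot> c y = l"
    proof (rule ex1I[of _ m])
      show "m \<in> hom C (Cod C (q \<cdot> c x)) Q \<and> m \<cdot> q \<cdot> c x = k \<and> m \<cdot> q \<cdot> c y = l"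
        using m h h2 c D by (simp add: in_hom comp_rewrite[OF m(4)])
      fix n assume n: "n \<in> hom C (Cod C (q \<cdot> c x)) Q \<and> n \<cdot> q \<cdot> c x = k \<and> n \<cdot> q \<cdot> c y = l"
      have n': "n \<in> Arr C" "Dom C n = Cod C q" "Cod C n = Q" using n c D by (auto simp: in_hom)
      have nq: "n \<cdot> q = h"
      proof (rule coproduct_unique[OF P])
        fix i assume "i \<in> {x, y}"
        then show "(n \<cdot> q) \<cdot> c i = h \<cdot> c i"
          using n n' c D h h2 by (auto simp: comp_assoc_arr)
      qed (use n' h D in auto)
      show "n = m"
        by (rule coequalizer_unique[OF q]) (use n' m h nq in auto)
    qed
  qed (use c D assms in auto)
  then show ?thesis by blast
qed

subsection \<open>Colimits as coequalizers of maps between coproducts\<close>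

text \<open>Here \<open>P\<close> is the coproduct of the objects of the diagram and \<open>Q\<close> the coproduct of the sources of
  its arrows; \<open>\<alpha>\<close> applies the arrow and \<open>\<beta>\<close> does not.  A map out of \<open>P\<close> is a family of maps out of
  the objects, and this family is a cocone exactly when the map coequalizes \<open>\<alpha>\<close> and \<open>\<beta>\<close>.  The
  equivalence serves in both directions: a given colimit is recognized as a coequalizer, and a
  coequalizer in another category as a colimit.\<close>

lemma colimit_iff_coequalizer:
  assumes F: "is_functor J C Fo Fa"
    and P: "is_coproduct C (Obj J) Fo P c"
    and Q: "is_coproduct C (Arr J) (\<lambda>u. Fo (Dom J u)) Q d"
    and \<alpha>: "\<alpha> \<in> Arr C" "Dom C \<alpha> = Q" "Cod C \<alpha> = P" "\<And>u. u \<in> Arr J \<Longrightarrow> \<alpha> \<cdot> d u = c (Cod J u) \<cdot> Fa u"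
    and \<beta>: "\<beta> \<in> Arr C" "Dom C \<beta> = Q" "Cod C \<beta> = P" "\<And>u. u \<in> Arr J \<Longrightarrow> \<beta> \<cdot> d u = c (Dom J u)"
    and q: "q \<in> Arr C" "Dom C q = P"
  shows "is_colimit J C Fo Fa (Cod C q) (\<lambda>j. q \<cdot> c j) \<longleftrightarrow> is_coequalizer C \<alpha> \<beta> q" (is "?l \<longleftrightarrow> ?r")
proof -
  interpret J: category J by (rule functorD[OF F])
  note DP = coproductD[OF P] and DQ = coproductD[OF Q]
  note DF = functorD(3-8)[OF F]
  have coc: "is_cocone J C Fo Fa (Cod C h) (\<lambda>j. h \<cdot> c j) \<longleftrightarrow> h \<cdot> \<alpha> = h \<cdot> \<beta>"
    if h: "h \<in> Arr C" "Dom C h = P" for h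
  proof -
    have 1: "(h \<cdot> \<alpha>) \<cdot> d u = (h \<cdot> c (Cod J u)) \<cdot> Fa u" "(h \<cdot> \<beta>) \<cdot> d u = h \<cdot> c (Dom J u)" if "u \<in> Arr J" for u
      using that h \<alpha> \<beta> DP DQ DF by (simp_all add: comp_assoc_arr)
    have "is_cocone J C Fo Fa (Cod C h) (\<lambda>j. h \<cdot> c j) \<longleftrightarrow>
        (\<forall>u \<in> Arr J. (h \<cdot> c (Cod J u)) \<cdot> Fa u = h \<cdot> c (Dom J u))"
      using h DP by (auto simp: is_cocone_def in_hom)
    also have "\<dots> \<longleftrightarrow> (\<forall>u \<in> Arr J. (h \<cdot> \<alpha>) \<cdot> d u = (h \<cdot> \<beta>) \<cdot> d u)" using 1 by auto
    also have "\<dots> \<longleftrightarrow> h \<cdot> \<alpha> = h \<cdot> \<beta>"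
    proof
      assume eq: "\<forall>u \<in> Arr J. (h \<cdot> \<alpha>) \<cdot> d u = (h \<cdot> \<beta>) \<cdot> d u"
      show "h \<cdot> \<alpha> = h \<cdot> \<beta>"
        by (rule coproduct_unique[OF Q]) (use h \<alpha>(1-3) \<beta>(1-3) eq in auto)
    qed simp
    finally show ?thesis .
  qed
  show ?thesis
  proof
    assume l: ?l
    show ?r
    proof (rule coequalizerI)
      show "q \<cdot> \<alpha> = q \<cdot> \<beta>" using l coc[OF q] by (simp add: is_colimit_def)
      fix h assume h: "h \<in> Arr C" "Dom C h = Cod C \<beta>" "h \<cdot> \<alpha> = h \<cdot> \<beta>"
      then have "is_cocone J C Fo Fa (Cod C h) (\<lambda>j. h \<cdot> c j)" using coc \<beta> by simp
      from colimit_ex[OF l this] obtain k where k: "k \<in> Arr C" "Dom C k = Cod C q" "Cod C k = Cod C h"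
        "\<And>j. j \<in> Obj J \<Longrightarrow> k \<cdot> q \<cdot> c j = h \<cdot> c j" by blast
      have "k \<cdot> q = h"
        by (rule coproduct_unique[OF P]) (use h k q \<beta> DP in \<open>simp_all add: comp_assoc_arr\<close>)
      then show "\<exists>k\<in>Arr C. Dom C k = Cod C q \<and> Cod C k = Cod C h \<and> k \<cdot> q = h" using k by auto
    next
      fix h h' assume h: "h \<in> Arr C" "h' \<in> Arr C" "Dom C h = Cod C q" "Dom C h' = Cod C q"
        "Cod C h = Cod C h'" "h \<cdot> q = h' \<cdot> q"
      have eq: "h \<cdot> q \<cdot> c j = h' \<cdot> q \<cdot> c j" if "j \<in> Obj J" for j
        using that h(1-5) q DP comp_assoc_arr[of "c j" q h] comp_assoc_arr[of "c j" q h'] h(6) by simp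
      show "h = h'" by (rule colimit_unique[OF F l]) (use h(1-5) eq in auto)
    qed (use \<alpha> \<beta> q in auto)
  next
    assume r: ?r
    show ?l
    proof (rule colimitI[OF F])
      show "is_cocone J C Fo Fa (Cod C q) (\<lambda>j. q \<cdot> c j)" using coc[OF q] coequalizerD[OF r] by simp
      fix Y e assume e: "is_cocone J C Fo Fa Y e"
      obtain h where h: "h \<in> Arr C" "Dom C h = P" "Cod C h = Y" "\<And>j. j \<in> Obj J \<Longrightarrow> h \<cdot> c j = e j"
        by (rule coproduct_ex[OF P, of Y e]) (use e in \<open>auto simp: is_cocone_def in_hom\<close>)
      have "is_cocone J C Fo Fa Y (\<lambda>j. h \<cdot> c j)" using e h(4) by (auto simp: is_cocone_def)
      then have "h \<cdot> \<alpha> = h \<cdot> \<beta>" using coc[of h] h by simp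
      then obtain k where k: "k \<in> Arr C" "Dom C k = Cod C q" "Cod C k = Cod C h" "k \<cdot> q = h"
        using coequalizer_ex[OF r, of h] h \<beta> by auto
      have "k \<cdot> q \<cdot> c j = e j" if "j \<in> Obj J" for j
        using that k q DP h by (simp add: comp_rewrite[OF k(4)])
      then show "\<exists>k\<in>Arr C. Dom C k = Cod C q \<and> Cod C k = Y \<and> (\<forall>j\<in>Obj J. k \<cdot> q \<cdot> c j = e j)"
        using k h by auto
    next
      fix h h' assume h: "h \<in> Arr C" "h' \<in> Arr C" "Dom C h = Cod C q" "Dom C h' = Cod C q"
        "Cod C h = Cod C h'" "\<And>j. j \<in> Obj J \<Longrightarrow> h \<cdot> q \<cdot> c j = h' \<cdot> q \<cdot> c j"
      have eq: "h \<cdot> q = h' \<cdot> q"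
        by (rule coproduct_unique[OF P]) (use h q DP in \<open>simp_all add: comp_assoc_arr\<close>)
      show "h = h'" by (rule coequalizer_unique[OF r]) (use h(1-5) eq in auto)
    qed
  qed
qed

lemma colimit_presentation:
  assumes F: "is_functor J C Fo Fa"
    and P: "is_coproduct C (Obj J) Fo P c"
    and Q: "is_coproduct C (Arr J) (\<lambda>u. Fo (Dom J u)) Q d"
  obtains \<alpha> \<beta> where "\<alpha> \<in> Arr C" "Dom C \<alpha> = Q" "Cod C \<alpha> = P"
      "\<And>u. u \<in> Arr J \<Longrightarrow> \<alpha> \<cdot> d u = c (Cod J u) \<cdot> Fa u"
      "\<beta> \<in> Arr C" "Dom C \<beta> = Q" "Cod C \<beta> = P" "\<And>u. u \<in> Arr J \<Longrightarrow> \<beta> \<cdot> d u = c (Dom J u)"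
proof -
  interpret J: category J by (rule functorD[OF F])
  note DP = coproductD[OF P] and DQ = coproductD[OF Q]
  note DF = functorD(3-8)[OF F]
  obtain \<alpha> where \<alpha>: "\<alpha> \<in> Arr C" "Dom C \<alpha> = Q" "Cod C \<alpha> = P"
      "\<And>u. u \<in> Arr J \<Longrightarrow> \<alpha> \<cdot> d u = c (Cod J u) \<cdot> Fa u"
    by (rule coproduct_ex[OF Q, of P "\<lambda>u. c (Cod J u) \<cdot> Fa u"]) (use DP DQ DF in auto)
  obtain \<beta> where \<beta>: "\<beta> \<in> Arr C" "Dom C \<beta> = Q" "Cod C \<beta> = P" "\<And>u. u \<in> Arr J \<Longrightarrow> \<beta> \<cdot> d u = c (Dom J u)"
    by (rule coproduct_ex[OF Q, of P "\<lambda>u. c (Dom J u)"]) (use DP DQ DF in auto)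
  show ?thesis using that \<alpha> \<beta> by blast
qed

end

section \<open>Multiplicative systems and the closure\<close>

text \<open>Left and right calculus of fractions together.  The assumptions are exchanged by passing to
  the opposite category.\<close>

locale multiplicative_system = category C
  for C :: "('o, 'a, 'm) cat_scheme" (structure) +
  fixes W :: "'a set"
  assumes W_arr: "s \<in> W \<Longrightarrow> s \<in> Arr C"
    and W_ident: "A \<in> Obj C \<Longrightarrow> Ident C A \<in> W"
    and W_comp: "\<lbrakk>s \<in> W; t \<in> W; Cod C s = Dom C t\<rbrakk> \<Longrightarrow> t \<cdot> s \<in> W"
    and left_ore: "\<lbrakk>s \<in> W; f \<in> Arr C; Dom C s = Dom C f\<rbrakk>
      \<Longrightarrow> \<exists>t \<in> W. \<exists>g \<in> Arr C. Dom C t = Cod C f \<and> Dom C g = Cod C s \<and> Cod C t = Cod C g \<and> t \<cdot> f = g \<cdot> s"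
    and left_cancel: "\<lbrakk>parallel C f g; s \<in> W; Cod C s = Dom C f; f \<cdot> s = g \<cdot> s\<rbrakk>
      \<Longrightarrow> \<exists>t \<in> W. Dom C t = Cod C f \<and> t \<cdot> f = t \<cdot> g"
    and right_ore: "\<lbrakk>s \<in> W; f \<in> Arr C; Cod C s = Cod C f\<rbrakk>
      \<Longrightarrow> \<exists>t \<in> W. \<exists>g \<in> Arr C. Cod C t = Dom C f \<and> Cod C g = Dom C s \<and> Dom C t = Dom C g \<and> f \<cdot> t = s \<cdot> g"
    and right_cancel: "\<lbrakk>parallel C f g; s \<in> W; Dom C s = Cod C f; s \<cdot> f = s \<cdot> g\<rbrakk>
      \<Longrightarrow> \<exists>t \<in> W. Cod C t = Dom C f \<and> f \<cdot> t = g \<cdot> t"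

lemma add_pullbacks_opcat: "add_pullbacks C T = add_pushouts (opcat C) T"
  by (simp add: add_pullbacks_def add_pushouts_def is_pullback_opcat)

lemma add_equalizer_maps_opcat: "add_equalizer_maps C T = add_coequalizer_maps (opcat C) T"
  unfolding add_equalizer_maps_def add_coequalizer_maps_def is_equalizer_opcat by simp blast

context category
begin

lemma pushout_ident: "s \<in> Arr C \<Longrightarrow> is_pushout C s (Ident C (Dom C s)) (Ident C (Cod C s)) s"
  unfolding is_pushout_def
proof (intro conjI allI ballI impI)
  fix Q a b
  assume s: "s \<in> Arr C" and ab: "a \<in> hom C (Cod C s) Q" "b \<in> hom C (Cod C (Ident C (Dom C s))) Q"
    "a \<cdot> s = b \<cdot> Ident C (Dom C s)"
  then have "b = a \<cdot> s" by (simp add: in_hom)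
  show "\<exists>!h. h \<in> hom C (Cod C (Ident C (Cod C s))) Q \<and> h \<cdot> Ident C (Cod C s) = a \<and> h \<cdot> s = b"
  proof (rule ex1I[of _ a])
    fix h assume "h \<in> hom C (Cod C (Ident C (Cod C s))) Q \<and> h \<cdot> Ident C (Cod C s) = a \<and> h \<cdot> s = b"
    then have "h \<in> hom C (Cod C s) Q" "h \<cdot> Ident C (Cod C s) = a" using s by simp_all
    then show "h = a" by (simp add: in_hom)
  qed (use ab(1) s \<open>b = a \<cdot> s\<close> in \<open>simp add: in_hom\<close>)
qed simp_all

text \<open>An arrow is its own pushout along an identity, so that closing under pushouts loses nothing.
  The same holds for pullbacks by duality.\<close>

lemma add_pushouts_increasing: "T \<subseteq> Arr C \<Longrightarrow> T \<subseteq> add_pushouts C T"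
  unfolding add_pushouts_def using pushout_ident by blast

lemma add_pushouts_arr: "add_pushouts C T \<subseteq> Arr C"
  unfolding add_pushouts_def is_pushout_def by blast

lemma add_coequalizer_maps_arr: "T \<subseteq> Arr C \<Longrightarrow> add_coequalizer_maps C T \<subseteq> Arr C"
  unfolding add_coequalizer_maps_def in_hom by blast

lemma coequalizer_ident: "f \<in> Arr C \<Longrightarrow> is_coequalizer C f f (Ident C (Cod C f))"
  by (rule coequalizerI) auto

text \<open>If \<open>f\<close> and \<open>g\<close> agree after precomposition with \<open>s\<close>, the identity is a coequalizer of
  \<open>f \<cdot> s\<close> and \<open>g \<cdot> s\<close>, so the canonical map of coequalizers is the coequalizer of \<open>f\<close> and \<open>g\<close>.\<close>

lemma coequalizer_in_add_coequalizer_maps: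
  assumes "parallel C f g" "s \<in> T" "s \<in> Arr C" "Cod C s = Dom C f" "f \<cdot> s = g \<cdot> s" "is_coequalizer C f g q"
  shows "q \<in> add_coequalizer_maps C T"
proof -
  have p: "f \<in> Arr C" "g \<in> Arr C" "Dom C f = Dom C g" "Cod C f = Cod C g"
    using assms(1) by (auto simp: parallel_def)
  have "is_coequalizer C (f \<cdot> s) (g \<cdot> s) (Ident C (Cod C f))"
    using coequalizer_ident[of "f \<cdot> s"] assms p by simp
  moreover have "q \<in> hom C (Cod C (Ident C (Cod C f))) (Cod C q)" "q \<cdot> Ident C (Cod C f) = q"
    using coequalizerD[OF assms(6)] p by (simp_all add: in_hom)
  ultimately show ?thesis
    unfolding add_coequalizer_maps_def using assms by blast
qed

end

subsection \<open>The stages of the closure\<close>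

lemma finite_comps_arr:
  assumes "category C" "T \<subseteq> Arr C" "t \<in> finite_comps C T"
  shows "t \<in> Arr C"
proof -
  interpret category C by fact
  from assms(3) show ?thesis by induction (use assms(2) in auto)
qed

context symmetric_monoidal_category
begin

lemma tensor_arr [simp]:
  assumes "f \<in> Arr M" "g \<in> Arr M"
  shows "f \<otimes> g \<in> Arr M" "Dom M (f \<otimes> g) = Dom M f \<otimes>\<^sub>o Dom M g" "Cod M (f \<otimes> g) = Cod M f \<otimes>\<^sub>o Cod M g"
  using tarr_hom[of f "Dom M f" "Cod M f" g "Dom M g" "Cod M g"] assms by (auto simp: in_hom)

lemma is_product_map_arr: "is_product_map M I s m \<or> is_coproduct_map M I s m \<Longrightarrow> m \<in> Arr M"
  unfolding is_product_map_def is_coproduct_map_def in_hom by auto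

text \<open>The successive collections of one step of the closure form an increasing chain; what is added
  at any of them is therefore still there at the end of the step.\<close>

lemma closure_step_parts:
  fixes \<kappa> :: "'u rel" and a :: 'u
  assumes "T \<subseteq> Arr M"
  defines "T1 \<equiv> add_pushouts M T"
  defines "T2 \<equiv> add_coequalizer_maps M T1"
  defines "T3 \<equiv> add_pullbacks M T2"
  defines "T4 \<equiv> add_equalizer_maps M T3"
  defines "T5 \<equiv> finite_comps M T4"
  defines "T6 \<equiv> add_products \<kappa> a M T5"
  shows "T \<subseteq> T1" "T1 \<subseteq> T2" "T2 \<subseteq> T3" "T3 \<subseteq> T4" "T4 \<subseteq> T5" "T5 \<subseteq> T6" "T6 \<subseteq> closure_step \<kappa> M a T"
    "closure_step \<kappa> M a T \<subseteq> Arr M"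
proof -
  interpret O: category "opcat M" by (rule category_opcat[OF category_axioms])
  show "T \<subseteq> T1" unfolding T1_def by (rule add_pushouts_increasing[OF assms(1)])
  have 1: "T1 \<subseteq> Arr M" unfolding T1_def by (rule add_pushouts_arr)
  show "T1 \<subseteq> T2" unfolding T2_def by (auto simp: add_coequalizer_maps_def)
  have 2: "T2 \<subseteq> Arr M" unfolding T2_def by (rule add_coequalizer_maps_arr[OF 1])
  show "T2 \<subseteq> T3" unfolding T3_def add_pullbacks_opcat using 2 by (intro O.add_pushouts_increasing) simp
  have 3: "T3 \<subseteq> Arr M" unfolding T3_def add_pullbacks_opcat using O.add_pushouts_arr by simp
  show "T3 \<subseteq> T4" unfolding T4_def by (auto simp: add_equalizer_maps_def)
  have 4: "T4 \<subseteq> Arr M"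
    unfolding T4_def add_equalizer_maps_opcat using O.add_coequalizer_maps_arr 3 by simp
  show "T4 \<subseteq> T5" unfolding T5_def by (auto intro: finite_comps.intros)
  have 5: "T5 \<subseteq> Arr M" unfolding T5_def using finite_comps_arr[OF category_axioms 4] by blast
  show "T5 \<subseteq> T6" unfolding T6_def by (auto simp: add_products_def)
  have 6: "T6 \<subseteq> Arr M" unfolding T6_def add_products_def using 5 is_product_map_arr by blast
  have step: "closure_step \<kappa> M a T = add_tensors M T6"
    unfolding closure_step_def T1_def T2_def T3_def T4_def T5_def T6_def ..
  show "T6 \<subseteq> closure_step \<kappa> M a T" unfolding step by (auto simp: add_tensors_def)
  show "closure_step \<kappa> M a T \<subseteq> Arr M" unfolding step using 6 by (auto simp: add_tensors_def)
qed

end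

text \<open>An infinite cardinal is a limit ordinal, so no stage is the last one.\<close>

lemma successor_exists:
  assumes "Card_order \<kappa>" "infinite (Field \<kappa>)" "b \<in> Field \<kappa>"
  obtains a where "a \<in> Field \<kappa>" "immediate_pred \<kappa> b a"
proof -
  have W: "Well_order \<kappa>" using assms(1) by (simp add: card_order_on_def)
  then have wf: "wf (\<kappa> - Id)" and tot: "Total \<kappa>" by (auto simp: order_on_defs)
  have "\<exists>a. a \<in> Field \<kappa> \<and> b \<in> underS \<kappa> a"
    using infinite_Card_order_limit[OF assms] by (auto simp: underS_def)
  then obtain a where a: "a \<in> {a \<in> Field \<kappa>. b \<in> underS \<kappa> a}"
    and min: "\<And>c. (c, a) \<in> \<kappa> - Id \<Longrightarrow> c \<notin> {a \<in> Field \<kappa>. b \<in> underS \<kappa> a}"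
    using wfE_min[OF wf, of _ "{a \<in> Field \<kappa>. b \<in> underS \<kappa> a}"] by blast
  have "(c, b) \<in> \<kappa>" if c: "c \<in> underS \<kappa> a" for c
  proof (rule ccontr)
    assume n: "(c, b) \<notin> \<kappa>"
    have cF: "c \<in> Field \<kappa>" using c by (auto simp: underS_def Field_def)
    have "c \<noteq> b"
      using n W assms(3) by (auto simp: order_on_defs refl_on_def)
    then have "b \<in> underS \<kappa> c"
      using n tot cF assms(3) by (auto simp: total_on_def underS_def)
    then show False using min[of c] c cF by (auto simp: underS_def)
  qed
  then show ?thesis using a that by (auto simp: immediate_pred_def)
qed

text \<open>A well-order shorter than \<open>\<kappa>\<close> is isomorphic to an initial segment of \<open>\<kappa>\<close>.\<close>

lemma small_index_set_below:
  assumes "Card_order \<kappa>" "|I| <o \<kappa>"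
  obtains b where "b \<in> Field \<kappa>" "\<exists>h. bij_betw h I (underS \<kappa> b)"
proof -
  have W: "Well_order \<kappa>" using assms(1) by (simp add: card_order_on_def)
  obtain b where b: "b \<in> Field \<kappa>" "|I| =o Restr \<kappa> (underS \<kappa> b)"
    using ordLess_iff_ordIso_Restr[OF W card_of_Well_order] assms(2) by blast
  have "Field (Restr \<kappa> (underS \<kappa> b)) = underS \<kappa> b"
    using W underS_Field by (intro Refl_Field_Restr2) (auto simp: order_on_defs)
  with card_of_cong[OF b(2)] have "\<exists>h. bij_betw h I (underS \<kappa> b)"
    by (simp add: Field_card_of card_of_ordIso)
  with b(1) show ?thesis using that by blast
qed

text \<open>By regularity a family of fewer than \<open>\<kappa>\<close> elements is not cofinal.\<close>

lemma small_family_bounded: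
  assumes "regular_cardinal \<kappa>" "|I| <o \<kappa>" "\<And>i. i \<in> I \<Longrightarrow> f i \<in> Field \<kappa>"
  obtains a where "a \<in> Field \<kappa>" "\<And>i. i \<in> I \<Longrightarrow> (f i, a) \<in> \<kappa>"
proof -
  have C: "Card_order \<kappa>" "regularCard \<kappa>" using assms(1) by (auto simp: regular_cardinal_def)
  then have W: "Well_order \<kappa>" by (simp add: card_order_on_def)
  have "|f ` I| <o \<kappa>" using card_of_image assms(2) by (rule ordLeq_ordLess_trans)
  then have "\<not> |f ` I| =o \<kappa>" using not_ordLess_ordIso by blast
  then have "\<not> cofinal (f ` I) \<kappa>" using C(2) assms(3) unfolding regularCard_def by blast
  then obtain a where a: "a \<in> Field \<kappa>" "\<And>i. i \<in> I \<Longrightarrow> a = f i \<or> (a, f i) \<notin> \<kappa>"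
    unfolding cofinal_def by blast
  have "(f i, a) \<in> \<kappa>" if "i \<in> I" for i
    using a(1) a(2)[OF that] assms(3)[OF that] W
    by (cases "a = f i") (auto simp: order_on_defs refl_on_def total_on_def)
  with a(1) show ?thesis using that by blast
qed

locale monoidal_closure = symmetric_monoidal_category M
  for M :: "('o, 'a, 'm) moncat_scheme" (structure) +
  fixes \<kappa> :: "'u rel" and S :: "'a set"
  assumes reg: "regular_cardinal \<kappa>" and S_arr: "S \<subseteq> Arr M"
begin

abbreviation "stage \<equiv> closure_stage \<kappa> M S"
abbreviation "W \<equiv> mult_closure \<kappa> M S"

lemma kappa: "Card_order \<kappa>" "infinite (Field \<kappa>)" "Well_order \<kappa>"
  using reg by (auto simp: regular_cardinal_def card_order_on_def)

lemma stage_arr: "stage a \<subseteq> Arr M"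
proof -
  have "wf (\<kappa> - Id)" using kappa(3) by (auto simp: order_on_defs)
  then show ?thesis
  proof (induction a)
    case (less a)
    consider "underS \<kappa> a = {}" | b where "immediate_pred \<kappa> b a"
      | "underS \<kappa> a \<noteq> {}" "\<nexists>b. immediate_pred \<kappa> b a" by blast
    then show ?case
    proof cases
      case 1
      then show ?thesis using closure_stage_zero[OF kappa(3), of a M S] S_arr by auto
    next
      case 2
      then have "(b, a) \<in> \<kappa> - Id" by (auto simp: immediate_pred_def underS_def)
      then show ?thesis
        using closure_stage_succ[OF kappa(3) 2, of M S] closure_step_parts(8)[OF less] by simp
    next
      case 3
      then show ?thesis
        using closure_stage_limit[OF kappa(3) 3, of M S] less by (auto simp: underS_def)
    qed
  qed
qed

lemma step_increasing: "stage b \<subseteq> closure_step \<kappa> M a (stage b)"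
  using closure_step_parts(1-5)[OF stage_arr[of b]] closure_step_parts(6,7)[OF stage_arr[of b], of \<kappa> a] by blast

lemma stage_mono_strict: "b \<in> underS \<kappa> a \<Longrightarrow> stage b \<subseteq> stage a"
proof -
  have "wf (\<kappa> - Id)" using kappa(3) by (auto simp: order_on_defs)
  then show "b \<in> underS \<kappa> a \<Longrightarrow> stage b \<subseteq> stage a"
  proof (induction a)
    case (less a)
    show ?case
    proof (cases "\<exists>p. immediate_pred \<kappa> p a")
      case True
      then obtain p where p: "immediate_pred \<kappa> p a" by blast
      then have "(b, p) \<in> \<kappa>" "(p, a) \<in> \<kappa> - Id"
        using less.prems by (auto simp: immediate_pred_def underS_def)
      then have "stage b \<subseteq> stage p" using less.IH[of p] by (cases "b = p") (auto simp: underS_def)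
      also have "stage p \<subseteq> stage a"
        using step_increasing[of p a] closure_stage_succ[OF kappa(3) p, of M S] by simp
      finally show ?thesis .
    next
      case False
      then show ?thesis using closure_stage_limit[OF kappa(3), of a M S] less.prems by blast
    qed
  qed
qed

lemma stage_mono: "(b, a) \<in> \<kappa> \<Longrightarrow> stage b \<subseteq> stage a"
  using stage_mono_strict[of b a] by (cases "b = a") (auto simp: underS_def)

lemma stage_closure: "a \<in> Field \<kappa> \<Longrightarrow> stage a \<subseteq> W"
  unfolding mult_closure_def by blast

lemma step_closure:
  assumes "b \<in> Field \<kappa>"
  obtains a where "closure_step \<kappa> M a (stage b) \<subseteq> W"
proof -
  obtain a where a: "a \<in> Field \<kappa>" "immediate_pred \<kappa> b a"
    using successor_exists[OF kappa(1,2) assms] .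
  show ?thesis
    using closure_stage_succ[OF kappa(3) a(2), of M S] stage_closure[OF a(1)] by (intro that[of a]) simp
qed

lemma common_stage:
  assumes "s \<in> W" "t \<in> W"
  obtains b where "b \<in> Field \<kappa>" "s \<in> stage b" "t \<in> stage b"
proof -
  obtain b c where b: "b \<in> Field \<kappa>" "s \<in> stage b" and c: "c \<in> Field \<kappa>" "t \<in> stage c"
    using assms unfolding mult_closure_def by blast
  have "(b, c) \<in> \<kappa> \<or> (c, b) \<in> \<kappa>"
    using kappa(3) b c by (cases "b = c") (auto simp: order_on_defs total_on_def refl_on_def)
  then show ?thesis using that b c stage_mono by blast
qed

lemma closure_arr: "W \<subseteq> Arr M"
  unfolding mult_closure_def using stage_arr by blast

lemma closure_base: "S \<union> Ident M ` Obj M \<subseteq> W"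
proof -
  have "Field \<kappa> \<noteq> {}" using kappa(2) by auto
  have "wf (\<kappa> - Id)" using kappa(3) by (auto simp: order_on_defs)
  then obtain a where a: "a \<in> Field \<kappa>" "\<And>c. (c, a) \<in> \<kappa> - Id \<Longrightarrow> c \<notin> Field \<kappa>"
    using wfE_min[of "\<kappa> - Id" _ "Field \<kappa>"] \<open>Field \<kappa> \<noteq> {}\<close> by blast
  then have "underS \<kappa> a = {}" by (auto simp: underS_def Field_def)
  then show ?thesis using closure_stage_zero[OF kappa(3), of a M S] stage_closure[OF a(1)] by simp
qed

text \<open>Everything that one step adds to a collection containing given elements of \<open>W\<close> is in \<open>W\<close>.
  The closure properties below are read off from this.\<close>

lemma closure_stepE:
  assumes "s \<in> W" "t \<in> W"
  obtains T a where "T \<subseteq> Arr M" "s \<in> T" "t \<in> T" "closure_step \<kappa> M a T \<subseteq> W"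
proof -
  obtain b where b: "b \<in> Field \<kappa>" "s \<in> stage b" "t \<in> stage b"
    by (rule common_stage[OF assms])
  obtain a where "closure_step \<kappa> M a (stage b) \<subseteq> W" by (rule step_closure[OF b(1)])
  then show ?thesis by (rule that[OF stage_arr b(2,3)])
qed

lemma closure_pushout:
  assumes "s \<in> W" "is_pushout M s g i t"
  shows "t \<in> W"
proof -
  obtain T a where T: "T \<subseteq> Arr M" "s \<in> T" "s \<in> T" "closure_step \<kappa> M a T \<subseteq> W"
    by (rule closure_stepE[OF assms(1) assms(1)])
  have "t \<in> add_pushouts M T" unfolding add_pushouts_def using T assms by blast
  then show ?thesis using closure_step_parts(2-5)[OF T(1)] closure_step_parts(6,7)[OF T(1), of \<kappa> a] T(4) by blast
qed

lemma closure_pullback: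
  assumes "s \<in> W" "is_pullback M s g i t"
  shows "t \<in> W"
proof -
  obtain T a where T: "T \<subseteq> Arr M" "s \<in> T" "s \<in> T" "closure_step \<kappa> M a T \<subseteq> W"
    by (rule closure_stepE[OF assms(1) assms(1)])
  note parts = closure_step_parts(1-5)[OF T(1)] closure_step_parts(6-8)[OF T(1), of \<kappa> a]
  have "t \<in> add_pullbacks M (add_coequalizer_maps M (add_pushouts M T))"
    unfolding add_pullbacks_def using parts(1,2) T(2) assms(2) by blast
  then show ?thesis using parts(4-7) T(4) by blast
qed

lemma closure_coequalizer:
  assumes "parallel M f g" "s \<in> W" "Cod M s = Dom M f" "f \<cdot> s = g \<cdot> s" "is_coequalizer M f g q"
  shows "q \<in> W"
proof -
  obtain T a where T: "T \<subseteq> Arr M" "s \<in> T" "s \<in> T" "closure_step \<kappa> M a T \<subseteq> W"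
    by (rule closure_stepE[OF assms(2) assms(2)])
  note parts = closure_step_parts(1-5)[OF T(1)] closure_step_parts(6-8)[OF T(1), of \<kappa> a]
  have "q \<in> add_coequalizer_maps M (add_pushouts M T)"
    by (rule coequalizer_in_add_coequalizer_maps[OF assms(1) _ _ assms(3-5)]) (use parts(1) T in auto)
  then show ?thesis using parts(3-7) T(4) by blast
qed

lemma closure_equalizer:
  assumes "parallel M f g" "s \<in> W" "Dom M s = Cod M f" "s \<cdot> f = s \<cdot> g" "is_equalizer M f g q"
  shows "q \<in> W"
proof -
  interpret O: category "opcat M" by (rule category_opcat[OF category_axioms])
  obtain T a where T: "T \<subseteq> Arr M" "s \<in> T" "s \<in> T" "closure_step \<kappa> M a T \<subseteq> W"
    by (rule closure_stepE[OF assms(2) assms(2)])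
  note parts = closure_step_parts(1-5)[OF T(1)] closure_step_parts(6-8)[OF T(1), of \<kappa> a]
  have "q \<in> add_equalizer_maps M (add_pullbacks M (add_coequalizer_maps M (add_pushouts M T)))"
    unfolding add_equalizer_maps_opcat
    by (rule O.coequalizer_in_add_coequalizer_maps[of f g s])
      (use parts(1-3) T assms in \<open>auto simp: is_equalizer_opcat\<close>)
  then show ?thesis using parts(5-7) T(4) by blast
qed

lemma closure_comp:
  assumes "s \<in> W" "t \<in> W" "Cod M s = Dom M t"
  shows "t \<cdot> s \<in> W"
proof -
  obtain T a where T: "T \<subseteq> Arr M" "s \<in> T" "t \<in> T" "closure_step \<kappa> M a T \<subseteq> W"
    by (rule closure_stepE[OF assms(1,2)])
  note parts = closure_step_parts(1-5)[OF T(1)] closure_step_parts(6-8)[OF T(1), of \<kappa> a]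
  have "t \<cdot> s \<in> finite_comps M (add_equalizer_maps M (add_pullbacks M
      (add_coequalizer_maps M (add_pushouts M T))))"
    using parts(1-4) T(2,3) assms(3) by (intro finite_comps.intros) auto
  then show ?thesis using parts(6,7) T(4) by blast
qed

lemma closure_tensor:
  assumes "s \<in> W" "X \<in> Obj M"
  shows "Ident M X \<otimes> s \<in> W" and "s \<otimes> Ident M X \<in> W"
proof -
  obtain T a where T: "T \<subseteq> Arr M" "s \<in> T" "s \<in> T" "closure_step \<kappa> M a T \<subseteq> W"
    by (rule closure_stepE[OF assms(1) assms(1)])
  note parts = closure_step_parts(1-5)[OF T(1)] closure_step_parts(6-8)[OF T(1), of \<kappa> a]
  let ?T6 = "add_products \<kappa> a M (finite_comps M
     (add_equalizer_maps M (add_pullbacks M (add_coequalizer_maps M (add_pushouts M T)))))"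
  have "s \<in> ?T6" using parts(1-6) T(2) by blast
  then have "Ident M X \<otimes> s \<in> closure_step \<kappa> M a T" "s \<otimes> Ident M X \<in> closure_step \<kappa> M a T"
    using assms(2) unfolding closure_step_def add_tensors_def by blast+
  then show "Ident M X \<otimes> s \<in> W" "s \<otimes> Ident M X \<in> W" using T(4) by auto
qed

text \<open>Here regularity of \<open>\<kappa>\<close> enters: the stages at which the factors appear are bounded below
  \<open>\<kappa>\<close>, and the bound can be taken so large that the index set is admitted at the next stage.\<close>

lemma closure_products:
  fixes I :: "'u set"
  assumes I: "|I| <o \<kappa>" and s: "\<And>i. i \<in> I \<Longrightarrow> s i \<in> W"
    and m: "is_product_map M I s m \<or> is_coproduct_map M I s m"
  shows "m \<in> W"
proof -
  have "\<forall>i \<in> I. \<exists>a \<in> Field \<kappa>. s i \<in> stage a" using s unfolding mult_closure_def by blast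
  then obtain f where f: "\<And>i. i \<in> I \<Longrightarrow> f i \<in> Field \<kappa>" "\<And>i. i \<in> I \<Longrightarrow> s i \<in> stage (f i)" by metis
  obtain c where c: "c \<in> Field \<kappa>" "\<And>i. i \<in> I \<Longrightarrow> (f i, c) \<in> \<kappa>"
    by (rule small_family_bounded[OF reg I, of f]) (use f in auto)
  obtain b where b: "b \<in> Field \<kappa>" "\<exists>h. bij_betw h I (underS \<kappa> b)"
    by (rule small_index_set_below[OF kappa(1) I])
  \<comment> \<open>\<open>c\<close> bounds the stages of the factors and \<open>b\<close> has the size of \<open>I\<close>; the products are taken at the
    successor of the larger of the two.\<close>
  obtain e where e: "e \<in> Field \<kappa>" "(c, e) \<in> \<kappa>" "(b, e) \<in> \<kappa>"
  proof (cases "(b, c) \<in> \<kappa>")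
    case True
    then show ?thesis using that[of c] c(1) kappa(3) by (auto simp: order_on_defs refl_on_def)
  next
    case False
    then have "(c, b) \<in> \<kappa>"
      using b(1) c(1) kappa(3) by (cases "b = c") (auto simp: order_on_defs refl_on_def total_on_def)
    then show ?thesis using that[of b] b(1) kappa(3) by (auto simp: order_on_defs refl_on_def)
  qed
  obtain a where a: "a \<in> Field \<kappa>" "immediate_pred \<kappa> e a"
    using successor_exists[OF kappa(1,2) e(1)] .
  have "b \<in> underS \<kappa> a"
    using e(3) a(2) kappa(3) unfolding immediate_pred_def underS_def order_on_defs
    by (auto dest: transD antisymD)
  then have idx: "index_set_below \<kappa> a I" unfolding index_set_below_def using b(2) by blast
  note parts = closure_step_parts(1-5)[OF stage_arr[of e]] closure_step_parts(6,7)[OF stage_arr[of e], of \<kappa> a]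
  let ?T5 = "finite_comps M (add_equalizer_maps M (add_pullbacks M
      (add_coequalizer_maps M (add_pushouts M (stage e)))))"
  have "s i \<in> ?T5" if "i \<in> I" for i
  proof -
    have "stage (f i) \<subseteq> stage e" using stage_mono[OF c(2)[OF that]] stage_mono[OF e(2)] by blast
    then show ?thesis using f(2)[OF that] parts(1-5) by blast
  qed
  then have "m \<in> add_products \<kappa> a M ?T5"
    unfolding add_products_def using idx m by blast
  then have "m \<in> stage a"
    using parts(7) closure_stage_succ[OF kappa(3) a(2), of M S] by auto
  then show ?thesis using stage_closure[OF a(1)] by blast
qed

text \<open>Ore squares are pushouts and pullbacks, and cancellation is provided by the canonical maps
  between coequalizers and between equalizers.\<close>

lemma closure_multiplicative_system:
  assumes "complete TYPE('u) M" "cocomplete TYPE('u) M"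
  shows "multiplicative_system M W"
proof
  have inf: "infinite (UNIV :: 'u set)"
    using kappa(2) by (meson finite_subset subset_UNIV)
  interpret O: category "opcat M" by (rule category_opcat[OF category_axioms])
  have op: "cocomplete TYPE('u) (opcat M)" by (rule complete_opcat[OF category_axioms assms(1)])
  show "s \<in> Arr M" if "s \<in> W" for s using that closure_arr by blast
  show "Ident M A \<in> W" if "A \<in> Obj M" for A using that closure_base by blast
  show "t \<cdot> s \<in> W" if "s \<in> W" "t \<in> W" "Cod M s = Dom M t" for s t by (rule closure_comp[OF that])
  show "\<exists>t \<in> W. \<exists>g \<in> Arr M. Dom M t = Cod M f \<and> Dom M g = Cod M s \<and> Cod M t = Cod M g \<and> t \<cdot> f = g \<cdot> s"
    if *: "s \<in> W" "f \<in> Arr M" "Dom M s = Dom M f" for s f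
  proof -
    obtain i j where p: "is_pushout M s f i j"
      using pushout_exists[OF assms(2) inf] * closure_arr by blast
    have "j \<in> W" by (rule closure_pushout[OF *(1) p])
    then show ?thesis using p unfolding is_pushout_def by (intro bexI[of _ j] bexI[of _ i]) auto
  qed
  show "\<exists>t \<in> W. \<exists>g \<in> Arr M. Cod M t = Dom M f \<and> Cod M g = Dom M s \<and> Dom M t = Dom M g \<and> f \<cdot> t = s \<cdot> g"
    if *: "s \<in> W" "f \<in> Arr M" "Cod M s = Cod M f" for s f
  proof -
    obtain i j where p: "is_pullback M s f i j"
      using O.pushout_exists[OF op inf, of s f] * closure_arr by (auto simp: is_pullback_opcat)
    have "j \<in> W" by (rule closure_pullback[OF *(1) p])
    then show ?thesis using p unfolding is_pullback_def by (intro bexI[of _ j] bexI[of _ i]) auto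
  qed
  show "\<exists>t \<in> W. Dom M t = Cod M f \<and> t \<cdot> f = t \<cdot> g"
    if *: "parallel M f g" "s \<in> W" "Cod M s = Dom M f" "f \<cdot> s = g \<cdot> s" for f g s
  proof -
    obtain q where q: "is_coequalizer M f g q" using coequalizer_exists[OF assms(2) inf *(1)] by blast
    then show ?thesis
      using closure_coequalizer[OF * q] coequalizerD[OF q] by (intro bexI[of _ q]) auto
  qed
  show "\<exists>t \<in> W. Cod M t = Dom M f \<and> f \<cdot> t = g \<cdot> t"
    if *: "parallel M f g" "s \<in> W" "Dom M s = Cod M f" "s \<cdot> f = s \<cdot> g" for f g s
  proof -
    obtain q where q: "is_equalizer M f g q"
      using O.coequalizer_exists[OF op inf, of f g] *(1) by (auto simp: is_equalizer_opcat)
    then show ?thesis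
      using closure_equalizer[OF * q] q by (intro bexI[of _ q]) (auto simp: is_equalizer_def)
  qed
qed

end

section \<open>Functors with a calculus of fractions\<close>

text \<open>What is used of the functor \<open>V \<rightarrow> V[W\<inverse>]\<close> in the study of limits and colimits.  The assumptions
  are self-dual, so that every result on colimits also yields one on limits.\<close>

locale fraction_functor = C: category C + D: category D
  for C :: "('o, 'a, 'm) cat_scheme" and D :: "('o, 'b, 'n) cat_scheme" +
  fixes L :: "'a \<Rightarrow> 'b" and W :: "'a set"
  assumes func: "is_functor C D (\<lambda>A. A) L"
    and obj_eq: "Obj D = Obj C"
    and W_arr: "s \<in> W \<Longrightarrow> s \<in> Arr C"
    and W_comp: "\<lbrakk>s \<in> W; t \<in> W; Cod C s = Dom C t\<rbrakk> \<Longrightarrow> t \<cdot>\<^bsub>C\<^esub> s \<in> W"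
    and inverts: "s \<in> W \<Longrightarrow> iso D (L s)"
    and left_fraction: "h \<in> Arr D \<Longrightarrow> \<exists>t \<in> W. \<exists>f \<in> Arr C. Dom C t = Cod D h \<and> Dom C f = Dom D h
      \<and> Cod C t = Cod C f \<and> L t \<cdot>\<^bsub>D\<^esub> h = L f"
    and right_fraction: "h \<in> Arr D \<Longrightarrow> \<exists>s \<in> W. \<exists>f \<in> Arr C. Cod C s = Dom D h \<and> Cod C f = Cod D h
      \<and> Dom C s = Dom C f \<and> h \<cdot>\<^bsub>D\<^esub> L s = L f"
    and left_equal: "\<lbrakk>parallel C f g; L f = L g\<rbrakk> \<Longrightarrow> \<exists>t \<in> W. Dom C t = Cod C f \<and> t \<cdot>\<^bsub>C\<^esub> f = t \<cdot>\<^bsub>C\<^esub> g"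
    and right_equal: "\<lbrakk>parallel C f g; L f = L g\<rbrakk> \<Longrightarrow> \<exists>s \<in> W. Cod C s = Dom C f \<and> f \<cdot>\<^bsub>C\<^esub> s = g \<cdot>\<^bsub>C\<^esub> s"

lemma fraction_functor_opcat:
  assumes "fraction_functor C D L W"
  shows "fraction_functor (opcat C) (opcat D) L W"
proof -
  interpret fraction_functor C D L W by fact
  show ?thesis
  proof (intro fraction_functor.intro fraction_functor_axioms.intro)
    show "\<exists>t \<in> W. \<exists>f \<in> Arr (opcat C). Dom (opcat C) t = Cod (opcat D) h \<and> Dom (opcat C) f = Dom (opcat D) h
      \<and> Cod (opcat C) t = Cod (opcat C) f \<and> L t \<cdot>\<^bsub>opcat D\<^esub> h = L f" if "h \<in> Arr (opcat D)" for h
      using right_fraction[of h] that by simp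
    show "\<exists>t \<in> W. \<exists>f \<in> Arr (opcat C). Cod (opcat C) t = Dom (opcat D) h \<and> Cod (opcat C) f = Cod (opcat D) h
      \<and> Dom (opcat C) t = Dom (opcat C) f \<and> h \<cdot>\<^bsub>opcat D\<^esub> L t = L f" if "h \<in> Arr (opcat D)" for h
      using left_fraction[of h] that by simp
    show "t \<cdot>\<^bsub>opcat C\<^esub> s \<in> W" if "s \<in> W" "t \<in> W" "Cod (opcat C) s = Dom (opcat C) t" for s t
      using W_comp[of t s] that by simp
    show "\<exists>t \<in> W. Dom (opcat C) t = Cod (opcat C) f \<and> t \<cdot>\<^bsub>opcat C\<^esub> f = t \<cdot>\<^bsub>opcat C\<^esub> g"
      if "parallel (opcat C) f g" "L f = L g" for f g
      using right_equal[of f g] that by simp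
    show "\<exists>t \<in> W. Cod (opcat C) t = Dom (opcat C) f \<and> f \<cdot>\<^bsub>opcat C\<^esub> t = g \<cdot>\<^bsub>opcat C\<^esub> t"
      if "parallel (opcat C) f g" "L f = L g" for f g
      using left_equal[of f g] that by simp
  qed (use C.category_axioms D.category_axioms functor_opcat[OF func] obj_eq W_arr inverts in simp_all)
qed

context fraction_functor
begin

abbreviation comp_C (infixr "\<cdot>\<^sub>C" 72) where "g \<cdot>\<^sub>C f \<equiv> g \<cdot>\<^bsub>C\<^esub> f"
abbreviation comp_D (infixr "\<cdot>\<^sub>D" 72) where "g \<cdot>\<^sub>D f \<equiv> g \<cdot>\<^bsub>D\<^esub> f"

lemma L_arr [simp]:
  "f \<in> Arr C \<Longrightarrow> L f \<in> Arr D" "f \<in> Arr C \<Longrightarrow> Dom D (L f) = Dom C f" "f \<in> Arr C \<Longrightarrow> Cod D (L f) = Cod C f"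
  by (simp_all add: functorD[OF func])

lemma L_comp:
  "\<lbrakk>f \<in> Arr C; g \<in> Arr C; Cod C f = Dom C g\<rbrakk> \<Longrightarrow> L (g \<cdot>\<^sub>C f) = L g \<cdot>\<^sub>D L f"
  by (simp add: functorD[OF func])

lemma L_ident: "A \<in> Obj C \<Longrightarrow> L (Ident C A) = Ident D A"
  by (simp add: functorD[OF func])

lemma L_comp_eq:
  assumes "g \<cdot>\<^sub>C f = g' \<cdot>\<^sub>C f'" "f \<in> Arr C" "g \<in> Arr C" "Cod C f = Dom C g"
    "f' \<in> Arr C" "g' \<in> Arr C" "Cod C f' = Dom C g'"
  shows "L g \<cdot>\<^sub>D L f = L g' \<cdot>\<^sub>D L f'"
  using assms L_comp[of f g] L_comp[of f' g'] by simp

lemma left_fractionE: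
  assumes "h \<in> Arr D"
  obtains t f where "t \<in> W" "t \<in> Arr C" "f \<in> Arr C" "Dom C t = Cod D h" "Dom C f = Dom D h"
    "Cod C t = Cod C f" "L t \<cdot>\<^sub>D h = L f" "iso D (L t)"
  using left_fraction[OF assms] W_arr inverts by metis

text \<open>A second fraction is formed from \<open>h\<close> after it has been multiplied by the denominator of \<open>g\<close>; the
  product of the two denominators then works for both.\<close>

lemma left_common_denominator:
  assumes g: "g \<in> Arr D" "h \<in> Arr D" "Dom D g = Dom D h" "Cod D g = Cod D h"
  obtains t x y where "t \<in> W" "t \<in> Arr C" "x \<in> Arr C" "y \<in> Arr C" "Dom C t = Cod D h"
    "Dom C x = Dom D h" "Dom C y = Dom D h" "Cod C x = Cod C t" "Cod C y = Cod C t"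
    "L t \<cdot>\<^sub>D g = L x" "L t \<cdot>\<^sub>D h = L y" "iso D (L t)"
proof -
  obtain s f where s: "s \<in> W" "s \<in> Arr C" "f \<in> Arr C" "Dom C s = Cod D g" "Dom C f = Dom D g"
    "Cod C s = Cod C f" "L s \<cdot>\<^sub>D g = L f" "iso D (L s)"
    by (rule left_fractionE[OF g(1)])
  have sh: "L s \<cdot>\<^sub>D h \<in> Arr D" using s g by simp
  obtain r k where r: "r \<in> W" "r \<in> Arr C" "k \<in> Arr C" "Dom C r = Cod D (L s \<cdot>\<^sub>D h)"
    "Dom C k = Dom D (L s \<cdot>\<^sub>D h)" "Cod C r = Cod C k" "L r \<cdot>\<^sub>D (L s \<cdot>\<^sub>D h) = L k" "iso D (L r)"
    by (rule left_fractionE[OF sh])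
  have r': "Dom C r = Cod C s" "Dom C k = Dom D h" using r s g by simp_all
  have rs: "r \<cdot>\<^sub>C s \<in> W" using W_comp[OF s(1) r(1)] r' by simp
  have "L (r \<cdot>\<^sub>C s) \<cdot>\<^sub>D g = L r \<cdot>\<^sub>D (L s \<cdot>\<^sub>D g)" "L (r \<cdot>\<^sub>C s) \<cdot>\<^sub>D h = L r \<cdot>\<^sub>D (L s \<cdot>\<^sub>D h)"
    using r(2) r' s(2,4) g by (simp_all add: L_comp D.comp_assoc_arr)
  then have "L (r \<cdot>\<^sub>C s) \<cdot>\<^sub>D g = L (r \<cdot>\<^sub>C f)" "L (r \<cdot>\<^sub>C s) \<cdot>\<^sub>D h = L k"
    using r s g r' by (simp_all add: L_comp)
  then show ?thesis
    by (rule that[OF rs, rotated -3]) (use r(2,3,6) s(2-6) g r' inverts[OF rs] in simp_all)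
qed

text \<open>An arrow of \<open>D\<close> is a composite of images of arrows of \<open>C\<close> and inverses of such, so
  naturality only has to be checked on images of arrows of \<open>C\<close>.\<close>

lemma naturality_extends:
  assumes F: "is_functor D E Fo Fa" and G: "is_functor D E Go Ga"
    and \<eta>: "\<And>A. A \<in> Obj C \<Longrightarrow> \<eta> A \<in> Arr E" "\<And>A. A \<in> Obj C \<Longrightarrow> Dom E (\<eta> A) = Fo A"
      "\<And>A. A \<in> Obj C \<Longrightarrow> Cod E (\<eta> A) = Go A"
    and nat: "\<And>f. f \<in> Arr C \<Longrightarrow> \<eta> (Cod C f) \<cdot>\<^bsub>E\<^esub> Fa (L f) = Ga (L f) \<cdot>\<^bsub>E\<^esub> \<eta> (Dom C f)"
    and h: "h \<in> Arr D"
  shows "\<eta> (Cod D h) \<cdot>\<^bsub>E\<^esub> Fa h = Ga h \<cdot>\<^bsub>E\<^esub> \<eta> (Dom D h)"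
proof -
  interpret E: category E by (rule functorD[OF F])
  obtain t f where t: "t \<in> W" "t \<in> Arr C" "f \<in> Arr C" "Dom C t = Cod D h" "Dom C f = Dom D h"
    "Cod C t = Cod C f" "L t \<cdot>\<^sub>D h = L f" "iso D (L t)"
    by (rule left_fractionE[OF h])
  note DF = functorD(4-8)[OF F] and DG = functorD(4-8)[OF G]
  have ob: "Dom D h \<in> Obj C" "Cod D h \<in> Obj C" "Cod C f \<in> Obj C"
    using h t(3) D.dom_cod_obj obj_eq by auto
  have "Ga (L t) \<cdot>\<^bsub>E\<^esub> (\<eta> (Cod D h) \<cdot>\<^bsub>E\<^esub> Fa h) = (Ga (L t) \<cdot>\<^bsub>E\<^esub> \<eta> (Dom C t)) \<cdot>\<^bsub>E\<^esub> Fa h"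
    using t h ob \<eta> by (simp add: DF DG E.comp_assoc_arr)
  also have "\<dots> = (\<eta> (Cod C t) \<cdot>\<^bsub>E\<^esub> Fa (L t)) \<cdot>\<^bsub>E\<^esub> Fa h" using nat[OF t(2)] by simp
  also have "\<dots> = \<eta> (Cod C t) \<cdot>\<^bsub>E\<^esub> Fa (L t \<cdot>\<^sub>D h)"
    using t(2-6) h ob \<eta> by (simp add: DF DG E.comp_assoc_arr)
  also have "\<dots> = Ga (L t \<cdot>\<^sub>D h) \<cdot>\<^bsub>E\<^esub> \<eta> (Dom D h)" using nat[OF t(3)] t by simp
  also have "\<dots> = Ga (L t) \<cdot>\<^bsub>E\<^esub> (Ga h \<cdot>\<^bsub>E\<^esub> \<eta> (Dom D h))"
    using t(2,4) h ob \<eta> by (simp add: DF DG E.comp_assoc_arr)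
  finally show ?thesis
    by (rule E.iso_cancel_left[OF functor_iso[OF G t(8)]]) (use t(2,4) h ob \<eta> in \<open>simp_all add: DF DG\<close>)
qed

subsection \<open>Preservation of colimits and limits\<close>

text \<open>Let \<open>a = t\<inverse> x\<close> coequalize the images of \<open>f\<close> and \<open>g\<close>.  Then \<open>x f\<close> and \<open>x g\<close> agree after composition
  with some \<open>u \<in> W\<close>, so \<open>u x\<close> factors through \<open>q\<close> as \<open>k q\<close>, and \<open>(u t)\<inverse> k\<close> is the factorization of
  \<open>a\<close>.  Uniqueness is proved in the same way, starting from a common denominator.\<close>

lemma preserves_coequalizer:
  assumes q: "is_coequalizer C f g q"
  shows "is_coequalizer D (L f) (L g) (L q)"
proof -
  note Q = C.coequalizerD[OF q]
  have lift: "x \<cdot>\<^sub>C q = y \<cdot>\<^sub>C q \<Longrightarrow> x = y"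
    if "x \<in> Arr C" "y \<in> Arr C" "Dom C x = Cod C q" "Dom C y = Cod C q" "Cod C x = Cod C y" for x y
    by (rule C.coequalizer_unique[OF q]) (use that in auto)
  show ?thesis
  proof (rule D.coequalizerI)
    show "L q \<cdot>\<^sub>D L f = L q \<cdot>\<^sub>D L g" by (rule L_comp_eq) (use Q in auto)
  next
    fix a assume a: "a \<in> Arr D" "Dom D a = Cod D (L g)" "a \<cdot>\<^sub>D L f = a \<cdot>\<^sub>D L g"
    obtain t x where t: "t \<in> W" "t \<in> Arr C" "x \<in> Arr C" "Dom C t = Cod D a" "Dom C x = Dom D a"
      "Cod C t = Cod C x" "L t \<cdot>\<^sub>D a = L x" "iso D (L t)"
      by (rule left_fractionE[OF a(1)])
    have dx: "Dom C x = Cod C g" using t a Q by simp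
    have "L (x \<cdot>\<^sub>C f) = L t \<cdot>\<^sub>D (a \<cdot>\<^sub>D L f)" "L (x \<cdot>\<^sub>C g) = L t \<cdot>\<^sub>D (a \<cdot>\<^sub>D L g)"
      using t(2-4) t(7)[symmetric] a(1,2) Q dx by (simp_all add: L_comp D.comp_assoc_arr)
    then have "L (x \<cdot>\<^sub>C f) = L (x \<cdot>\<^sub>C g)" using a(3) by simp
    moreover have "parallel C (x \<cdot>\<^sub>C f) (x \<cdot>\<^sub>C g)" using t dx Q by (simp add: parallel_def)
    ultimately obtain u where u: "u \<in> W" "Dom C u = Cod C x" "u \<cdot>\<^sub>C (x \<cdot>\<^sub>C f) = u \<cdot>\<^sub>C (x \<cdot>\<^sub>C g)"
      using left_equal t dx Q by (metis C.comp_arr(3))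
    have u': "u \<in> Arr C" using u(1) by (rule W_arr)
    obtain k where k: "k \<in> Arr C" "Dom C k = Cod C q" "Cod C k = Cod C (u \<cdot>\<^sub>C x)" "k \<cdot>\<^sub>C q = u \<cdot>\<^sub>C x"
      by (rule C.coequalizer_ex[OF q, of "u \<cdot>\<^sub>C x"]) (use u u' t dx Q in \<open>simp_all add: C.comp_assoc_arr\<close>)
    have isoz: "iso D (L (u \<cdot>\<^sub>C t))" using W_comp[OF t(1) u(1)] inverts u t by simp
    obtain r where r: "L (u \<cdot>\<^sub>C t) \<in> Arr D" "r \<in> Arr D" "Dom D r = Cod D (L (u \<cdot>\<^sub>C t))"
      "Cod D r = Dom D (L (u \<cdot>\<^sub>C t))"
      "r \<cdot>\<^sub>D L (u \<cdot>\<^sub>C t) = Ident D (Dom D (L (u \<cdot>\<^sub>C t)))" "L (u \<cdot>\<^sub>C t) \<cdot>\<^sub>D r = Ident D (Cod D (L (u \<cdot>\<^sub>C t)))"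
      using isoz by (rule D.isoE)
    have ut: "u \<cdot>\<^sub>C t \<in> Arr C" "Dom C (u \<cdot>\<^sub>C t) = Cod D a" "Cod C (u \<cdot>\<^sub>C t) = Cod C u"
      using u' u t by simp_all
    have "L k \<cdot>\<^sub>D L q = L (u \<cdot>\<^sub>C t) \<cdot>\<^sub>D a"
    proof -
      have "L k \<cdot>\<^sub>D L q = L (u \<cdot>\<^sub>C x)" using k Q by (simp flip: L_comp)
      also have "\<dots> = L u \<cdot>\<^sub>D (L t \<cdot>\<^sub>D a)" using t u u' by (simp add: L_comp)
      also have "\<dots> = L (u \<cdot>\<^sub>C t) \<cdot>\<^sub>D a" using t(2-6) u u' a(1) by (simp add: L_comp D.comp_assoc_arr)
      finally show ?thesis .
    qed
    then have "(r \<cdot>\<^sub>D L k) \<cdot>\<^sub>D L q = r \<cdot>\<^sub>D (L (u \<cdot>\<^sub>C t) \<cdot>\<^sub>D a)"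
      using k(1-3) Q r(2-4) ut u' u t(2-6) by (simp add: D.comp_assoc_arr)
    also have "\<dots> = a" using r(2-5) ut a(1) by (simp add: D.comp_rewrite[OF r(5)])
    finally show "\<exists>h \<in> Arr D. Dom D h = Cod D (L q) \<and> Cod D h = Cod D a \<and> h \<cdot>\<^sub>D L q = a"
      using k(1-3) Q r(2-4) ut u' u t(2-6) by (intro bexI[of _ "r \<cdot>\<^sub>D L k"]) simp_all
  next
    fix h h' assume h: "h \<in> Arr D" "h' \<in> Arr D" "Dom D h = Cod D (L q)" "Dom D h' = Cod D (L q)"
      "Cod D h = Cod D h'" "h \<cdot>\<^sub>D L q = h' \<cdot>\<^sub>D L q"
    have dh: "Dom D h = Dom D h'" using h by simp
    obtain t x y where t: "t \<in> W" "t \<in> Arr C" "x \<in> Arr C" "y \<in> Arr C" "Dom C t = Cod D h'"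
      "Dom C x = Dom D h'" "Dom C y = Dom D h'" "Cod C x = Cod C t" "Cod C y = Cod C t"
      "L t \<cdot>\<^sub>D h = L x" "L t \<cdot>\<^sub>D h' = L y" "iso D (L t)"
      by (rule left_common_denominator[OF h(1,2) dh h(5)])
    have xy: "Dom C x = Cod C q" "Dom C y = Cod C q" using t h Q by simp_all
    have "L (x \<cdot>\<^sub>C q) = L t \<cdot>\<^sub>D (h \<cdot>\<^sub>D L q)" "L (y \<cdot>\<^sub>C q) = L t \<cdot>\<^sub>D (h' \<cdot>\<^sub>D L q)"
      using t(2-9) t(10,11)[symmetric] h(1-5) Q xy by (simp_all add: L_comp D.comp_assoc_arr)
    then have "L (x \<cdot>\<^sub>C q) = L (y \<cdot>\<^sub>C q)" using h(6) by simp
    moreover have "parallel C (x \<cdot>\<^sub>C q) (y \<cdot>\<^sub>C q)" using t xy Q by (simp add: parallel_def)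
    ultimately obtain u where u: "u \<in> W" "Dom C u = Cod C t" "u \<cdot>\<^sub>C (x \<cdot>\<^sub>C q) = u \<cdot>\<^sub>C (y \<cdot>\<^sub>C q)"
      using left_equal t xy Q by (metis C.comp_arr(3))
    have u': "u \<in> Arr C" using u(1) by (rule W_arr)
    have uxy: "u \<cdot>\<^sub>C x = u \<cdot>\<^sub>C y"
      by (rule lift) (use u u' t xy Q in \<open>simp_all add: C.comp_assoc_arr\<close>)
    have "L u \<cdot>\<^sub>D L x = L u \<cdot>\<^sub>D L y"
      by (rule L_comp_eq[OF uxy]) (use u u' t in simp_all)
    then have "L x = L y"
      using D.iso_cancel_left[OF inverts[OF u(1)]] u u' t(2-9) by simp
    then have "L t \<cdot>\<^sub>D h = L t \<cdot>\<^sub>D h'" using t(10,11) by simp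
    then show "h = h'"
      by (rule D.iso_cancel_left[OF t(12)]) (use t(2-9) h(1-5) in simp_all)
  qed (use Q in simp_all)
qed

end

definition coproduct_closed :: "('o, 'a, 'm) cat_scheme \<Rightarrow> 'i set \<Rightarrow> 'a set \<Rightarrow> bool" where
  "coproduct_closed C I W \<longleftrightarrow> (\<forall>A. (\<forall>i \<in> I. A i \<in> Obj C) \<longrightarrow> (\<exists>P c. is_coproduct C I A P c))
     \<and> (\<forall>s m. (\<forall>i \<in> I. s i \<in> W) \<longrightarrow> is_coproduct_map C I s m \<longrightarrow> m \<in> W)"

context fraction_functor
begin

text \<open>Here \<open>s\<close> is a family of denominators and \<open>m\<close> their coproduct, itself a denominator.\<close>

lemma coproduct_denominator:
  assumes I: "coproduct_closed C I W" and P: "is_coproduct C I A P c"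
    and s: "\<And>i. i \<in> I \<Longrightarrow> s i \<in> W" "\<And>i. i \<in> I \<Longrightarrow> Cod C (s i) = A i"
  obtains E e m where "is_coproduct C I (\<lambda>i. Dom C (s i)) E e" "m \<in> W" "m \<in> Arr C" "Dom C m = E"
    "Cod C m = P" "\<And>i. i \<in> I \<Longrightarrow> m \<cdot>\<^sub>C e i = c i \<cdot>\<^sub>C s i"
proof -
  have sa: "s i \<in> Arr C" if "i \<in> I" for i using s(1)[OF that] by (rule W_arr)
  then obtain E e where E: "is_coproduct C I (\<lambda>i. Dom C (s i)) E e"
    using I unfolding coproduct_closed_def by (metis C.dom_cod_obj(1))
  have "is_coproduct C I (\<lambda>i. Cod C (s i)) P c"
    using P s(2) unfolding is_coproduct_def by simp
  then obtain m where m: "is_coproduct_map C I s m" "m \<in> Arr C" "Dom C m = E" "Cod C m = P"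
    "\<And>i. i \<in> I \<Longrightarrow> m \<cdot>\<^sub>C e i = c i \<cdot>\<^sub>C s i"
    using C.coproduct_map_ex[OF E _ sa] by blast
  moreover have "m \<in> W" using I m(1) s(1) unfolding coproduct_closed_def by blast
  ultimately show ?thesis using that E by blast
qed

text \<open>A family \<open>q i = f i (s i)\<inverse>\<close> of fractions is induced by the fraction \<open>k m\<inverse>\<close>, where \<open>m\<close> is the
  coproduct of the \<open>s i\<close> and \<open>k\<close> is induced by the \<open>f i\<close>.  For uniqueness, two maps \<open>x, y\<close> with a
  common denominator whose components are equalized by arrows \<open>s i \<in> W\<close> are equalized by \<open>m\<close>.\<close>

lemma preserves_coproduct:
  assumes I: "coproduct_closed C I W" and P: "is_coproduct C I A P c"
  shows "is_coproduct D I A P (\<lambda>i. L (c i))"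
proof -
  note DP = C.coproductD[OF P]
  show ?thesis
  proof (rule D.coproductI)
    fix Q q
    assume Q: "Q \<in> Obj D" and q: "\<And>i. i \<in> I \<Longrightarrow> q i \<in> Arr D" "\<And>i. i \<in> I \<Longrightarrow> Dom D (q i) = A i"
      "\<And>i. i \<in> I \<Longrightarrow> Cod D (q i) = Q"
    have "\<forall>i \<in> I. \<exists>s f. s \<in> W \<and> f \<in> Arr C \<and> Cod C s = A i \<and> Cod C f = Q
      \<and> Dom C s = Dom C f \<and> q i \<cdot>\<^sub>D L s = L f"
      using right_fraction q by metis
    then obtain s f where sf: "\<forall>i \<in> I. s i \<in> W \<and> f i \<in> Arr C \<and> Cod C (s i) = A i \<and> Cod C (f i) = Q
      \<and> Dom C (s i) = Dom C (f i) \<and> q i \<cdot>\<^sub>D L (s i) = L (f i)"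
      unfolding bchoice_iff by blast
    then have s: "s i \<in> W" "Cod C (s i) = A i"
      and f: "f i \<in> Arr C" "Dom C (f i) = Dom C (s i)" "Cod C (f i) = Q"
      and qs: "q i \<cdot>\<^sub>D L (s i) = L (f i)" if "i \<in> I" for i
      using that by auto
    have sa: "s i \<in> Arr C" if "i \<in> I" for i using s(1)[OF that] by (rule W_arr)
    obtain E e m where E: "is_coproduct C I (\<lambda>i. Dom C (s i)) E e" and m: "m \<in> W" "m \<in> Arr C"
      "Dom C m = E" "Cod C m = P" and me: "\<And>i. i \<in> I \<Longrightarrow> m \<cdot>\<^sub>C e i = c i \<cdot>\<^sub>C s i"
      using coproduct_denominator[OF I P s] by blast
    note DE = C.coproductD[OF E]
    obtain k where k: "k \<in> Arr C" "Dom C k = E" "Cod C k = Q" "\<And>i. i \<in> I \<Longrightarrow> k \<cdot>\<^sub>C e i = f i"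
      by (rule C.coproduct_ex[OF E, of Q f]) (use f Q obj_eq in simp_all)
    \<comment> \<open>\<open>r\<close> is the inverse of the image of \<open>m\<close>.\<close>
    obtain r where r: "L m \<in> Arr D" "r \<in> Arr D" "Dom D r = Cod D (L m)" "Cod D r = Dom D (L m)"
      "r \<cdot>\<^sub>D L m = Ident D (Dom D (L m))" "L m \<cdot>\<^sub>D r = Ident D (Cod D (L m))"
      using inverts[OF m(1)] by (rule D.isoE)
    have r': "Dom D r = P" "Cod D r = E" using r m by simp_all
    have "(L k \<cdot>\<^sub>D r) \<cdot>\<^sub>D L (c i) = q i" if i: "i \<in> I" for i
    proof -
      have "((L k \<cdot>\<^sub>D r) \<cdot>\<^sub>D L (c i)) \<cdot>\<^sub>D L (s i) = L k \<cdot>\<^sub>D (r \<cdot>\<^sub>D (L (c i) \<cdot>\<^sub>D L (s i)))"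
        using i k(1-3) r(2) r' DP(2-4) sa s by (simp add: D.comp_assoc_arr)
      also have "L (c i) \<cdot>\<^sub>D L (s i) = L m \<cdot>\<^sub>D L (e i)"
        by (rule L_comp_eq[OF me[OF i, symmetric]]) (use i m DE DP sa s in simp_all)
      also have "r \<cdot>\<^sub>D (L m \<cdot>\<^sub>D L (e i)) = L (e i)"
        using i m DE r(2) r' by (simp add: D.comp_rewrite[OF r(5)])
      also have "L k \<cdot>\<^sub>D L (e i) = q i \<cdot>\<^sub>D L (s i)"
        using i k qs DE by (simp flip: L_comp)
      finally show ?thesis
        by (rule D.iso_cancel_right[OF inverts[OF s(1)[OF i]]])
          (use i k(1-3) r(2) r' DP(2-4) sa s q in simp_all)
    qed
    then show "\<exists>h \<in> Arr D. Dom D h = P \<and> Cod D h = Q \<and> (\<forall>i \<in> I. h \<cdot>\<^sub>D L (c i) = q i)"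
      using k(1-3) r(2) r' by (intro bexI[of _ "L k \<cdot>\<^sub>D r"]) simp_all
  next
    fix h h' assume h: "h \<in> Arr D" "h' \<in> Arr D" "Dom D h = P" "Dom D h' = P" "Cod D h = Cod D h'"
      and eq: "\<And>i. i \<in> I \<Longrightarrow> h \<cdot>\<^sub>D L (c i) = h' \<cdot>\<^sub>D L (c i)"
    have dh: "Dom D h = Dom D h'" using h by simp
    obtain t x y where t: "t \<in> W" "t \<in> Arr C" "x \<in> Arr C" "y \<in> Arr C" "Dom C t = Cod D h'"
      "Dom C x = Dom D h'" "Dom C y = Dom D h'" "Cod C x = Cod C t" "Cod C y = Cod C t"
      "L t \<cdot>\<^sub>D h = L x" "L t \<cdot>\<^sub>D h' = L y" "iso D (L t)"
      by (rule left_common_denominator[OF h(1,2) dh h(5)])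
    have xy: "Dom C x = P" "Dom C y = P" using t h by simp_all
    have "\<exists>s \<in> W. Cod C s = A i \<and> (x \<cdot>\<^sub>C c i) \<cdot>\<^sub>C s = (y \<cdot>\<^sub>C c i) \<cdot>\<^sub>C s" if i: "i \<in> I" for i
    proof -
      have "L (x \<cdot>\<^sub>C c i) = L t \<cdot>\<^sub>D (h \<cdot>\<^sub>D L (c i))" "L (y \<cdot>\<^sub>C c i) = L t \<cdot>\<^sub>D (h' \<cdot>\<^sub>D L (c i))"
        using i t(2-9) t(10,11)[symmetric] h xy DP by (simp_all add: L_comp D.comp_assoc_arr)
      then have "L (x \<cdot>\<^sub>C c i) = L (y \<cdot>\<^sub>C c i)" using eq[OF i] by simp
      moreover have "parallel C (x \<cdot>\<^sub>C c i) (y \<cdot>\<^sub>C c i)" using i t xy DP by (simp add: parallel_def)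
      moreover have "Dom C (x \<cdot>\<^sub>C c i) = A i" using i t xy DP by simp
      ultimately show ?thesis using right_equal by metis
    qed
    then obtain s where s: "\<And>i. i \<in> I \<Longrightarrow> s i \<in> W" "\<And>i. i \<in> I \<Longrightarrow> Cod C (s i) = A i"
      and xs: "\<And>i. i \<in> I \<Longrightarrow> (x \<cdot>\<^sub>C c i) \<cdot>\<^sub>C s i = (y \<cdot>\<^sub>C c i) \<cdot>\<^sub>C s i" by metis
    have sa: "s i \<in> Arr C" if "i \<in> I" for i using s(1)[OF that] by (rule W_arr)
    obtain E e m where E: "is_coproduct C I (\<lambda>i. Dom C (s i)) E e" and m: "m \<in> W" "m \<in> Arr C"
      "Dom C m = E" "Cod C m = P" and me: "\<And>i. i \<in> I \<Longrightarrow> m \<cdot>\<^sub>C e i = c i \<cdot>\<^sub>C s i"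
      using coproduct_denominator[OF I P s] by blast
    note DE = C.coproductD[OF E]
    have xme: "(x \<cdot>\<^sub>C m) \<cdot>\<^sub>C e i = (y \<cdot>\<^sub>C m) \<cdot>\<^sub>C e i" if i: "i \<in> I" for i
    proof -
      have "(x \<cdot>\<^sub>C m) \<cdot>\<^sub>C e i = (x \<cdot>\<^sub>C c i) \<cdot>\<^sub>C s i" "(y \<cdot>\<^sub>C m) \<cdot>\<^sub>C e i = (y \<cdot>\<^sub>C c i) \<cdot>\<^sub>C s i"
        using i t(3,4) xy m DE DP me sa s by (simp_all add: C.comp_assoc_arr)
      then show ?thesis using xs[OF i] by simp
    qed
    have xm: "x \<cdot>\<^sub>C m = y \<cdot>\<^sub>C m"
      by (rule C.coproduct_unique[OF E]) (use t(3-9) xy m xme in simp_all)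
    have "L x \<cdot>\<^sub>D L m = L y \<cdot>\<^sub>D L m"
      by (rule L_comp_eq[OF xm]) (use t xy m in simp_all)
    then have "L x = L y"
      using D.iso_cancel_right[OF inverts[OF m(1)]] t(2-9) xy m by simp
    then have "L t \<cdot>\<^sub>D h = L t \<cdot>\<^sub>D h'" using t(10,11) by simp
    then show "h = h'"
      by (rule D.iso_cancel_left[OF t(12)]) (use t(2-9) h in simp_all)
  qed (use DP obj_eq in simp_all)
qed

text \<open>The colimit is presented as a coequalizer of maps between coproducts in \<open>C\<close>, this presentation
  is carried to \<open>D\<close>, and there it is read as a colimit again.\<close>

lemma preserves_colimit:
  assumes F: "is_functor J C Fo Fa" and X: "is_colimit J C Fo Fa X c"
    and ob: "coproduct_closed C (Obj J) W" and ar: "coproduct_closed C (Arr J) W"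
  shows "is_colimit J D Fo (\<lambda>u. L (Fa u)) X (\<lambda>j. L (c j))"
proof -
  interpret J: category J by (rule functorD[OF F])
  note DF = functorD(3-8)[OF F]
  have F': "is_functor J D Fo (\<lambda>u. L (Fa u))" using functor_comp[OF F func] .
  obtain P p where P: "is_coproduct C (Obj J) Fo P p"
    using ob DF(1) unfolding coproduct_closed_def by blast
  have "\<forall>u \<in> Arr J. Fo (Dom J u) \<in> Obj C" using DF(1) by simp
  then obtain Q d where Q: "is_coproduct C (Arr J) (\<lambda>u. Fo (Dom J u)) Q d"
    using ar[unfolded coproduct_closed_def, THEN conjunct1, rule_format, of "\<lambda>u. Fo (Dom J u)"] by blast
  note DP = C.coproductD[OF P] and DQ = C.coproductD[OF Q] and DX = C.colimitD[OF X]
  obtain \<alpha> \<beta> where \<alpha>: "\<alpha> \<in> Arr C" "Dom C \<alpha> = Q" "Cod C \<alpha> = P"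
      "\<And>u. u \<in> Arr J \<Longrightarrow> \<alpha> \<cdot>\<^sub>C d u = p (Cod J u) \<cdot>\<^sub>C Fa u"
    and \<beta>: "\<beta> \<in> Arr C" "Dom C \<beta> = Q" "Cod C \<beta> = P" "\<And>u. u \<in> Arr J \<Longrightarrow> \<beta> \<cdot>\<^sub>C d u = p (Dom J u)"
    using C.colimit_presentation[OF F P Q] by blast
  obtain q where q: "q \<in> Arr C" "Dom C q = P" "Cod C q = X" "\<And>j. j \<in> Obj J \<Longrightarrow> q \<cdot>\<^sub>C p j = c j"
    by (rule C.coproduct_ex[OF P, of X c]) (use DX in auto)
  have "is_colimit J C Fo Fa (Cod C q) (\<lambda>j. q \<cdot>\<^sub>C p j)"
    using X q unfolding is_colimit_def is_cocone_def by simp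
  then have "is_coequalizer C \<alpha> \<beta> q"
    using C.colimit_iff_coequalizer[OF F P Q \<alpha> \<beta> q(1,2)] by simp
  then have "is_coequalizer D (L \<alpha>) (L \<beta>) (L q)" by (rule preserves_coequalizer)
  then have col: "is_colimit J D Fo (\<lambda>u. L (Fa u)) (Cod D (L q)) (\<lambda>j. L q \<cdot>\<^sub>D L (p j))"
  proof (subst D.colimit_iff_coequalizer[OF F' preserves_coproduct[OF ob P] preserves_coproduct[OF ar Q]])
    show "L \<alpha> \<cdot>\<^sub>D L (d u) = L (p (Cod J u)) \<cdot>\<^sub>D L (Fa u)" if "u \<in> Arr J" for u
      by (rule L_comp_eq[OF \<alpha>(4)]) (use that \<alpha> DP DQ DF in simp_all)
    show "L \<beta> \<cdot>\<^sub>D L (d u) = L (p (Dom J u))" if "u \<in> Arr J" for u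
      using \<beta>(4)[OF that, symmetric] that \<beta>(1-3) DQ by (simp add: L_comp)
  qed (use \<alpha> \<beta> q in simp_all)
  have "L (c j) = L q \<cdot>\<^sub>D L (p j)" if "j \<in> Obj J" for j
    using q(4)[OF that, symmetric] that q(1-3) DP by (simp add: L_comp)
  then show ?thesis
    using col q unfolding is_colimit_def is_cocone_def by simp
qed

lemma preserves_limit:
  assumes F: "is_functor J C Fo Fa" and X: "is_limit J C Fo Fa X p"
    and ob: "coproduct_closed (opcat C) (Obj J) W" and ar: "coproduct_closed (opcat C) (Arr J) W"
  shows "is_limit J D Fo (\<lambda>u. L (Fa u)) X (\<lambda>j. L (p j))"
proof -
  interpret op: fraction_functor "opcat C" "opcat D" L W
    by (rule fraction_functor_opcat) unfold_locales
  show ?thesis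
    using op.preserves_colimit[OF functor_opcat[OF F]] X ob ar by (simp add: is_limit_opcat)
qed

end

section \<open>The localization as a category\<close>

context category
begin

lemma zigzag_obj: "zigzag C T A B p \<Longrightarrow> A \<in> Obj C \<and> B \<in> Obj C"
  by (induction rule: zigzag.induct) (auto simp: in_hom)

lemma zigzag_append: "zigzag C T A B p \<Longrightarrow> zigzag C T B D q \<Longrightarrow> zigzag C T A D (p @ q)"
  by (induction rule: zigzag.induct) (auto intro: zigzag.intros)

lemma zigzag_single: "f \<in> Arr C \<Longrightarrow> zigzag C T (Dom C f) (Cod C f) [Fwd f]"
  by (rule zigzag.fwd[OF _ zigzag.nil]) (auto simp: in_hom)

lemma zigzag_single_bwd: "s \<in> T \<Longrightarrow> s \<in> Arr C \<Longrightarrow> zigzag C T (Cod C s) (Dom C s) [Bwd s]"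
  by (rule zigzag.bwd[OF _ _ zigzag.nil]) (auto simp: in_hom)

lemma zigzag_eq_zigzag: "zigzag_eq C T A B p q \<Longrightarrow> zigzag C T A B p \<and> zigzag C T A B q"
proof (induction rule: zigzag_eq.induct)
  case (append A B p p' D q q')
  then show ?case by (auto intro: zigzag_append)
next
  case (comp f A B g D)
  then show ?case
    using comp_hom[OF comp] zigzag_obj[OF zigzag_single] by (auto intro!: zigzag.intros simp: in_hom)
qed (auto intro!: zigzag.intros simp: in_hom)

end

definition zarr :: "('o, 'a, 'm) cat_scheme \<Rightarrow> 'a set \<Rightarrow> 'o \<Rightarrow> 'o \<Rightarrow> 'a zstep list \<Rightarrow> ('o, 'a) zarr" where
  "zarr C T A B p = (A, B, zigzag_class C T A B p)"

lemma zigzag_class_eqI: "zigzag_eq C T A B p q \<Longrightarrow> zigzag_class C T A B p = zigzag_class C T A B q"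
  unfolding zigzag_class_def by (auto intro: zigzag_eq.trans zigzag_eq.sym)

lemma zarr_eqI: "zigzag_eq C T A B p q \<Longrightarrow> zarr C T A B p = zarr C T A B q"
  unfolding zarr_def by (simp add: zigzag_class_eqI)

lemma zarr_eqD:
  assumes "zarr C T A B p = zarr C T A B q" "zigzag C T A B q"
  shows "zigzag_eq C T A B p q"
proof -
  have "q \<in> zigzag_class C T A B q" using assms(2) by (simp add: zigzag_class_def zigzag_eq.refl)
  then have "q \<in> zigzag_class C T A B p" using assms(1) by (simp add: zarr_def)
  then show ?thesis by (simp add: zigzag_class_def)
qed

text \<open>Operations on classes are defined as unions over representatives.  When all members of the
  union are equal, it is any one of them.\<close>

lemma UN_zigzag_class:
  assumes "\<And>p'. zigzag_eq C T A B p p' \<Longrightarrow> F p' = F p" "zigzag C T A B p"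
  shows "(\<Union>p' \<in> zigzag_class C T A B p. F p') = F p"
proof -
  have "p \<in> zigzag_class C T A B p" using assms(2) by (simp add: zigzag_class_def zigzag_eq.refl)
  moreover have "F p' = F p" if "p' \<in> zigzag_class C T A B p" for p'
    using assms(1) that by (simp add: zigzag_class_def)
  ultimately show ?thesis by blast
qed

lemma loc_comp_zarr:
  assumes "zigzag C T A B p" "zigzag C T B D q"
  shows "loc_comp C T (zarr C T B D q) (zarr C T A B p) = zarr C T A D (p @ q)"
proof -
  let ?cl = "\<lambda>p q. zigzag_class C T A D (p @ q)"
  have inner: "(\<Union>q' \<in> zigzag_class C T B D q. ?cl p' q') = ?cl p' q" if "zigzag_eq C T A B p p'" for p'
  proof (rule UN_zigzag_class[OF _ assms(2)])
    fix q' assume "zigzag_eq C T B D q q'"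
    moreover have "zigzag_eq C T A B p' p'" using that zigzag_eq.sym zigzag_eq.trans by metis
    ultimately show "?cl p' q' = ?cl p' q"
      by (metis zigzag_class_eqI zigzag_eq.append)
  qed
  have "(\<Union>p' \<in> zigzag_class C T A B p. \<Union>q' \<in> zigzag_class C T B D q. ?cl p' q')
      = (\<Union>q' \<in> zigzag_class C T B D q. ?cl p q')"
  proof (rule UN_zigzag_class[OF _ assms(1)])
    fix p' assume pp: "zigzag_eq C T A B p p'"
    have "?cl p' q = ?cl p q"
      using zigzag_class_eqI[OF zigzag_eq.append[OF pp zigzag_eq.refl[OF assms(2)]]] by simp
    then show "(\<Union>q' \<in> zigzag_class C T B D q. ?cl p' q') = (\<Union>q' \<in> zigzag_class C T B D q. ?cl p q')"
      using inner[OF pp] inner[OF zigzag_eq.refl[OF assms(1)]] by simp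
  qed
  then show ?thesis
    using inner[OF zigzag_eq.refl[OF assms(1)]] by (simp add: zarr_def)
qed

lemma localization_simps [simp]:
  "Obj (localization M T) = Obj M"
  "Dom (localization M T) (zarr M T A B p) = A"
  "Cod (localization M T) (zarr M T A B p) = B"
  "Ident (localization M T) A = zarr M T A A []"
  "tobj (localization M T) = tobj M"
  "tarr (localization M T) = loc_tarr M T"
  "unit_obj (localization M T) = unit_obj M"
  "assoc (localization M T) A B D = loc_arr M T (assoc M A B D)"
  "lunit (localization M T) A = loc_arr M T (lunit M A)"
  "runit (localization M T) A = loc_arr M T (runit M A)"
  "braid (localization M T) A B = loc_arr M T (braid M A B)"
  by (simp_all add: localization_def zarr_def)

lemma localization_comp:
  assumes "zigzag M T A B p" "zigzag M T B D q"
  shows "zarr M T B D q \<cdot>\<^bsub>localization M T\<^esub> zarr M T A B p = zarr M T A D (p @ q)"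
  using loc_comp_zarr[OF assms] by (simp add: localization_def)

lemma localization_hom: "f \<in> hom (localization M T) A B \<longleftrightarrow> (\<exists>p. f = zarr M T A B p \<and> zigzag M T A B p)"
  by (auto simp: hom_def localization_def zarr_def)

lemma localization_arr: "f \<in> Arr (localization M T) \<longleftrightarrow> (\<exists>A B p. f = zarr M T A B p \<and> zigzag M T A B p)"
  by (auto simp: localization_def zarr_def)

lemma zarr_arr [simp]: "zigzag M T A B p \<Longrightarrow> zarr M T A B p \<in> Arr (localization M T)"
  by (auto simp: localization_arr)

lemma loc_arr_zarr: "loc_arr M T f = zarr M T (Dom M f) (Cod M f) [Fwd f]"
  by (simp add: loc_arr_def zarr_def)

lemma localization_category:
  assumes "category M"
  shows "category (localization M T)"
proof -
  interpret category M by fact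
  show ?thesis
  proof
    show "Ident (localization M T) A \<in> hom (localization M T) A A" if "A \<in> Obj (localization M T)" for A
      using that by (auto simp: localization_hom intro!: exI[of _ "[]"] zigzag.nil)
    show "Comp (localization M T) g f \<in> hom (localization M T) A D"
      if "f \<in> hom (localization M T) A B" "g \<in> hom (localization M T) B D" for f g A B D
      using that unfolding localization_hom by (metis localization_comp zigzag_append)
    show "Comp (localization M T) f (Ident (localization M T) A) = f"
      if h: "f \<in> hom (localization M T) A B" for f A B
    proof -
      obtain p where p: "f = zarr M T A B p" "zigzag M T A B p" using h unfolding localization_hom by blast
      then have "zigzag M T A A []" using zigzag_obj by (auto intro: zigzag.nil)
      from localization_comp[OF this p(2)] p(1) show ?thesis by simp
    qed
    show "Comp (localization M T) (Ident (localization M T) B) f = f"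
      if h: "f \<in> hom (localization M T) A B" for f A B
    proof -
      obtain p where p: "f = zarr M T A B p" "zigzag M T A B p" using h unfolding localization_hom by blast
      then have "zigzag M T B B []" using zigzag_obj by (auto intro: zigzag.nil)
      from localization_comp[OF p(2) this] p(1) show ?thesis by simp
    qed
    show "Comp (localization M T) (Comp (localization M T) h g) f
        = Comp (localization M T) h (Comp (localization M T) g f)"
      if "f \<in> hom (localization M T) A B" "g \<in> hom (localization M T) B D"
        "h \<in> hom (localization M T) D E" for f g h A B D E
      using that by (auto simp: localization_hom localization_comp zigzag_append)
  qed (auto simp: localization_arr dest: zigzag_obj)
qed

lemma localization_functor:
  assumes "category M"
  shows "is_functor M (localization M T) (\<lambda>A. A) (loc_arr M T)"
proof -
  interpret category M by fact
  show ?thesis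
  proof (rule functorI[OF assms localization_category[OF assms]])
    show "loc_arr M T f \<in> Arr (localization M T)" if "f \<in> Arr M" for f
      using that zigzag_single by (auto simp: loc_arr_zarr)
    show "loc_arr M T (Ident M A) = Ident (localization M T) A" if "A \<in> Obj M" for A
      using that zarr_eqI[OF zigzag_eq.ident] by (simp add: loc_arr_zarr)
    show "loc_arr M T (g \<cdot>\<^bsub>M\<^esub> f) = loc_arr M T g \<cdot>\<^bsub>localization M T\<^esub> loc_arr M T f"
      if *: "f \<in> Arr M" "g \<in> Arr M" "Cod M f = Dom M g" for f g
    proof -
      have "loc_arr M T g \<cdot>\<^bsub>localization M T\<^esub> loc_arr M T f = zarr M T (Dom M f) (Cod M g) [Fwd f, Fwd g]"
        using localization_comp[OF zigzag_single[OF *(1)], of T] zigzag_single[OF *(2), of T] *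
        by (simp add: loc_arr_zarr)
      also have "\<dots> = loc_arr M T (g \<cdot>\<^bsub>M\<^esub> f)"
        using * zarr_eqI[OF zigzag_eq.comp, of f M "Dom M f" "Cod M f" g "Cod M g" T]
        by (simp add: loc_arr_zarr in_hom)
      finally show ?thesis ..
    qed
  qed (simp_all add: loc_arr_zarr)
qed

lemma localization_inverts:
  assumes "category M" "s \<in> T" "s \<in> Arr M"
  shows "iso (localization M T) (loc_arr M T s)"
    and "loc_arr M T s \<cdot>\<^bsub>localization M T\<^esub> zarr M T (Cod M s) (Dom M s) [Bwd s]
      = Ident (localization M T) (Cod M s)"
    and "zarr M T (Cod M s) (Dom M s) [Bwd s] \<cdot>\<^bsub>localization M T\<^esub> loc_arr M T s
      = Ident (localization M T) (Dom M s)"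
proof -
  interpret category M by fact
  have z: "zigzag M T (Dom M s) (Cod M s) [Fwd s]" "zigzag M T (Cod M s) (Dom M s) [Bwd s]"
    using assms zigzag_single zigzag_single_bwd by auto
  have h: "s \<in> hom M (Dom M s) (Cod M s)" using assms by (simp add: in_hom)
  show 1: "loc_arr M T s \<cdot>\<^bsub>localization M T\<^esub> zarr M T (Cod M s) (Dom M s) [Bwd s]
      = Ident (localization M T) (Cod M s)"
    using localization_comp[OF z(2,1)] zarr_eqI[OF zigzag_eq.inverse_left[OF assms(2) h]]
    by (simp add: loc_arr_zarr)
  show 2: "zarr M T (Cod M s) (Dom M s) [Bwd s] \<cdot>\<^bsub>localization M T\<^esub> loc_arr M T s
      = Ident (localization M T) (Dom M s)"
    using localization_comp[OF z] zarr_eqI[OF zigzag_eq.inverse_right[OF assms(2) h]]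
    by (simp add: loc_arr_zarr)
  show "iso (localization M T) (loc_arr M T s)"
    by (rule isoI[of _ _ "zarr M T (Cod M s) (Dom M s) [Bwd s]"])
      (use z 1 2 in \<open>auto simp: loc_arr_zarr\<close>)
qed

section \<open>The calculus of fractions\<close>

text \<open>A left fraction from \<open>A\<close> to \<open>B\<close> is a pair \<open>(f, t)\<close> standing for \<open>t\<inverse> f\<close>.  The relation
  \<open>fraction_step A g x y\<close> expresses that \<open>y\<close> represents the composite of \<open>g\<close> with \<open>x\<close>; for an
  identity \<open>g\<close> it is equivalence of fractions.  Working with this relation instead of with classes
  of fractions makes it possible to treat a backward step as the converse of a forward step.\<close>

context multiplicative_system
begin

definition fraction :: "'o \<Rightarrow> 'o \<Rightarrow> 'a \<times> 'a \<Rightarrow> bool" where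
  "fraction A B x \<longleftrightarrow> fst x \<in> Arr C \<and> Dom C (fst x) = A \<and> snd x \<in> W \<and> snd x \<in> Arr C
     \<and> Dom C (snd x) = B \<and> Cod C (fst x) = Cod C (snd x)"

text \<open>The data behind a step; \<open>k\<close> and \<open>v\<close> bring the numerators over a common target.\<close>

definition fraction_witness :: "'o \<Rightarrow> 'a \<Rightarrow> 'a \<Rightarrow> 'a \<Rightarrow> 'a \<Rightarrow> 'a \<Rightarrow> 'a \<Rightarrow> 'a \<Rightarrow> bool" where
  "fraction_witness A g f t f' t' k v \<longleftrightarrow> k \<in> Arr C \<and> v \<in> Arr C \<and> Dom C k = Cod C t \<and> Dom C v = Cod C t'
     \<and> Cod C k = Cod C v \<and> v \<cdot> t' \<in> W \<and> v \<cdot> f' = k \<cdot> f \<and> v \<cdot> t' \<cdot> g = k \<cdot> t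
     \<and> g \<in> Arr C \<and> f \<in> Arr C \<and> t \<in> Arr C \<and> f' \<in> Arr C \<and> t' \<in> Arr C \<and> t \<in> W \<and> t' \<in> W
     \<and> Dom C f = A \<and> Dom C f' = A \<and> Dom C t = Dom C g \<and> Dom C t' = Cod C g \<and> Cod C f = Cod C t
     \<and> Cod C f' = Cod C t'"

definition fraction_step :: "'o \<Rightarrow> 'a \<Rightarrow> 'a \<times> 'a \<Rightarrow> 'a \<times> 'a \<Rightarrow> bool" where
  "fraction_step A g x y \<longleftrightarrow> (\<exists>k v. fraction_witness A g (fst x) (snd x) (fst y) (snd y) k v)"

lemma fraction_stepE:
  assumes "fraction_step A g (f, t) (f', t')"
  obtains k v where "fraction_witness A g f t f' t' k v"
  using assms unfolding fraction_step_def by auto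

lemma fraction_stepI:
  assumes "k \<in> Arr C" "v \<in> Arr C" "Dom C k = Cod C t" "Dom C v = Cod C t'"
    "Cod C k = Cod C v" "v \<cdot> t' \<in> W" "v \<cdot> f' = k \<cdot> f" "v \<cdot> t' \<cdot> g = k \<cdot> t"
    "g \<in> Arr C" "f \<in> Arr C" "t \<in> Arr C" "f' \<in> Arr C" "t' \<in> Arr C" "t \<in> W" "t' \<in> W"
    "Dom C f = A" "Dom C f' = A" "Dom C t = Dom C g" "Dom C t' = Cod C g" "Cod C f = Cod C t"
    "Cod C f' = Cod C t'"
  shows "fraction_step A g (f, t) (f', t')"
  using assms unfolding fraction_step_def fraction_witness_def by auto

lemma fraction_witnessD:
  assumes "fraction_witness A g f t f' t' k v"
  shows "k \<in> Arr C" "v \<in> Arr C" "Dom C k = Cod C t" "Dom C v = Cod C t'"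
    "Cod C k = Cod C v" "v \<cdot> t' \<in> W" "v \<cdot> f' = k \<cdot> f" "v \<cdot> t' \<cdot> g = k \<cdot> t"
    "g \<in> Arr C" "f \<in> Arr C" "t \<in> Arr C" "f' \<in> Arr C" "t' \<in> Arr C" "t \<in> W" "t' \<in> W"
    "Dom C f = A" "Dom C f' = A" "Dom C t = Dom C g" "Dom C t' = Cod C g" "Cod C f = Cod C t"
    "Cod C f' = Cod C t'"
  using assms unfolding fraction_witness_def by auto

text \<open>The Ore condition for \<open>v t\<close> and \<open>l t\<close> gives a square that commutes after precomposition with
  \<open>t\<close>; cancelling \<open>t\<close> makes it commute.  The arrow \<open>v\<close> itself may lie outside \<open>W\<close>.\<close>

lemma ore_merge:
  assumes t: "t \<in> W" and v: "v \<in> Arr C" "Dom C v = Cod C t" "v \<cdot> t \<in> W"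
    and l: "l \<in> Arr C" "Dom C l = Cod C t"
  obtains n m where "n \<in> W" "n \<in> Arr C" "m \<in> Arr C" "Dom C n = Cod C l" "Dom C m = Cod C v"
    "Cod C n = Cod C m" "n \<cdot> l = m \<cdot> v"
proof -
  have ta: "t \<in> Arr C" using t by (rule W_arr)
  obtain n m where n: "n \<in> W" "m \<in> Arr C" "Dom C n = Cod C (l \<cdot> t)" "Dom C m = Cod C (v \<cdot> t)"
    "Cod C n = Cod C m" "n \<cdot> (l \<cdot> t) = m \<cdot> (v \<cdot> t)"
    using left_ore[OF v(3), of "l \<cdot> t"] ta v l by auto
  have na: "n \<in> Arr C" using n(1) by (rule W_arr)
  have d: "Dom C n = Cod C l" "Dom C m = Cod C v" using n ta v l by simp_all
  have p: "parallel C (n \<cdot> l) (m \<cdot> v)" using n na d v l by (simp add: parallel_def)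
  have e: "(n \<cdot> l) \<cdot> t = (m \<cdot> v) \<cdot> t" using n na d v l ta by (simp add: comp_assoc_arr)
  obtain c where c: "c \<in> W" "Dom C c = Cod C (n \<cdot> l)" "c \<cdot> (n \<cdot> l) = c \<cdot> (m \<cdot> v)"
    using left_cancel[OF p t _ e] na d l by auto
  have ca: "c \<in> Arr C" using c(1) by (rule W_arr)
  have dc: "Dom C c = Cod C n" using c(2) na d l by simp
  show ?thesis
    by (rule that[of "c \<cdot> n" "c \<cdot> m"])
      (use W_comp[OF n(1) c(1)] c(3) dc ca na n(2,5) d v l in \<open>simp_all add: comp_assoc_arr\<close>)
qed

text \<open>From here to \<open>fraction_step_surjective\<close> it is shown that steps compose, that a step is a function on
  equivalence classes of fractions, and that it is a bijection if the arrow is in \<open>W\<close>.  Existence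
  and uniqueness of the value come from the Ore condition and cancellation, and a preimage under \<open>s \<in> W\<close> of \<open>t\<inverse> f\<close> is \<open>(t s)\<inverse> f\<close>.\<close>

lemma fraction_step_total:
  assumes "g \<in> Arr C" "fraction A (Dom C g) x"
  shows "\<exists>y. fraction_step A g x y"
proof -
  obtain f t where x: "x = (f, t)" by (cases x)
  have ft: "f \<in> Arr C" "Dom C f = A" "t \<in> W" "t \<in> Arr C" "Dom C t = Dom C g" "Cod C f = Cod C t"
    using assms(2) by (auto simp: x fraction_def)
  obtain t' g' where t': "t' \<in> W" "g' \<in> Arr C" "Dom C t' = Cod C g" "Dom C g' = Cod C t"
    "Cod C t' = Cod C g'" "t' \<cdot> g = g' \<cdot> t"
    using left_ore[OF ft(3) assms(1) ft(5)] by auto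
  have "fraction_step A g (f, t) (g' \<cdot> f, t')"
    by (rule fraction_stepI[of g' "Ident C (Cod C t')"])
      (use W_arr[OF t'(1)] t' ft assms(1) in simp_all)
  then show ?thesis using x by blast
qed

lemma fraction_step_comp:
  assumes "fraction_step A g x y" "fraction_step A h y z" "Cod C g = Dom C h"
  shows "fraction_step A (h \<cdot> g) x z"
proof -
  obtain f t f1 t1 f2 t2 where xyz: "x = (f, t)" "y = (f1, t1)" "z = (f2, t2)"
    by (metis surj_pair)
  obtain k v where k: "fraction_witness A g f t f1 t1 k v"
    by (rule fraction_stepE[OF assms(1)[unfolded xyz]])
  note k = fraction_witnessD[OF k]
  obtain l w where l: "fraction_witness A h f1 t1 f2 t2 l w"
    by (rule fraction_stepE[OF assms(2)[unfolded xyz]])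
  note l = fraction_witnessD[OF l]
  obtain n m where n: "n \<in> W" "n \<in> Arr C" "m \<in> Arr C" "Dom C n = Cod C l" "Dom C m = Cod C v"
    "Cod C n = Cod C m" "n \<cdot> l = m \<cdot> v"
    by (rule ore_merge[OF k(15) k(2,4,6) l(1,3)])
  note ty = k(1-5) k(9-13) k(16-21) l(1-5) l(9-13) l(16-21) n(2-6)
  have 1: "(n \<cdot> w) \<cdot> t2 \<in> W"
    using W_comp[OF l(6) n(1)] ty by (simp add: comp_assoc_arr)
  have "(n \<cdot> w) \<cdot> f2 = n \<cdot> (w \<cdot> f2)" using ty by (simp add: comp_assoc_arr)
  also have "\<dots> = (n \<cdot> l) \<cdot> f1" unfolding l(7) using ty by (simp add: comp_assoc_arr)
  also have "\<dots> = m \<cdot> (v \<cdot> f1)" unfolding n(7) using ty by (simp add: comp_assoc_arr)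
  also have "\<dots> = (m \<cdot> k) \<cdot> f" unfolding k(7) using ty by (simp add: comp_assoc_arr)
  finally have 2: "(n \<cdot> w) \<cdot> f2 = (m \<cdot> k) \<cdot> f" .
  have "(n \<cdot> w) \<cdot> t2 \<cdot> (h \<cdot> g) = n \<cdot> ((w \<cdot> t2 \<cdot> h) \<cdot> g)" using ty by (simp add: comp_assoc_arr)
  also have "\<dots> = (n \<cdot> l) \<cdot> t1 \<cdot> g" unfolding l(8) using ty by (simp add: comp_assoc_arr)
  also have "\<dots> = m \<cdot> (v \<cdot> t1 \<cdot> g)" unfolding n(7) using ty by (simp add: comp_assoc_arr)
  also have "\<dots> = (m \<cdot> k) \<cdot> t" unfolding k(8) using ty by (simp add: comp_assoc_arr)
  finally have 3: "(n \<cdot> w) \<cdot> t2 \<cdot> (h \<cdot> g) = (m \<cdot> k) \<cdot> t" .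
  show ?thesis unfolding xyz
    by (rule fraction_stepI[OF _ _ _ _ _ 1 2 3]) (use ty k(14) l(15) assms(3) in simp_all)
qed

lemma fraction_step_functional:
  assumes "fraction_step A g x y" "fraction_step A g x z"
  shows "fraction_step A (Ident C (Cod C g)) y z"
proof -
  obtain f t f1 t1 f2 t2 where xyz: "x = (f, t)" "y = (f1, t1)" "z = (f2, t2)"
    by (metis surj_pair)
  obtain k v where k: "fraction_witness A g f t f1 t1 k v"
    by (rule fraction_stepE[OF assms(1)[unfolded xyz]])
  note k = fraction_witnessD[OF k]
  obtain l w where l: "fraction_witness A g f t f2 t2 l w"
    by (rule fraction_stepE[OF assms(2)[unfolded xyz]])
  note l = fraction_witnessD[OF l]
  have d: "Dom C (v \<cdot> t1) = Dom C (w \<cdot> t2)" "w \<cdot> t2 \<in> Arr C" using k l by simp_all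
  obtain b a where b: "b \<in> W" "a \<in> Arr C" "Dom C b = Cod C (w \<cdot> t2)" "Dom C a = Cod C (v \<cdot> t1)"
    "Cod C b = Cod C a" "b \<cdot> (w \<cdot> t2) = a \<cdot> (v \<cdot> t1)"
    using left_ore[OF k(6) d(2,1)] by auto
  have ba: "b \<in> Arr C" using b(1) by (rule W_arr)
  have db: "Dom C b = Cod C w" "Dom C a = Cod C v" using b k l by simp_all
  note ty = k(1-5) k(9-13) k(16-21) l(1-5) l(9-13) l(16-21) ba db b(2,5)
  have p: "parallel C (b \<cdot> l) (a \<cdot> k)" using ty by (simp add: parallel_def)
  have "(b \<cdot> l) \<cdot> t = b \<cdot> (w \<cdot> t2 \<cdot> g)" unfolding l(8) using ty by (simp add: comp_assoc_arr)
  also have "\<dots> = (b \<cdot> (w \<cdot> t2)) \<cdot> g" using ty by (simp add: comp_assoc_arr)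
  also have "\<dots> = a \<cdot> (v \<cdot> t1 \<cdot> g)" unfolding b(6) using ty by (simp add: comp_assoc_arr)
  also have "\<dots> = (a \<cdot> k) \<cdot> t" unfolding k(8) using ty by (simp add: comp_assoc_arr)
  finally have e: "(b \<cdot> l) \<cdot> t = (a \<cdot> k) \<cdot> t" .
  obtain c where c: "c \<in> W" "Dom C c = Cod C (b \<cdot> l)" "c \<cdot> (b \<cdot> l) = c \<cdot> (a \<cdot> k)"
    using left_cancel[OF p k(14) _ e] ty by auto
  have ca: "c \<in> Arr C" using c(1) by (rule W_arr)
  have dc: "Dom C c = Cod C b" using c(2) ty by simp
  note ty = ty ca dc
  have "c \<cdot> (b \<cdot> (w \<cdot> t2)) \<in> W"
    by (rule W_comp[OF W_comp[OF l(6) b(1)] c(1)]) (use ty in simp_all)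
  then have 1: "(c \<cdot> b \<cdot> w) \<cdot> t2 \<in> W" using ty by (simp add: comp_assoc_arr)
  have "(c \<cdot> b \<cdot> w) \<cdot> f2 = c \<cdot> b \<cdot> (w \<cdot> f2)" using ty by (simp add: comp_assoc_arr)
  also have "\<dots> = (c \<cdot> (b \<cdot> l)) \<cdot> f" unfolding l(7) using ty by (simp add: comp_assoc_arr)
  also have "\<dots> = c \<cdot> a \<cdot> (k \<cdot> f)" unfolding c(3) using ty by (simp add: comp_assoc_arr)
  also have "\<dots> = (c \<cdot> a \<cdot> v) \<cdot> f1" unfolding k(7)[symmetric] using ty by (simp add: comp_assoc_arr)
  finally have 2: "(c \<cdot> b \<cdot> w) \<cdot> f2 = (c \<cdot> a \<cdot> v) \<cdot> f1" .
  have "(c \<cdot> b \<cdot> w) \<cdot> t2 \<cdot> Ident C (Cod C g) = c \<cdot> (b \<cdot> (w \<cdot> t2))" using ty by (simp add: comp_assoc_arr)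
  also have "\<dots> = (c \<cdot> a \<cdot> v) \<cdot> t1" unfolding b(6) using ty by (simp add: comp_assoc_arr)
  finally have 3: "(c \<cdot> b \<cdot> w) \<cdot> t2 \<cdot> Ident C (Cod C g) = (c \<cdot> a \<cdot> v) \<cdot> t1" .
  show ?thesis unfolding xyz
    by (rule fraction_stepI[OF _ _ _ _ _ 1 2 3]) (use ty k(15) l(15) in simp_all)
qed

lemma fraction_step_injective:
  assumes "s \<in> W" "fraction_step A s x z" "fraction_step A s y z"
  shows "fraction_step A (Ident C (Dom C s)) x y"
proof -
  obtain f t f1 t1 f2 t2 where xyz: "x = (f, t)" "y = (f1, t1)" "z = (f2, t2)"
    by (metis surj_pair)
  obtain k v where k: "fraction_witness A s f t f2 t2 k v"
    by (rule fraction_stepE[OF assms(2)[unfolded xyz]])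
  note k = fraction_witnessD[OF k]
  obtain l w where l: "fraction_witness A s f1 t1 f2 t2 l w"
    by (rule fraction_stepE[OF assms(3)[unfolded xyz]])
  note l = fraction_witnessD[OF l]
  obtain n m where n: "n \<in> W" "n \<in> Arr C" "m \<in> Arr C" "Dom C n = Cod C w" "Dom C m = Cod C v"
    "Cod C n = Cod C m" "n \<cdot> w = m \<cdot> v"
    by (rule ore_merge[OF k(15) k(2,4,6) l(2,4)])
  note ty = k(1-5) k(9-13) k(16-21) l(1-5) l(9-13) l(16-21) n(2-6)
  have "(n \<cdot> l) \<cdot> t1 = n \<cdot> ((w \<cdot> t2) \<cdot> s)" using ty l(8) by (simp add: comp_assoc_arr)
  moreover have "n \<cdot> ((w \<cdot> t2) \<cdot> s) \<in> W"
    by (rule W_comp[OF W_comp[OF assms(1) l(6)] n(1)]) (use ty in simp_all)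
  ultimately have 1: "(n \<cdot> l) \<cdot> t1 \<in> W" by simp
  have "(n \<cdot> l) \<cdot> f1 = n \<cdot> (w \<cdot> f2)" unfolding l(7) using ty by (simp add: comp_assoc_arr)
  also have "\<dots> = (n \<cdot> w) \<cdot> f2" using ty by (simp add: comp_assoc_arr)
  also have "\<dots> = m \<cdot> (v \<cdot> f2)" unfolding n(7) using ty by (simp add: comp_assoc_arr)
  also have "\<dots> = (m \<cdot> k) \<cdot> f" unfolding k(7) using ty by (simp add: comp_assoc_arr)
  finally have 2: "(n \<cdot> l) \<cdot> f1 = (m \<cdot> k) \<cdot> f" .
  have "(n \<cdot> l) \<cdot> t1 \<cdot> Ident C (Dom C s) = n \<cdot> (l \<cdot> t1)" using ty by (simp add: comp_assoc_arr)
  also have "\<dots> = (n \<cdot> w) \<cdot> t2 \<cdot> s" unfolding l(8)[symmetric] using ty by (simp add: comp_assoc_arr)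
  also have "\<dots> = m \<cdot> (v \<cdot> t2 \<cdot> s)" unfolding n(7) using ty by (simp add: comp_assoc_arr)
  also have "\<dots> = (m \<cdot> k) \<cdot> t" unfolding k(8) using ty by (simp add: comp_assoc_arr)
  finally have 3: "(n \<cdot> l) \<cdot> t1 \<cdot> Ident C (Dom C s) = (m \<cdot> k) \<cdot> t" .
  show ?thesis unfolding xyz
    by (rule fraction_stepI[OF _ _ _ _ _ 1 2 3]) (use ty k(14) l(14) in simp_all)
qed

lemma fraction_step_surjective:
  assumes "s \<in> W" "fraction A (Cod C s) z"
  shows "\<exists>x. fraction_step A s x z"
proof -
  obtain f t where z: "z = (f, t)" by (cases z)
  have ft: "f \<in> Arr C" "Dom C f = A" "t \<in> W" "t \<in> Arr C" "Dom C t = Cod C s" "Cod C f = Cod C t"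
    using assms(2) by (auto simp: z fraction_def)
  have "fraction_step A s (f, t \<cdot> s) (f, t)"
    by (rule fraction_stepI[of "Ident C (Cod C t)" "Ident C (Cod C t)"])
      (use W_arr[OF assms(1)] ft W_comp[OF assms(1) ft(3)] in simp_all)
  then show ?thesis using z by blast
qed

lemma fraction_step_refl:
  assumes "fraction A B x"
  shows "fraction_step A (Ident C B) x x"
proof -
  obtain f t where x: "x = (f, t)" by (cases x)
  have ft: "f \<in> Arr C" "Dom C f = A" "t \<in> W" "t \<in> Arr C" "Dom C t = B" "Cod C f = Cod C t"
    using assms by (auto simp: x fraction_def)
  then have "B \<in> Obj C" by auto
  then show ?thesis unfolding x
    by (intro fraction_stepI[of "Ident C (Cod C t)" "Ident C (Cod C t)"]) (use ft in simp_all)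
qed

lemma fraction_step_fraction:
  assumes "fraction_step A g x y"
  shows "g \<in> Arr C" "fraction A (Dom C g) x" "fraction A (Cod C g) y"
  using assms unfolding fraction_step_def fraction_witness_def fraction_def by auto

lemma fraction_step_sym:
  assumes "B \<in> Obj C" "fraction_step A (Ident C B) x y"
  shows "fraction_step A (Ident C B) y x"
  using fraction_step_functional[OF assms(2) fraction_step_refl] fraction_step_fraction[OF assms(2)] assms(1)
  by simp

lemma fraction_step_ident_left:
  assumes "fraction_step A (Ident C (Dom C g)) x y" "fraction_step A g y z"
  shows "fraction_step A g x z"
  using fraction_step_comp[OF assms] fraction_step_fraction(1)[OF assms(2)] by simp

lemma fraction_step_ident_right:
  assumes "fraction_step A g x y" "fraction_step A (Ident C (Cod C g)) y z"
  shows "fraction_step A g x z"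
  using fraction_step_comp[OF assms] fraction_step_fraction(1)[OF assms(1)] by simp

text \<open>The steps of a zigzag from \<open>B\<close> are composed as relations, a backward step acting as the converse.
  The empty zigzag acts as equivalence of fractions and not as equality, for a step determines its
  result only up to equivalence.\<close>

fun zigzag_action :: "'o \<Rightarrow> 'o \<Rightarrow> 'a zstep list \<Rightarrow> 'a \<times> 'a \<Rightarrow> 'a \<times> 'a \<Rightarrow> bool" where
  "zigzag_action A B [] x y \<longleftrightarrow> fraction_step A (Ident C B) x y"
| "zigzag_action A B (Fwd g # p) x y \<longleftrightarrow> (\<exists>z. fraction_step A g x z \<and> zigzag_action A (Cod C g) p z y)"
| "zigzag_action A B (Bwd s # p) x y \<longleftrightarrow> (\<exists>z. fraction_step A s z x \<and> zigzag_action A (Dom C s) p z y)"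

lemma zigzag_action_start:
  "zigzag C W B D p \<Longrightarrow> zigzag_action A B p x y \<Longrightarrow> fraction A B x"
  by (induction rule: zigzag.induct) (auto dest: fraction_step_fraction simp: in_hom)

lemma zigzag_action_ident:
  assumes "zigzag C W B D p" "fraction_step A (Ident C B) x z" "zigzag_action A B p z y"
  shows "zigzag_action A B p x y"
  using assms(1)
proof cases
  case nil
  then show ?thesis
    using assms(2,3) fraction_step_comp[of A "Ident C B" x z "Ident C B" y] by simp
next
  case (fwd f E q)
  then have f: "Dom C f = B" by (simp add: in_hom)
  obtain w where "fraction_step A f z w" "zigzag_action A (Cod C f) q w y"
    using assms(3) fwd(1) by auto
  moreover from this(1) have "fraction_step A f x w"
    using fraction_step_ident_left[of A f x z w] assms(2) f by simp
  ultimately show ?thesis unfolding fwd(1) zigzag_action.simps by blast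
next
  case (bwd s E q)
  then have s: "Cod C s = B" "B \<in> Obj C" using cod_obj by (auto simp: in_hom)
  obtain w where "fraction_step A s w z" "zigzag_action A (Dom C s) q w y"
    using assms(3) bwd(1) by auto
  moreover from this(1) have "fraction_step A s w x"
    using fraction_step_ident_right[of A s w z x] fraction_step_sym[OF s(2) assms(2)] s by simp
  ultimately show ?thesis unfolding bwd(1) zigzag_action.simps by blast
qed

lemma zigzag_action_append:
  assumes "zigzag C W B D p" "zigzag C W D E q"
  shows "zigzag_action A B (p @ q) x y \<longleftrightarrow> (\<exists>z. zigzag_action A B p x z \<and> zigzag_action A D q z y)"
  using assms
proof (induction arbitrary: x rule: zigzag.induct)
  case (nil B)
  then show ?case
    using zigzag_action_ident zigzag_action_start fraction_step_refl by (metis append_Nil zigzag_action.simps(1))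
next
  case (fwd f B D p E)
  then show ?case by (auto simp: in_hom)
next
  case (bwd s D B p E)
  then show ?case by (auto simp: in_hom)
qed

text \<open>The generating relations of zigzags hold for the corresponding relations between fractions,
  as steps are functional and, for elements of \<open>W\<close>, bijective on equivalence classes.\<close>

lemma zigzag_action_cong:
  "zigzag_eq C W B D p q \<Longrightarrow> zigzag_action A B p x y \<longleftrightarrow> zigzag_action A B q x y"
proof (induction arbitrary: x y rule: zigzag_eq.induct)
  case (append B D p p' E q q')
  then have "zigzag C W B D p" "zigzag C W B D p'" "zigzag C W D E q" "zigzag C W D E q'"
    using zigzag_eq_zigzag by blast+
  then show ?case using append.IH by (simp add: zigzag_action_append)
next
  case (ident B)
  show ?case
  proof
    assume "zigzag_action A B [Fwd (Ident C B)] x y"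
    then obtain z where "fraction_step A (Ident C B) x z" "fraction_step A (Ident C B) z y"
      using ident by auto
    then show "zigzag_action A B [] x y"
      using ident fraction_step_ident_left[of A "Ident C B" x z y] by simp
  next
    assume *: "zigzag_action A B [] x y"
    then have "fraction_step A (Ident C B) y y"
      using fraction_step_refl[OF fraction_step_fraction(3)[of A "Ident C B" x y]] ident by simp
    with * show "zigzag_action A B [Fwd (Ident C B)] x y"
      unfolding zigzag_action.simps using ident by (metis ident_arr(3))
  qed
next
  case (comp f B D g E)
  then have fg: "f \<in> Arr C" "g \<in> Arr C" "Cod C f = Dom C g" by (auto simp: in_hom)
  show ?case
  proof
    assume "zigzag_action A B [Fwd f, Fwd g] x y"
    then show "zigzag_action A B [Fwd (g \<cdot> f)] x y"
      using fg fraction_step_comp[OF _ _ fg(3)] unfolding zigzag_action.simps by simp metis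
  next
    assume "zigzag_action A B [Fwd (g \<cdot> f)] x y"
    then obtain w where w: "fraction_step A (g \<cdot> f) x w" "fraction_step A (Ident C (Cod C g)) w y"
      using fg by auto
    have "fraction A (Dom C f) x" using fraction_step_fraction(2)[OF w(1)] fg by simp
    then obtain z where z: "fraction_step A f x z" using fraction_step_total[OF fg(1)] by blast
    have "fraction A (Dom C g) z" using fraction_step_fraction(3)[OF z] fg by simp
    then obtain u where u: "fraction_step A g z u" using fraction_step_total[OF fg(2)] by blast
    have "fraction_step A (Ident C (Cod C (g \<cdot> f))) u w"
      by (rule fraction_step_functional[OF fraction_step_comp[OF z u fg(3)] w(1)])
    then have "fraction_step A g z w" using fg fraction_step_ident_right[OF u] by simp
    then have "fraction_step A g z y" using fraction_step_ident_right w(2) by blast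
    moreover have "fraction_step A (Ident C (Cod C g)) y y"
      using fraction_step_refl[OF fraction_step_fraction(3)[OF w(2)]] fg by simp
    ultimately show "zigzag_action A B [Fwd f, Fwd g] x y" using z unfolding zigzag_action.simps by blast
  qed
next
  case (inverse_right s B D)
  then have s: "s \<in> Arr C" "Dom C s = B" "Cod C s = D" "B \<in> Obj C" by (auto simp: in_hom)
  show ?case
  proof
    assume "zigzag_action A B [Fwd s, Bwd s] x y"
    then obtain z w where "fraction_step A s x z" "fraction_step A s w z" "fraction_step A (Ident C B) w y"
      using s by auto
    then show "zigzag_action A B [] x y"
      using fraction_step_injective[OF inverse_right(1)] s fraction_step_ident_left[of A "Ident C B" x w y]
      by simp
  next
    assume *: "zigzag_action A B [] x y"
    then have "fraction A (Dom C s) x" using fraction_step_fraction(2) s by fastforce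
    then show "zigzag_action A B [Fwd s, Bwd s] x y"
      using fraction_step_total[OF s(1)] * s unfolding zigzag_action.simps by blast
  qed
next
  case (inverse_left s D B)
  then have s: "s \<in> Arr C" "Dom C s = D" "Cod C s = B" "B \<in> Obj C" by (auto simp: in_hom)
  show ?case
  proof
    assume "zigzag_action A B [Bwd s, Fwd s] x y"
    then obtain z w where "fraction_step A s z x" "fraction_step A s z w" "fraction_step A (Ident C B) w y"
      using s by auto
    then show "zigzag_action A B [] x y"
      using fraction_step_functional[of A s z x w] s fraction_step_ident_left[of A "Ident C B" x w y]
      by simp
  next
    assume *: "zigzag_action A B [] x y"
    then have "fraction A (Cod C s) x" using fraction_step_fraction(2) s by fastforce
    then show "zigzag_action A B [Bwd s, Fwd s] x y"
      using fraction_step_surjective[OF inverse_left(1)] * s unfolding zigzag_action.simps by blast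
  qed
qed auto

text \<open>If \<open>f\<close> and \<open>g\<close> have the same image, they act in the same way on the fraction \<open>1\<inverse> 1\<close>, so \<open>1\<inverse> f\<close> and
  \<open>1\<inverse> g\<close> are equivalent fractions.  An equivalence between them is an arrow of \<open>W\<close> that equalizes
  \<open>f\<close> and \<open>g\<close>.\<close>

lemma zigzag_eq_left_equal:
  assumes "parallel C f g" "zigzag_eq C W (Dom C f) (Cod C f) [Fwd f] [Fwd g]"
  shows "\<exists>t \<in> W. Dom C t = Cod C f \<and> t \<cdot> f = t \<cdot> g"
proof -
  have p: "f \<in> Arr C" "g \<in> Arr C" "Dom C f = Dom C g" "Cod C f = Cod C g"
    using assms(1) by (auto simp: parallel_def)
  let ?A = "Dom C f" and ?B = "Cod C f"
  let ?x = "(Ident C ?A, Ident C ?A)" and ?y = "(f, Ident C ?B)"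
  have y: "fraction ?A ?B ?y"
    using p by (simp add: fraction_def W_ident)
  have "fraction_step ?A f ?x ?y"
    by (rule fraction_stepI[of f "Ident C ?B"]) (use p in \<open>simp_all add: W_ident\<close>)
  then have "zigzag_action ?A ?A [Fwd f] ?x ?y" using fraction_step_refl[OF y] by auto
  then have "zigzag_action ?A ?A [Fwd g] ?x ?y" using zigzag_action_cong[OF assms(2)] by blast
  then obtain z where "fraction_step ?A g ?x z" "fraction_step ?A (Ident C (Cod C g)) z ?y" by auto
  then have "fraction_step ?A g ?x ?y" by (rule fraction_step_ident_right)
  then obtain k v where "k \<in> Arr C" "v \<in> Arr C" "Dom C k = ?A" "Dom C v = ?B"
    "v \<cdot> Ident C ?B \<in> W" "v \<cdot> f = k \<cdot> Ident C ?A" "v \<cdot> Ident C ?B \<cdot> g = k \<cdot> Ident C ?A"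
    unfolding fraction_step_def fraction_witness_def using p by auto
  then show ?thesis using p by (intro bexI[of _ v]) auto
qed

end

locale localized = multiplicative_system M W + symmetric_monoidal_category M
  for M :: "('o, 'a, 'm) moncat_scheme" (structure) and W :: "'a set"
begin

abbreviation "LM \<equiv> localization M W"
abbreviation "L \<equiv> loc_arr M W"
abbreviation comp_L (infixr "\<cdot>\<^sub>L" 72) where "g \<cdot>\<^sub>L f \<equiv> g \<cdot>\<^bsub>LM\<^esub> f"
abbreviation tensor_L (infixr "\<otimes>\<^sub>L" 74) where "f \<otimes>\<^sub>L g \<equiv> f \<otimes>\<^bsub>LM\<^esub> g"

text \<open>Induction on the zigzag, adding one step at its source.  A backward step \<open>s\<close> is moved past the
  numerator \<open>f\<close> by an Ore square \<open>s' f = f' s\<close>.\<close>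

lemma localization_left_fraction:
  assumes "zigzag M W A B p"
  shows "\<exists>t \<in> W. \<exists>f \<in> Arr M. Dom M t = B \<and> Dom M f = A \<and> Cod M t = Cod M f
    \<and> L t \<cdot>\<^sub>L zarr M W A B p = L f"
  using assms
proof (induction rule: zigzag.induct)
  interpret D: category LM by (rule localization_category[OF category_axioms])
  note LF = functorD[OF localization_functor[OF category_axioms, of W]]
  case (nil A)
  have "L (Ident M A) \<cdot>\<^sub>L zarr M W A A [] = L (Ident M A)"
    using D.ident_right[of "L (Ident M A)" A] LF(4-6)[of "Ident M A"] nil by simp
  then show ?case using nil by (intro bexI[of _ "Ident M A"]) (auto simp: W_ident)
next
  interpret D: category LM by (rule localization_category[OF category_axioms])
  note LF = functorD[OF localization_functor[OF category_axioms, of W]]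
  case (fwd g A B D p)
  then obtain t f where t: "t \<in> W" "f \<in> Arr M" "Dom M t = D" "Dom M f = B" "Cod M t = Cod M f"
    "L t \<cdot>\<^sub>L zarr M W B D p = L f" by blast
  have ta: "t \<in> Arr M" using t(1) by (rule W_arr)
  have g: "g \<in> Arr M" "Dom M g = A" "Cod M g = B" using fwd by (auto simp: in_hom)
  have z: "zarr M W A D (Fwd g # p) = zarr M W B D p \<cdot>\<^sub>L L g"
    using localization_comp[OF zigzag_single[OF g(1), of W, unfolded g(2,3)] fwd(2)] g by (simp add: loc_arr_zarr)
  have "L t \<cdot>\<^sub>L zarr M W A D (Fwd g # p) = (L t \<cdot>\<^sub>L zarr M W B D p) \<cdot>\<^sub>L L g"
    unfolding z by (rule D.comp_assoc_arr[symmetric])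
      (use t(3) ta g fwd(2) LF(4-6)[of t] LF(4-6)[of g] in auto)
  also have "\<dots> = L (f \<cdot> g)" using t g LF(8)[of g f] by simp
  finally show ?case using t g by (intro bexI[of _ t] bexI[of _ "f \<cdot> g"]) auto
next
  interpret D: category LM by (rule localization_category[OF category_axioms])
  note LF = functorD[OF localization_functor[OF category_axioms, of W]]
  case (bwd s B A D p)
  then obtain t f where t: "t \<in> W" "f \<in> Arr M" "Dom M t = D" "Dom M f = B" "Cod M t = Cod M f"
    "L t \<cdot>\<^sub>L zarr M W B D p = L f" by blast
  have ta: "t \<in> Arr M" using t(1) by (rule W_arr)
  have s: "s \<in> Arr M" "Dom M s = B" "Cod M s = A" using bwd by (auto simp: in_hom)
  obtain s' f' where s': "s' \<in> W" "f' \<in> Arr M" "Dom M s' = Cod M f" "Dom M f' = A"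
    "Cod M s' = Cod M f'" "s' \<cdot> f = f' \<cdot> s"
    using left_ore[OF bwd(1), of f] t s by auto
  have sa: "s' \<in> Arr M" using s'(1) by (rule W_arr)
  have iss: "iso LM (L s)" by (rule localization_inverts(1)[OF category_axioms bwd(1) s(1)])
  let ?r = "zarr M W A B [Bwd s]"
  have r: "zigzag M W A B [Bwd s]" using zigzag_single_bwd[OF bwd(1) s(1)] s by simp
  then have ra: "?r \<in> Arr LM" by auto
  have z: "zarr M W A D (Bwd s # p) = zarr M W B D p \<cdot>\<^sub>L ?r"
    using localization_comp[OF r bwd(3)] by simp
  have pa: "zarr M W B D p \<in> Arr LM" using bwd(3) by auto
  note ty = LF(4-6)[OF ta] LF(4-6)[OF s(1)] LF(4-6)[OF sa] LF(4-6)[OF t(2)] LF(4-6)[OF s'(2)] ra pa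
  have "L (s' \<cdot> t) \<cdot>\<^sub>L zarr M W A D (Bwd s # p) = (L s' \<cdot>\<^sub>L L t) \<cdot>\<^sub>L (zarr M W B D p \<cdot>\<^sub>L ?r)"
    using z LF(8)[of t s'] ta sa t s' by simp
  also have "\<dots> = L s' \<cdot>\<^sub>L ((L t \<cdot>\<^sub>L zarr M W B D p) \<cdot>\<^sub>L ?r)"
    using ty t(3-5) s'(3-5)
    by (simp add: D.comp_assoc_arr)
  also have "\<dots> = (L s' \<cdot>\<^sub>L L f) \<cdot>\<^sub>L ?r"
    unfolding t(6) using ty t(3-5) s'(3-5) by (simp add: D.comp_assoc_arr)
  also have "L s' \<cdot>\<^sub>L L f = L f' \<cdot>\<^sub>L L s"
    using LF(8)[of f s'] LF(8)[of s f'] s' t sa s by simp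
  also have "(L f' \<cdot>\<^sub>L L s) \<cdot>\<^sub>L ?r = L f' \<cdot>\<^sub>L (L s \<cdot>\<^sub>L ?r)"
    using ty s s'(3-5) by (simp add: D.comp_assoc_arr)
  also have "\<dots> = L f'"
    using localization_inverts(2)[OF category_axioms bwd(1) s(1)] s ty s'(4) D.ident_right[of "L f'" A]
    by (simp)
  finally show ?case using W_comp[OF t(1) s'(1)] s' t ta sa
    by (intro bexI[of _ "s' \<cdot> t"] bexI[of _ f']) auto
qed

text \<open>Right fractions are obtained from left fractions by an Ore square, and arrows equalized on the
  left by an element of \<open>W\<close> are equalized on the right by cancellation.\<close>

lemma localization_fraction_functor: "fraction_functor M LM L W"
proof -
  interpret D: category LM by (rule localization_category[OF category_axioms])
  note F = localization_functor[OF category_axioms, of W]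
  note LF = functorD[OF F]
  have left: "\<exists>t \<in> W. \<exists>f \<in> Arr M. Dom M t = Cod LM h \<and> Dom M f = Dom LM h
      \<and> Cod M t = Cod M f \<and> L t \<cdot>\<^sub>L h = L f" if "h \<in> Arr LM" for h
    using that localization_left_fraction by (auto simp: localization_arr)
  have inv: "iso LM (L s)" if "s \<in> W" for s
    using localization_inverts(1)[OF category_axioms that W_arr[OF that]] .
  have left_eq: "\<exists>t \<in> W. Dom M t = Cod M f \<and> t \<cdot> f = t \<cdot> g" if "parallel M f g" "L f = L g" for f g
  proof (rule zigzag_eq_left_equal[OF that(1)])
    have "zigzag M W (Dom M f) (Cod M f) [Fwd g]"
      using zigzag_single[of g W] that(1) by (auto simp: parallel_def)
    then show "zigzag_eq M W (Dom M f) (Cod M f) [Fwd f] [Fwd g]"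
      using that by (intro zarr_eqD) (auto simp: loc_arr_zarr parallel_def)
  qed
  show ?thesis
  proof
    show "\<exists>s \<in> W. \<exists>f \<in> Arr M. Cod M s = Dom LM h \<and> Cod M f = Cod LM h
      \<and> Dom M s = Dom M f \<and> h \<cdot>\<^sub>L L s = L f" if h: "h \<in> Arr LM" for h
    proof -
      obtain t f where t: "t \<in> W" "f \<in> Arr M" "Dom M t = Cod LM h" "Dom M f = Dom LM h"
        "Cod M t = Cod M f" "L t \<cdot>\<^sub>L h = L f" using left[OF h] by blast
      have ta: "t \<in> Arr M" using t(1) by (rule W_arr)
      obtain s g where s: "s \<in> W" "g \<in> Arr M" "Cod M s = Dom M f" "Cod M g = Dom M t"
        "Dom M s = Dom M g" "f \<cdot> s = t \<cdot> g" using right_ore[OF t(1,2,5)] by blast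
      have sa: "s \<in> Arr M" using s(1) by (rule W_arr)
      note ty = LF(4-6)[OF ta] LF(4-6)[OF sa] LF(4-6)[OF t(2)] LF(4-6)[OF s(2)] h
      have "L t \<cdot>\<^sub>L (h \<cdot>\<^sub>L L s) = (L t \<cdot>\<^sub>L h) \<cdot>\<^sub>L L s"
        using ty t(3,4) s(3) by (simp add: D.comp_assoc_arr)
      also have "\<dots> = L t \<cdot>\<^sub>L L g"
        using t(6) LF(8)[of s f] LF(8)[of g t] s t ta sa by simp
      finally have "h \<cdot>\<^sub>L L s = L g"
        by (rule D.iso_cancel_left[OF inv[OF t(1)]])
          (use ty t(3,4) s(3,4) in \<open>simp_all\<close>)
      then show ?thesis using s t by auto
    qed
    show "\<exists>s \<in> W. Cod M s = Dom M f \<and> f \<cdot> s = g \<cdot> s" if *: "parallel M f g" "L f = L g" for f g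
    proof -
      obtain t where "t \<in> W" "Dom M t = Cod M f" "t \<cdot> f = t \<cdot> g" using left_eq[OF *] by blast
      then show ?thesis using right_cancel[OF *(1)] by blast
    qed
  qed (use F left inv left_eq W_arr W_comp in auto)
qed

end

section \<open>The symmetric monoidal structure of the localization\<close>

text \<open>The extension to the localization of an endofunctor that maps \<open>T\<close> into itself.\<close>

fun loc_map :: "('o, 'a, 'm) cat_scheme \<Rightarrow> 'a set \<Rightarrow> ('o \<Rightarrow> 'o) \<Rightarrow> ('a \<Rightarrow> 'a)
    \<Rightarrow> ('o, 'a) zarr \<Rightarrow> ('o, 'a) zarr" where
  "loc_map C T Fo Fa (A, B, P) =
     (Fo A, Fo B, \<Union>p \<in> P. zigzag_class C T (Fo A) (Fo B) (map (map_zstep Fa) p))"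

lemma zigzag_map:
  assumes F: "is_functor C C Fo Fa" and T: "Fa ` T \<subseteq> T"
  shows "zigzag C T A B p \<Longrightarrow> zigzag C T (Fo A) (Fo B) (map (map_zstep Fa) p)"
  by (induction rule: zigzag.induct)
    (use T in \<open>auto intro!: zigzag.intros simp: functorD[OF F] in_hom\<close>)

lemma zigzag_eq_map:
  assumes F: "is_functor C C Fo Fa" and T: "Fa ` T \<subseteq> T"
  shows "zigzag_eq C T A B p q \<Longrightarrow>
    zigzag_eq C T (Fo A) (Fo B) (map (map_zstep Fa) p) (map (map_zstep Fa) q)"
proof (induction rule: zigzag_eq.induct)
  case (comp f A B g D)
  then have "Fa (g \<cdot>\<^bsub>C\<^esub> f) = Fa g \<cdot>\<^bsub>C\<^esub> Fa f" "Fa f \<in> hom C (Fo A) (Fo B)" "Fa g \<in> hom C (Fo B) (Fo D)"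
    by (auto simp: functorD[OF F] in_hom)
  then show ?case by (auto intro: zigzag_eq.comp)
next
  case (inverse_right s A B)
  then show ?case
    using T by (auto intro!: zigzag_eq.inverse_right simp: functorD[OF F] in_hom)
next
  case (inverse_left s A B)
  then show ?case
    using T by (auto intro!: zigzag_eq.inverse_left[where A = "Fo A"] simp: functorD[OF F] in_hom)
qed (auto intro: zigzag_eq.intros zigzag_map[OF F T] simp: functorD[OF F])

lemma loc_map_zarr:
  assumes F: "is_functor C C Fo Fa" and T: "Fa ` T \<subseteq> T" and p: "zigzag C T A B p"
  shows "loc_map C T Fo Fa (zarr C T A B p) = zarr C T (Fo A) (Fo B) (map (map_zstep Fa) p)"
  unfolding zarr_def loc_map.simps
  by (subst UN_zigzag_class[OF _ p])
    (use zigzag_class_eqI[OF zigzag_eq.sym[OF zigzag_eq_map[OF F T]]] in auto)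

lemma loc_map_functor:
  assumes F: "is_functor M M Fo Fa" and T: "Fa ` T \<subseteq> T"
  shows "is_functor (localization M T) (localization M T) Fo (loc_map M T Fo Fa)"
proof -
  interpret category M by (rule functorD[OF F])
  note z = loc_map_zarr[OF F T] zigzag_map[OF F T]
  have cat: "category (localization M T)" by (rule localization_category[OF category_axioms])
  show ?thesis
  proof (rule functorI[OF cat cat])
    show "loc_map M T Fo Fa (g \<cdot>\<^bsub>localization M T\<^esub> f)
        = loc_map M T Fo Fa g \<cdot>\<^bsub>localization M T\<^esub> loc_map M T Fo Fa f"
      if "f \<in> Arr (localization M T)" "g \<in> Arr (localization M T)"
        "Cod (localization M T) f = Dom (localization M T) g" for f g
      using that by (auto simp: localization_arr localization_comp z zigzag_append)
    show "loc_map M T Fo Fa (Ident (localization M T) A) = Ident (localization M T) (Fo A)"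
      if "A \<in> Obj (localization M T)" for A
      using that by (auto simp: z zigzag.nil)
    fix f assume "f \<in> Arr (localization M T)"
    then obtain A B p where f: "f = zarr M T A B p" "zigzag M T A B p" unfolding localization_arr by blast
    show "loc_map M T Fo Fa f \<in> Arr (localization M T)"
      "Dom (localization M T) (loc_map M T Fo Fa f) = Fo (Dom (localization M T) f)"
      "Cod (localization M T) (loc_map M T Fo Fa f) = Fo (Cod (localization M T) f)"
      using f(2) by (simp_all add: f(1) z)
  qed (simp add: functorD[OF F])
qed

lemma loc_map_loc_arr:
  assumes F: "is_functor M M Fo Fa" and T: "Fa ` T \<subseteq> T" and f: "f \<in> Arr M"
  shows "loc_map M T Fo Fa (loc_arr M T f) = loc_arr M T (Fa f)"
proof -
  interpret category M by (rule functorD[OF F])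
  show ?thesis
    using loc_map_zarr[OF F T zigzag_single[OF f]] f by (simp add: loc_arr_zarr functorD[OF F])
qed

context symmetric_monoidal_category
begin

lemma interchange_arr:
  "\<lbrakk>f \<in> Arr M; f' \<in> Arr M; Cod M f = Dom M f'; g \<in> Arr M; g' \<in> Arr M; Cod M g = Dom M g'\<rbrakk>
    \<Longrightarrow> (f' \<otimes> g') \<cdot> (f \<otimes> g) = (f' \<cdot> f) \<otimes> (g' \<cdot> g)"
  using interchange[of f "Dom M f" "Dom M f'" f' "Cod M f'" g "Dom M g" "Dom M g'" g' "Cod M g'"]
  by (simp add: in_hom)

lemma tensor_right_functor:
  assumes "B \<in> Obj M"
  shows "is_functor M M (\<lambda>A. A \<otimes>\<^sub>o B) (\<lambda>f. f \<otimes> Ident M B)"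
  by (rule functorI[OF category_axioms category_axioms])
    (use assms in \<open>simp_all add: tobj_obj tarr_ident interchange_arr\<close>)

lemma tensor_left_functor:
  assumes "A \<in> Obj M"
  shows "is_functor M M (\<lambda>B. A \<otimes>\<^sub>o B) (\<lambda>f. Ident M A \<otimes> f)"
  by (rule functorI[OF category_axioms category_axioms])
    (use assms in \<open>simp_all add: tobj_obj tarr_ident interchange_arr\<close>)

lemma structure_arr [simp]:
  assumes "A \<in> Obj M"
  shows "lunit M A \<in> Arr M" "Dom M (lunit M A) = unit_obj M \<otimes>\<^sub>o A" "Cod M (lunit M A) = A"
    "runit M A \<in> Arr M" "Dom M (runit M A) = A \<otimes>\<^sub>o unit_obj M" "Cod M (runit M A) = A"
    "B \<in> Obj M \<Longrightarrow> braid M A B \<in> Arr M" "B \<in> Obj M \<Longrightarrow> Dom M (braid M A B) = A \<otimes>\<^sub>o B"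
    "B \<in> Obj M \<Longrightarrow> Cod M (braid M A B) = B \<otimes>\<^sub>o A"
    "\<lbrakk>B \<in> Obj M; D \<in> Obj M\<rbrakk> \<Longrightarrow> assoc M A B D \<in> Arr M"
    "\<lbrakk>B \<in> Obj M; D \<in> Obj M\<rbrakk> \<Longrightarrow> Dom M (assoc M A B D) = (A \<otimes>\<^sub>o B) \<otimes>\<^sub>o D"
    "\<lbrakk>B \<in> Obj M; D \<in> Obj M\<rbrakk> \<Longrightarrow> Cod M (assoc M A B D) = A \<otimes>\<^sub>o (B \<otimes>\<^sub>o D)"
  using lunit_hom[OF assms] runit_hom[OF assms] braid_hom[OF assms] assoc_hom[OF assms]
  by (auto simp: in_hom)

lemma assoc_natural_single:
  assumes f: "f \<in> Arr M" and "X \<in> Obj M" "Y \<in> Obj M"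
  shows "assoc M (Cod M f) X Y \<cdot> ((f \<otimes> Ident M X) \<otimes> Ident M Y) = (f \<otimes> Ident M (X \<otimes>\<^sub>o Y)) \<cdot> assoc M (Dom M f) X Y"
    and "assoc M X (Cod M f) Y \<cdot> ((Ident M X \<otimes> f) \<otimes> Ident M Y) = (Ident M X \<otimes> (f \<otimes> Ident M Y)) \<cdot> assoc M X (Dom M f) Y"
    and "assoc M X Y (Cod M f) \<cdot> (Ident M (X \<otimes>\<^sub>o Y) \<otimes> f) = (Ident M X \<otimes> (Ident M Y \<otimes> f)) \<cdot> assoc M X Y (Dom M f)"
proof -
  have f': "f \<in> hom M (Dom M f) (Cod M f)" using f by (simp add: in_hom)
  note i = ident_hom[OF assms(2)] ident_hom[OF assms(3)]
  show "assoc M (Cod M f) X Y \<cdot> ((f \<otimes> Ident M X) \<otimes> Ident M Y) = (f \<otimes> Ident M (X \<otimes>\<^sub>o Y)) \<cdot> assoc M (Dom M f) X Y"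
    using assoc_natural[OF f' i] by (simp add: tarr_ident assms)
  show "assoc M X (Cod M f) Y \<cdot> ((Ident M X \<otimes> f) \<otimes> Ident M Y) = (Ident M X \<otimes> (f \<otimes> Ident M Y)) \<cdot> assoc M X (Dom M f) Y"
    using assoc_natural[OF i(1) f' i(2)] .
  show "assoc M X Y (Cod M f) \<cdot> (Ident M (X \<otimes>\<^sub>o Y) \<otimes> f) = (Ident M X \<otimes> (Ident M Y \<otimes> f)) \<cdot> assoc M X Y (Dom M f)"
    using assoc_natural[OF i f'] by (simp add: tarr_ident assms)
qed

lemma unit_braid_natural_single:
  assumes f: "f \<in> Arr M"
  shows "lunit M (Cod M f) \<cdot> (Ident M (unit_obj M) \<otimes> f) = f \<cdot> lunit M (Dom M f)"
    and "runit M (Cod M f) \<cdot> (f \<otimes> Ident M (unit_obj M)) = f \<cdot> runit M (Dom M f)"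
    and "X \<in> Obj M \<Longrightarrow> braid M (Cod M f) X \<cdot> (f \<otimes> Ident M X) = (Ident M X \<otimes> f) \<cdot> braid M (Dom M f) X"
    and "X \<in> Obj M \<Longrightarrow> braid M X (Cod M f) \<cdot> (Ident M X \<otimes> f) = (f \<otimes> Ident M X) \<cdot> braid M X (Dom M f)"
proof -
  have f': "f \<in> hom M (Dom M f) (Cod M f)" using f by (simp add: in_hom)
  show "lunit M (Cod M f) \<cdot> (Ident M (unit_obj M) \<otimes> f) = f \<cdot> lunit M (Dom M f)"
    by (rule lunit_natural[OF f'])
  show "runit M (Cod M f) \<cdot> (f \<otimes> Ident M (unit_obj M)) = f \<cdot> runit M (Dom M f)"
    by (rule runit_natural[OF f'])
  show "braid M (Cod M f) X \<cdot> (f \<otimes> Ident M X) = (Ident M X \<otimes> f) \<cdot> braid M (Dom M f) X" if "X \<in> Obj M"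
    using braid_natural[OF f' ident_hom[OF that]] .
  show "braid M X (Cod M f) \<cdot> (Ident M X \<otimes> f) = (f \<otimes> Ident M X) \<cdot> braid M X (Dom M f)" if "X \<in> Obj M"
    using braid_natural[OF ident_hom[OF that] f'] .
qed

end

locale monoidal_localized = localized M W
  for M :: "('o, 'a, 'm) moncat_scheme" (structure) and W :: "'a set" +
  assumes W_tensor: "\<lbrakk>s \<in> W; X \<in> Obj M\<rbrakk> \<Longrightarrow> Ident M X \<otimes> s \<in> W"
    "\<lbrakk>s \<in> W; X \<in> Obj M\<rbrakk> \<Longrightarrow> s \<otimes> Ident M X \<in> W"
begin

sublocale loc: fraction_functor M LM L W
  by (rule localization_fraction_functor)

declare localization_simps(4,6) [simp del]

definition rtensor :: "'o \<Rightarrow> ('o, 'a) zarr \<Rightarrow> ('o, 'a) zarr" where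
  "rtensor B = loc_map M W (\<lambda>A. A \<otimes>\<^sub>o B) (\<lambda>f. f \<otimes> Ident M B)"

definition ltensor :: "'o \<Rightarrow> ('o, 'a) zarr \<Rightarrow> ('o, 'a) zarr" where
  "ltensor A = loc_map M W (\<lambda>B. A \<otimes>\<^sub>o B) (\<lambda>f. Ident M A \<otimes> f)"

lemma rtensor_functor: "B \<in> Obj M \<Longrightarrow> is_functor LM LM (\<lambda>A. A \<otimes>\<^sub>o B) (rtensor B)"
  unfolding rtensor_def by (rule loc_map_functor[OF tensor_right_functor]) (auto intro: W_tensor)

lemma ltensor_functor: "A \<in> Obj M \<Longrightarrow> is_functor LM LM (\<lambda>B. A \<otimes>\<^sub>o B) (ltensor A)"
  unfolding ltensor_def by (rule loc_map_functor[OF tensor_left_functor]) (auto intro: W_tensor)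

lemma rtensor_L: "\<lbrakk>B \<in> Obj M; f \<in> Arr M\<rbrakk> \<Longrightarrow> rtensor B (L f) = L (f \<otimes> Ident M B)"
  unfolding rtensor_def by (rule loc_map_loc_arr[OF tensor_right_functor]) (auto intro: W_tensor)

lemma ltensor_L: "\<lbrakk>A \<in> Obj M; f \<in> Arr M\<rbrakk> \<Longrightarrow> ltensor A (L f) = L (Ident M A \<otimes> f)"
  unfolding ltensor_def by (rule loc_map_loc_arr[OF tensor_left_functor]) (auto intro: W_tensor)

lemma rtensor_arr [simp]:
  assumes "B \<in> Obj M" "f \<in> Arr LM"
  shows "rtensor B f \<in> Arr LM" "Dom LM (rtensor B f) = Dom LM f \<otimes>\<^sub>o B" "Cod LM (rtensor B f) = Cod LM f \<otimes>\<^sub>o B"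
  using functorD(4-6)[OF rtensor_functor[OF assms(1)] assms(2)] by auto

lemma ltensor_arr [simp]:
  assumes "A \<in> Obj M" "f \<in> Arr LM"
  shows "ltensor A f \<in> Arr LM" "Dom LM (ltensor A f) = A \<otimes>\<^sub>o Dom LM f" "Cod LM (ltensor A f) = A \<otimes>\<^sub>o Cod LM f"
  using functorD(4-6)[OF ltensor_functor[OF assms(1)] assms(2)] by auto

lemma rtensor_comp:
  "\<lbrakk>B \<in> Obj M; f \<in> Arr LM; g \<in> Arr LM; Cod LM f = Dom LM g\<rbrakk>
    \<Longrightarrow> rtensor B (g \<cdot>\<^sub>L f) = rtensor B g \<cdot>\<^sub>L rtensor B f"
  by (rule functorD(8)[OF rtensor_functor])

lemma ltensor_comp:
  "\<lbrakk>A \<in> Obj M; f \<in> Arr LM; g \<in> Arr LM; Cod LM f = Dom LM g\<rbrakk>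
    \<Longrightarrow> ltensor A (g \<cdot>\<^sub>L f) = ltensor A g \<cdot>\<^sub>L ltensor A f"
  by (rule functorD(8)[OF ltensor_functor])

lemma loc_obj [simp]: "f \<in> Arr LM \<Longrightarrow> Dom LM f \<in> Obj M" "f \<in> Arr LM \<Longrightarrow> Cod LM f \<in> Obj M"
  using loc.D.dom_cod_obj[of f] by simp_all

lemma loc_tarr_eq:
  assumes "f \<in> Arr LM" "g \<in> Arr LM"
  shows "f \<otimes>\<^sub>L g = ltensor (Cod LM f) g \<cdot>\<^sub>L rtensor (Dom LM g) f"
proof -
  obtain A A' p B B' q where f: "f = zarr M W A A' p" "zigzag M W A A' p"
    and g: "g = zarr M W B B' q" "zigzag M W B B' q"
    using assms unfolding localization_arr by blast
  have ob: "A' \<in> Obj M" "B \<in> Obj M" using f g zigzag_obj by blast+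
  let ?R = "map (map_zstep (\<lambda>f. f \<otimes> Ident M B))" and ?L = "map (map_zstep (\<lambda>f. Ident M A' \<otimes> f))"
  let ?cl = "\<lambda>p q. zigzag_class M W (A \<otimes>\<^sub>o B) (A' \<otimes>\<^sub>o B') (?R p @ ?L q)"
  note R = tensor_right_functor[OF ob(2)] and L = tensor_left_functor[OF ob(1)]
  have RT: "(\<lambda>f. f \<otimes> Ident M B) ` W \<subseteq> W" and LT: "(\<lambda>f. Ident M A' \<otimes> f) ` W \<subseteq> W"
    using W_tensor ob by auto
  have cong: "?cl p' q' = ?cl p q" if "zigzag_eq M W A A' p p'" "zigzag_eq M W B B' q q'" for p' q'
    using zigzag_class_eqI[OF zigzag_eq.append[OF zigzag_eq_map[OF R RT that(1)] zigzag_eq_map[OF L LT that(2)]]]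
    by simp
  have inner: "(\<Union>q' \<in> zigzag_class M W B B' q. ?cl p' q') = ?cl p q" if "zigzag_eq M W A A' p p'" for p'
    using UN_zigzag_class[of M W B B' q "?cl p'"] cong[OF that] g(2) zigzag_eq.refl by metis
  have "(\<Union>p' \<in> zigzag_class M W A A' p. \<Union>q' \<in> zigzag_class M W B B' q. ?cl p' q') = ?cl p q"
    using UN_zigzag_class[of M W A A' p "\<lambda>p'. \<Union>q' \<in> zigzag_class M W B B' q. ?cl p' q'"] inner f(2) zigzag_eq.refl
    by metis
  then have "loc_tarr M W f g = zarr M W (A \<otimes>\<^sub>o B) (A' \<otimes>\<^sub>o B') (?R p @ ?L q)"
    by (simp add: f g zarr_def)
  also have "\<dots> = ltensor A' g \<cdot>\<^sub>L rtensor B f"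
    unfolding f(1) g(1) ltensor_def rtensor_def
    using loc_map_zarr[OF R RT f(2)] loc_map_zarr[OF L LT g(2)]
      localization_comp[OF zigzag_map[OF R RT f(2)] zigzag_map[OF L LT g(2)]] by simp
  finally show ?thesis by (simp add: f g localization_simps(6))
qed

text \<open>That tensoring on the left and on the right commute, which gives the interchange law, is proved
  in two steps, each an instance of \<open>naturality_extends\<close>: first for
  the image of an arrow \<open>a\<close> and an arbitrary \<open>g\<close>, and from this for arbitrary \<open>f\<close> and \<open>g\<close>.\<close>

lemma ltensor_rtensor_L:
  assumes a: "a \<in> Arr M" and g: "g \<in> Arr LM"
  shows "L (a \<otimes> Ident M (Cod LM g)) \<cdot>\<^sub>L ltensor (Dom M a) g
    = ltensor (Cod M a) g \<cdot>\<^sub>L L (a \<otimes> Ident M (Dom LM g))"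
  by (rule loc.naturality_extends[OF ltensor_functor ltensor_functor, where \<eta> = "\<lambda>B. L (a \<otimes> Ident M B)"])
    (use a g in \<open>simp_all add: ltensor_L interchange_arr flip: loc.L_comp\<close>)

lemma ltensor_rtensor:
  assumes f: "f \<in> Arr LM" and g: "g \<in> Arr LM"
  shows "ltensor (Cod LM f) g \<cdot>\<^sub>L rtensor (Dom LM g) f
    = rtensor (Cod LM g) f \<cdot>\<^sub>L ltensor (Dom LM f) g"
  by (rule loc.naturality_extends[OF rtensor_functor rtensor_functor, where \<eta> = "\<lambda>A. ltensor A g"])
    (use f g in \<open>simp_all add: rtensor_L ltensor_rtensor_L\<close>)

lemma tarr_L:
  assumes "f \<in> Arr M" "g \<in> Arr M"
  shows "L f \<otimes>\<^sub>L L g = L (f \<otimes> g)"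
  using assms by (simp add: loc_tarr_eq ltensor_L rtensor_L interchange_arr flip: loc.L_comp)

lemma loc_ident: "A \<in> Obj M \<Longrightarrow> Ident LM A = L (Ident M A)"
  by (simp add: loc.L_ident)

lemma rtensor_ident [simp]: "\<lbrakk>A \<in> Obj M; B \<in> Obj M\<rbrakk> \<Longrightarrow> rtensor B (Ident LM A) = Ident LM (A \<otimes>\<^sub>o B)"
  using functorD(7)[OF rtensor_functor, of B A] by simp

lemma ltensor_ident [simp]: "\<lbrakk>A \<in> Obj M; B \<in> Obj M\<rbrakk> \<Longrightarrow> ltensor A (Ident LM B) = Ident LM (A \<otimes>\<^sub>o B)"
  using functorD(7)[OF ltensor_functor, of A B] by simp

lemma tensor_ident:
  assumes "f \<in> Arr LM" "X \<in> Obj M"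
  shows "f \<otimes>\<^sub>L Ident LM X = rtensor X f"
proof -
  have "Ident LM X \<in> Arr LM" "Dom LM (Ident LM X) = X" "Cod LM f \<otimes>\<^sub>o X \<in> Obj M"
    using assms loc.D.ident_arr[of X] tobj_obj by simp_all
  then show ?thesis
    using assms loc.D.ident_left[of "rtensor X f" "Cod LM f \<otimes>\<^sub>o X"] by (simp add: loc_tarr_eq)
qed

lemma loc_assoc_natural:
  assumes f: "f \<in> Arr LM" and X: "X \<in> Obj M" and Y: "Y \<in> Obj M"
  shows "L (assoc M (Cod LM f) X Y) \<cdot>\<^sub>L rtensor Y (rtensor X f)
      = rtensor (X \<otimes>\<^sub>o Y) f \<cdot>\<^sub>L L (assoc M (Dom LM f) X Y)"
    and "L (assoc M X (Cod LM f) Y) \<cdot>\<^sub>L rtensor Y (ltensor X f)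
      = ltensor X (rtensor Y f) \<cdot>\<^sub>L L (assoc M X (Dom LM f) Y)"
    and "L (assoc M X Y (Cod LM f)) \<cdot>\<^sub>L ltensor (X \<otimes>\<^sub>o Y) f
      = ltensor X (ltensor Y f) \<cdot>\<^sub>L L (assoc M X Y (Dom LM f))"
proof -
  note XY = tobj_obj[OF X Y]
  note s = rtensor_L ltensor_L tobj_obj assoc_natural_single
  show "L (assoc M (Cod LM f) X Y) \<cdot>\<^sub>L rtensor Y (rtensor X f)
      = rtensor (X \<otimes>\<^sub>o Y) f \<cdot>\<^sub>L L (assoc M (Dom LM f) X Y)"
    by (rule loc.naturality_extends[OF functor_comp[OF rtensor_functor[OF X] rtensor_functor[OF Y]]
          rtensor_functor[OF XY], where \<eta> = "\<lambda>A. L (assoc M A X Y)"])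
      (use f X Y in \<open>simp_all add: s flip: loc.L_comp\<close>)
  show "L (assoc M X (Cod LM f) Y) \<cdot>\<^sub>L rtensor Y (ltensor X f)
      = ltensor X (rtensor Y f) \<cdot>\<^sub>L L (assoc M X (Dom LM f) Y)"
    by (rule loc.naturality_extends[OF functor_comp[OF ltensor_functor[OF X] rtensor_functor[OF Y]]
          functor_comp[OF rtensor_functor[OF Y] ltensor_functor[OF X]], where \<eta> = "\<lambda>A. L (assoc M X A Y)"])
      (use f X Y in \<open>simp_all add: s flip: loc.L_comp\<close>)
  show "L (assoc M X Y (Cod LM f)) \<cdot>\<^sub>L ltensor (X \<otimes>\<^sub>o Y) f
      = ltensor X (ltensor Y f) \<cdot>\<^sub>L L (assoc M X Y (Dom LM f))"
    by (rule loc.naturality_extends[OF ltensor_functor[OF XY]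
          functor_comp[OF ltensor_functor[OF Y] ltensor_functor[OF X]], where \<eta> = "\<lambda>A. L (assoc M X Y A)"])
      (use f X Y in \<open>simp_all add: s flip: loc.L_comp\<close>)
qed

lemma loc_unit_braid_natural:
  assumes f: "f \<in> Arr LM"
  shows "L (lunit M (Cod LM f)) \<cdot>\<^sub>L ltensor (unit_obj M) f = f \<cdot>\<^sub>L L (lunit M (Dom LM f))"
    and "L (runit M (Cod LM f)) \<cdot>\<^sub>L rtensor (unit_obj M) f = f \<cdot>\<^sub>L L (runit M (Dom LM f))"
    and "X \<in> Obj M \<Longrightarrow> L (braid M (Cod LM f) X) \<cdot>\<^sub>L rtensor X f
      = ltensor X f \<cdot>\<^sub>L L (braid M (Dom LM f) X)"
    and "X \<in> Obj M \<Longrightarrow> L (braid M X (Cod LM f)) \<cdot>\<^sub>L ltensor X f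
      = rtensor X f \<cdot>\<^sub>L L (braid M X (Dom LM f))"
proof -
  have id: "is_functor LM LM (\<lambda>A. A) (\<lambda>f. f)"
    by (rule functorI) (simp_all add: loc.D.category_axioms)
  note s = rtensor_L ltensor_L tobj_obj unit_braid_natural_single unit_obj
  show "L (lunit M (Cod LM f)) \<cdot>\<^sub>L ltensor (unit_obj M) f = f \<cdot>\<^sub>L L (lunit M (Dom LM f))"
    by (rule loc.naturality_extends[OF ltensor_functor[OF unit_obj] id, where \<eta> = "\<lambda>A. L (lunit M A)"])
      (use f in \<open>simp_all add: s flip: loc.L_comp\<close>)
  show "L (runit M (Cod LM f)) \<cdot>\<^sub>L rtensor (unit_obj M) f = f \<cdot>\<^sub>L L (runit M (Dom LM f))"
    by (rule loc.naturality_extends[OF rtensor_functor[OF unit_obj] id, where \<eta> = "\<lambda>A. L (runit M A)"])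
      (use f in \<open>simp_all add: s flip: loc.L_comp\<close>)
  show "L (braid M (Cod LM f) X) \<cdot>\<^sub>L rtensor X f = ltensor X f \<cdot>\<^sub>L L (braid M (Dom LM f) X)"
    if X: "X \<in> Obj M"
    by (rule loc.naturality_extends[OF rtensor_functor[OF X] ltensor_functor[OF X], where \<eta> = "\<lambda>A. L (braid M A X)"])
      (use f X in \<open>simp_all add: s flip: loc.L_comp\<close>)
  show "L (braid M X (Cod LM f)) \<cdot>\<^sub>L ltensor X f = rtensor X f \<cdot>\<^sub>L L (braid M X (Dom LM f))"
    if X: "X \<in> Obj M"
    by (rule loc.naturality_extends[OF ltensor_functor[OF X] rtensor_functor[OF X], where \<eta> = "\<lambda>A. L (braid M X A)"])
      (use f X in \<open>simp_all add: s flip: loc.L_comp\<close>)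
qed

lemma loc_tensor_arr [simp]:
  assumes "f \<in> Arr LM" "g \<in> Arr LM"
  shows "f \<otimes>\<^sub>L g \<in> Arr LM" "Dom LM (f \<otimes>\<^sub>L g) = Dom LM f \<otimes>\<^sub>o Dom LM g"
    "Cod LM (f \<otimes>\<^sub>L g) = Cod LM f \<otimes>\<^sub>o Cod LM g"
  using assms by (simp_all add: loc_tarr_eq)

lemma loc_interchange:
  assumes f: "f \<in> Arr LM" "f' \<in> Arr LM" "Cod LM f = Dom LM f'"
    and g: "g \<in> Arr LM" "g' \<in> Arr LM" "Cod LM g = Dom LM g'"
  shows "(f' \<cdot>\<^sub>L f) \<otimes>\<^sub>L (g' \<cdot>\<^sub>L g) = (f' \<otimes>\<^sub>L g') \<cdot>\<^sub>L (f \<otimes>\<^sub>L g)"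
proof -
  let ?A = "Cod LM f'" and ?B = "Dom LM g"
  have ob: "?A \<in> Obj M" "?B \<in> Obj M" "Dom LM f' \<in> Obj M" "Dom LM g' \<in> Obj M" using f g by simp_all
  note ty = f g ob
  have "(f' \<cdot>\<^sub>L f) \<otimes>\<^sub>L (g' \<cdot>\<^sub>L g)
      = (ltensor ?A g' \<cdot>\<^sub>L ltensor ?A g) \<cdot>\<^sub>L (rtensor ?B f' \<cdot>\<^sub>L rtensor ?B f)"
    using ty by (simp add: loc_tarr_eq ltensor_comp rtensor_comp)
  also have "\<dots> = ltensor ?A g' \<cdot>\<^sub>L ((ltensor ?A g \<cdot>\<^sub>L rtensor ?B f') \<cdot>\<^sub>L rtensor ?B f)"
    using ty by (simp add: loc.D.comp_assoc_arr)
  also have "ltensor ?A g \<cdot>\<^sub>L rtensor ?B f' = rtensor (Dom LM g') f' \<cdot>\<^sub>L ltensor (Dom LM f') g"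
    using ltensor_rtensor[OF f(2) g(1)] g by simp
  also have "ltensor ?A g' \<cdot>\<^sub>L ((rtensor (Dom LM g') f' \<cdot>\<^sub>L ltensor (Dom LM f') g) \<cdot>\<^sub>L rtensor ?B f)
      = (ltensor ?A g' \<cdot>\<^sub>L rtensor (Dom LM g') f') \<cdot>\<^sub>L (ltensor (Dom LM f') g \<cdot>\<^sub>L rtensor ?B f)"
    using ty by (simp add: loc.D.comp_assoc_arr)
  also have "\<dots> = (f' \<otimes>\<^sub>L g') \<cdot>\<^sub>L (f \<otimes>\<^sub>L g)"
    using ty by (simp add: loc_tarr_eq)
  finally show ?thesis .
qed

text \<open>A tensor product of arrows is a composite of arrows tensored with objects, so naturality in
  all variables is obtained by pasting the three squares of \<open>loc_assoc_natural\<close>.\<close>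

lemma loc_assoc_natural_full:
  assumes f: "f \<in> Arr LM" and g: "g \<in> Arr LM" and h: "h \<in> Arr LM"
  shows "L (assoc M (Cod LM f) (Cod LM g) (Cod LM h)) \<cdot>\<^sub>L ((f \<otimes>\<^sub>L g) \<otimes>\<^sub>L h)
    = (f \<otimes>\<^sub>L (g \<otimes>\<^sub>L h)) \<cdot>\<^sub>L L (assoc M (Dom LM f) (Dom LM g) (Dom LM h))"
proof -
  define A A' B B' D D' where d: "A = Dom LM f" "A' = Cod LM f" "B = Dom LM g" "B' = Cod LM g"
    "D = Dom LM h" "D' = Cod LM h"
  have ob: "A \<in> Obj M" "A' \<in> Obj M" "B \<in> Obj M" "B' \<in> Obj M" "D \<in> Obj M" "D' \<in> Obj M"
    using f g h by (simp_all add: d)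
  note ty = ob f g h d[symmetric] tobj_obj
  let ?a = "\<lambda>A B D. L (assoc M A B D)"
  have "?a A' B' D' \<cdot>\<^sub>L ((f \<otimes>\<^sub>L g) \<otimes>\<^sub>L h)
      = (?a A' B' D' \<cdot>\<^sub>L ltensor (A' \<otimes>\<^sub>o B') h) \<cdot>\<^sub>L (rtensor D (ltensor A' g) \<cdot>\<^sub>L rtensor D (rtensor B f))"
    using ty by (simp add: loc_tarr_eq rtensor_comp loc.D.comp_assoc_arr)
  also have "?a A' B' D' \<cdot>\<^sub>L ltensor (A' \<otimes>\<^sub>o B') h = ltensor A' (ltensor B' h) \<cdot>\<^sub>L ?a A' B' D"
    using loc_assoc_natural(3)[OF h ob(2,4)] by (simp add: d)
  also have "(ltensor A' (ltensor B' h) \<cdot>\<^sub>L ?a A' B' D) \<cdot>\<^sub>L (rtensor D (ltensor A' g) \<cdot>\<^sub>L rtensor D (rtensor B f))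
      = ltensor A' (ltensor B' h) \<cdot>\<^sub>L ((?a A' B' D \<cdot>\<^sub>L rtensor D (ltensor A' g)) \<cdot>\<^sub>L rtensor D (rtensor B f))"
    using ty by (simp add: loc.D.comp_assoc_arr)
  also have "?a A' B' D \<cdot>\<^sub>L rtensor D (ltensor A' g) = ltensor A' (rtensor D g) \<cdot>\<^sub>L ?a A' B D"
    using loc_assoc_natural(2)[OF g ob(2,5)] by (simp add: d)
  also have "ltensor A' (ltensor B' h) \<cdot>\<^sub>L ((ltensor A' (rtensor D g) \<cdot>\<^sub>L ?a A' B D) \<cdot>\<^sub>L rtensor D (rtensor B f))
      = ltensor A' (ltensor B' h) \<cdot>\<^sub>L ltensor A' (rtensor D g) \<cdot>\<^sub>L (?a A' B D \<cdot>\<^sub>L rtensor D (rtensor B f))"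
    using ty by (simp add: loc.D.comp_assoc_arr)
  also have "?a A' B D \<cdot>\<^sub>L rtensor D (rtensor B f) = rtensor (B \<otimes>\<^sub>o D) f \<cdot>\<^sub>L ?a A B D"
    using loc_assoc_natural(1)[OF f ob(3,5)] by (simp add: d)
  also have "ltensor A' (ltensor B' h) \<cdot>\<^sub>L ltensor A' (rtensor D g) \<cdot>\<^sub>L (rtensor (B \<otimes>\<^sub>o D) f \<cdot>\<^sub>L ?a A B D)
      = (f \<otimes>\<^sub>L (g \<otimes>\<^sub>L h)) \<cdot>\<^sub>L ?a A B D"
    using ty by (simp add: loc_tarr_eq ltensor_comp loc.D.comp_assoc_arr)
  finally show ?thesis by (simp add: d)
qed

lemma loc_braid_natural_full:
  assumes f: "f \<in> Arr LM" and g: "g \<in> Arr LM"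
  shows "L (braid M (Cod LM f) (Cod LM g)) \<cdot>\<^sub>L (f \<otimes>\<^sub>L g)
    = (g \<otimes>\<^sub>L f) \<cdot>\<^sub>L L (braid M (Dom LM f) (Dom LM g))"
proof -
  define A A' B B' where d: "A = Dom LM f" "A' = Cod LM f" "B = Dom LM g" "B' = Cod LM g"
  have ob: "A \<in> Obj M" "A' \<in> Obj M" "B \<in> Obj M" "B' \<in> Obj M"
    using f g by (simp_all add: d)
  note ty = ob f g d[symmetric] tobj_obj
  have "L (braid M A' B') \<cdot>\<^sub>L (f \<otimes>\<^sub>L g) = (L (braid M A' B') \<cdot>\<^sub>L ltensor A' g) \<cdot>\<^sub>L rtensor B f"
    using ty by (simp add: loc_tarr_eq loc.D.comp_assoc_arr)
  also have "L (braid M A' B') \<cdot>\<^sub>L ltensor A' g = rtensor A' g \<cdot>\<^sub>L L (braid M A' B)"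
    using loc_unit_braid_natural(4)[OF g ob(2)] by (simp add: d)
  also have "(rtensor A' g \<cdot>\<^sub>L L (braid M A' B)) \<cdot>\<^sub>L rtensor B f
      = rtensor A' g \<cdot>\<^sub>L (L (braid M A' B) \<cdot>\<^sub>L rtensor B f)"
    using ty by (simp add: loc.D.comp_assoc_arr)
  also have "L (braid M A' B) \<cdot>\<^sub>L rtensor B f = ltensor B f \<cdot>\<^sub>L L (braid M A B)"
    using loc_unit_braid_natural(3)[OF f ob(3)] by (simp add: d)
  also have "rtensor A' g \<cdot>\<^sub>L (ltensor B f \<cdot>\<^sub>L L (braid M A B))
      = (rtensor A' g \<cdot>\<^sub>L ltensor B f) \<cdot>\<^sub>L L (braid M A B)"
    using ty by (simp add: loc.D.comp_assoc_arr)
  also have "rtensor A' g \<cdot>\<^sub>L ltensor B f = g \<otimes>\<^sub>L f"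
    using ltensor_rtensor[OF g f] ty by (simp add: loc_tarr_eq)
  finally show ?thesis by (simp add: d)
qed

lemma localization_symmetric_monoidal: "symmetric_monoidal_category LM"
proof (intro symmetric_monoidal_category.intro symmetric_monoidal_category_axioms.intro)
  note F = loc.func
  fix A B D E assume "A \<in> Obj LM" "B \<in> Obj LM" "D \<in> Obj LM" "E \<in> Obj LM"
  then have ob: "A \<in> Obj M" "B \<in> Obj M" "D \<in> Obj M" "E \<in> Obj M" by simp_all
  show "(Ident LM A \<otimes>\<^sub>L assoc LM B D E) \<cdot>\<^sub>L assoc LM A (B \<otimes>\<^sub>o\<^bsub>LM\<^esub> D) E
      \<cdot>\<^sub>L (assoc LM A B D \<otimes>\<^sub>L Ident LM E)
      = assoc LM A B (D \<otimes>\<^sub>o\<^bsub>LM\<^esub> E) \<cdot>\<^sub>L assoc LM (A \<otimes>\<^sub>o\<^bsub>LM\<^esub> B) D E"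
    using ob pentagon[OF ob] by (simp add: loc_ident tarr_L tobj_obj flip: loc.L_comp)
next
  fix A B assume "A \<in> Obj LM" "B \<in> Obj LM"
  then have ob: "A \<in> Obj M" "B \<in> Obj M" by simp_all
  show "(Ident LM A \<otimes>\<^sub>L lunit LM B) \<cdot>\<^sub>L assoc LM A (unit_obj LM) B = runit LM A \<otimes>\<^sub>L Ident LM B"
    using ob triangle[OF ob] by (simp add: loc_ident tarr_L tobj_obj unit_obj flip: loc.L_comp)
  show "braid LM B A \<cdot>\<^sub>L braid LM A B = Ident LM (A \<otimes>\<^sub>o\<^bsub>LM\<^esub> B)"
    using ob braid_symmetric[OF ob] by (simp add: loc_ident tarr_L tobj_obj flip: loc.L_comp)
  show "Ident LM A \<otimes>\<^sub>L Ident LM B = Ident LM (A \<otimes>\<^sub>o\<^bsub>LM\<^esub> B)"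
    using ob by (simp add: loc_ident tarr_L tobj_obj tarr_ident)
next
  fix A B D assume "A \<in> Obj LM" "B \<in> Obj LM" "D \<in> Obj LM"
  then have ob: "A \<in> Obj M" "B \<in> Obj M" "D \<in> Obj M" by simp_all
  show "assoc LM B D A \<cdot>\<^sub>L braid LM A (B \<otimes>\<^sub>o\<^bsub>LM\<^esub> D) \<cdot>\<^sub>L assoc LM A B D
      = (Ident LM B \<otimes>\<^sub>L braid LM A D) \<cdot>\<^sub>L assoc LM B A D \<cdot>\<^sub>L (braid LM A B \<otimes>\<^sub>L Ident LM D)"
    using ob hexagon[OF ob] by (simp add: loc_ident tarr_L tobj_obj flip: loc.L_comp)
next
  fix f f' g g' A A' A'' B B' B''
  assume "f \<in> hom LM A A'" "f' \<in> hom LM A' A''" "g \<in> hom LM B B'" "g' \<in> hom LM B' B''"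
  then show "(f' \<cdot>\<^sub>L f) \<otimes>\<^sub>L (g' \<cdot>\<^sub>L g) = (f' \<otimes>\<^sub>L g') \<cdot>\<^sub>L (f \<otimes>\<^sub>L g)"
    by (intro loc_interchange) (auto simp: in_hom)
next
  fix f g h A A' B B' D D'
  assume "f \<in> hom LM A A'" "g \<in> hom LM B B'" "h \<in> hom LM D D'"
  then show "assoc LM A' B' D' \<cdot>\<^sub>L ((f \<otimes>\<^sub>L g) \<otimes>\<^sub>L h) = (f \<otimes>\<^sub>L (g \<otimes>\<^sub>L h)) \<cdot>\<^sub>L assoc LM A B D"
    using loc_assoc_natural_full[of f g h] by (simp add: in_hom)
next
  fix f g A A' B B'
  assume fg: "f \<in> hom LM A A'" "g \<in> hom LM B B'"
  then show "braid LM A' B' \<cdot>\<^sub>L (f \<otimes>\<^sub>L g) = (g \<otimes>\<^sub>L f) \<cdot>\<^sub>L braid LM A B"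
    using loc_braid_natural_full[of f g] by (simp add: in_hom)
  show "f \<otimes>\<^sub>L g \<in> hom LM (A \<otimes>\<^sub>o\<^bsub>LM\<^esub> B) (A' \<otimes>\<^sub>o\<^bsub>LM\<^esub> B')"
    using fg by (simp add: in_hom)
next
  fix f A A' assume "f \<in> hom LM A A'"
  then have f: "f \<in> Arr LM" "Dom LM f = A" "Cod LM f = A'" by (auto simp: in_hom)
  then have ob: "A \<in> Obj M" "A' \<in> Obj M" using loc_obj[OF f(1)] by auto
  have id: "Ident LM (unit_obj M) \<in> Arr LM" "Cod LM (Ident LM (unit_obj M)) = unit_obj M"
      "Dom LM (Ident LM (unit_obj M)) = unit_obj M"
    using loc.D.ident_arr[of "unit_obj M"] unit_obj by simp_all
  have "Ident LM (unit_obj M) \<otimes>\<^sub>L f = ltensor (unit_obj M) f"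
    using loc.D.ident_right[of "ltensor (unit_obj M) f" "unit_obj M \<otimes>\<^sub>o A"] f id unit_obj ob
    by (simp add: loc_tarr_eq)
  then show "lunit LM A' \<cdot>\<^sub>L (Ident LM (unit_obj LM) \<otimes>\<^sub>L f) = f \<cdot>\<^sub>L lunit LM A"
    using loc_unit_braid_natural(1)[OF f(1)] f by simp
  show "runit LM A' \<cdot>\<^sub>L (f \<otimes>\<^sub>L Ident LM (unit_obj LM)) = f \<cdot>\<^sub>L runit LM A"
    using loc_unit_braid_natural(2)[OF f(1)] f by (simp add: tensor_ident unit_obj)
qed (use loc.D.category_axioms functor_iso[OF loc.func] assoc_iso lunit_iso runit_iso
    in \<open>simp_all add: in_hom tobj_obj unit_obj\<close>)

lemma localization_strict_functor: "strict_symmetric_monoidal_functor M LM (\<lambda>A. A) L"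
  unfolding strict_symmetric_monoidal_functor_def using loc.func by (simp add: tarr_L)

end

section \<open>Colimits in the localization\<close>

locale tensor_localization = monoidal_localized M W
  for M :: "('o, 'a, 'm) moncat_scheme" (structure) and W :: "'a set" +
  fixes \<kappa> :: "'u rel"
  assumes cocomp: "cocomplete TYPE('u) M"
    and reg: "regular_cardinal \<kappa>"
    and closed: "\<And>I :: 'u set. |I| <o \<kappa> \<Longrightarrow> coproduct_closed M I W"
    and comparison: "tensor_colim_maps \<kappa> M \<subseteq> W"
begin

text \<open>In \<open>M\<close> the comparison from the colimit of the \<open>Fo j \<otimes> X\<close> to \<open>K \<otimes> X\<close> is one of the inverted arrows, and
  the former colimit is preserved by \<open>L\<close>; so \<open>K \<otimes> X\<close> is a colimit in the localization.\<close>

lemma tensor_preserves_colimit: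
  fixes J :: "('u, 'u) cat"
  assumes J: "small_cat \<kappa> J" and F: "is_functor J M Fo Fa" and K: "is_colimit J M Fo Fa K c"
    and X: "X \<in> Obj M"
  shows "is_colimit J LM (\<lambda>j. Fo j \<otimes>\<^sub>o X) (\<lambda>u. rtensor X (L (Fa u))) (K \<otimes>\<^sub>o X) (\<lambda>j. rtensor X (L (c j)))"
proof -
  interpret J: category J by (rule functorD[OF F])
  note DF = functorD(3-8)[OF F] and DK = colimitD[OF K]
  have FX: "is_functor J M (\<lambda>j. Fo j \<otimes>\<^sub>o X) (\<lambda>u. Fa u \<otimes> Ident M X)"
    by (rule functor_comp[OF F tensor_right_functor[OF X]])
  then obtain D d where D: "is_colimit J M (\<lambda>j. Fo j \<otimes>\<^sub>o X) (\<lambda>u. Fa u \<otimes> Ident M X) D d"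
    using cocomp unfolding cocomplete_def by blast
  note DD = colimitD[OF D]
  have "is_cocone J M (\<lambda>j. Fo j \<otimes>\<^sub>o X) (\<lambda>u. Fa u \<otimes> Ident M X) (K \<otimes>\<^sub>o X) (\<lambda>j. c j \<otimes> Ident M X)"
    unfolding is_cocone_def using DF DK X by (simp add: in_hom tobj_obj interchange_arr)
  then obtain u where u: "u \<in> Arr M" "Dom M u = D" "Cod M u = K \<otimes>\<^sub>o X"
    "\<And>j. j \<in> Obj J \<Longrightarrow> u \<cdot> d j = c j \<otimes> Ident M X"
    using colimit_ex[OF D] by blast
  have "tensor_colim_map M J Fo Fa X K c D d u"
    unfolding tensor_colim_map_def in_hom using K D u by simp
  then have "u \<in> tensor_colim_maps \<kappa> M"
    unfolding tensor_colim_maps_def using J F X by blast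
  then have iso: "iso LM (L u)" using comparison loc.inverts by blast
  have LD: "is_colimit J LM (\<lambda>j. Fo j \<otimes>\<^sub>o X) (\<lambda>u. L (Fa u \<otimes> Ident M X)) D (\<lambda>j. L (d j))"
    by (rule loc.preserves_colimit[OF FX D closed[OF small_cat_obj(1)[OF J]] closed[OF small_cat_obj(2)[OF J]]])
  have "L u \<cdot>\<^sub>L L (d j) = rtensor X (L (c j))" if "j \<in> Obj J" for j
    using loc.L_comp[of "d j" u] that u(1,2) u(4)[OF that] DD DK X by (simp add: rtensor_L)
  then have "is_colimit J LM (\<lambda>j. Fo j \<otimes>\<^sub>o X) (\<lambda>u. L (Fa u \<otimes> Ident M X)) (K \<otimes>\<^sub>o X) (\<lambda>j. rtensor X (L (c j)))"
    by (rule_tac loc.D.colimit_iso[OF functor_comp[OF FX loc.func] LD iso]) (use u in simp_all)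
  then show ?thesis
    by (subst (asm) loc.D.colimit_arr_cong[of J _ "\<lambda>u. rtensor X (L (Fa u))"]) (use DF X in \<open>simp_all add: rtensor_L\<close>)
qed

lemma tensor_preserves_coproduct:
  fixes I :: "'u set"
  assumes I: "|I| <o \<kappa>" and P: "is_coproduct M I A P c" and X: "X \<in> Obj M"
  shows "is_coproduct LM I (\<lambda>i. A i \<otimes>\<^sub>o X) (P \<otimes>\<^sub>o X) (\<lambda>i. rtensor X (L (c i)))"
proof -
  let ?Fa = "\<lambda>i. Ident M (A i)"
  note DP = coproductD[OF P]
  have "is_colimit (discrete_cat I) M A ?Fa P c" using P DP by (subst discrete_colimit) simp_all
  moreover have "is_functor (discrete_cat I) M A ?Fa" using DP by (intro discrete_functor) simp_all
  ultimately have "is_colimit (discrete_cat I) LM (\<lambda>i. A i \<otimes>\<^sub>o X) (\<lambda>i. rtensor X (L (?Fa i))) (P \<otimes>\<^sub>o X)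
      (\<lambda>i. rtensor X (L (c i)))"
    using tensor_preserves_colimit[OF small_discrete_cat[OF I] _ _ X] by blast
  then show ?thesis
    using DP X by (subst (asm) loc.D.discrete_colimit) (simp_all add: tobj_obj loc.L_ident)
qed

lemma tensor_preserves_coequalizer:
  assumes q: "is_coequalizer M f g q" and X: "X \<in> Obj M"
  shows "is_coequalizer LM (rtensor X (L f)) (rtensor X (L g)) (rtensor X (L q))"
proof -
  have inf: "infinite (UNIV :: 'u set)"
    using reg by (meson finite_subset subset_UNIV regular_cardinal_def)
  obtain x y a b :: 'u where dist: "distinct [x, y, a, b]" using infinite_obtains_four[OF inf] .
  define Fo where "Fo = (\<lambda>j. if j = x then Dom M f else Cod M f)"
  define Fa where "Fa = (\<lambda>u. if u = x then Ident M (Dom M f) else if u = y then Ident M (Cod M f)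
    else if u = a then f else g)"
  define c where "c = (\<lambda>j. if j = y then q else q \<cdot> f)"
  have F: "Fo x = Dom M f" "Fo y = Cod M f" "Fa x = Ident M (Dom M f)" "Fa y = Ident M (Cod M f)"
      "Fa a = f" "Fa b = g" and c: "c y = q" "c x = q \<cdot> f"
    using dist by (auto simp: Fo_def Fa_def c_def)
  note DQ = coequalizerD[OF q]
  have p: "parallel M f g" "parallel LM (rtensor X (L f)) (rtensor X (L g))"
    using DQ X by (auto simp: parallel_def)
  have "is_colimit (parallel_pair_cat x y a b) M Fo Fa (Cod M q) c"
    using q c by (subst parallel_pair_colimit[OF dist p(1) F]) simp
  from tensor_preserves_colimit[OF small_parallel_pair_cat[OF reg dist] parallel_pair_functor[OF dist p(1) F] this X]
  have "is_coequalizer LM (rtensor X (L f)) (rtensor X (L g)) (rtensor X (L (c y)))"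
    by (subst (asm) loc.D.parallel_pair_colimit[OF dist p(2)]) (use F DQ X in \<open>simp_all add: loc.L_ident\<close>)
  then show ?thesis by (simp add: c)
qed

text \<open>The coproducts \<open>P\<close> and \<open>Q\<close> are formed in the original category and \<open>t\<close> is a common denominator of the
  two maps \<open>\<alpha>, \<beta>\<close> that present the diagram.  Every ingredient of the resulting colimit is preserved
  by tensoring with \<open>X\<close>, so the same construction, tensored with \<open>X\<close>, gives the second colimit.\<close>

lemma localization_colimit_tensor:
  fixes J :: "('u, 'u) cat"
  assumes J: "small_cat \<kappa> J" and F: "is_functor J LM Bo Ba" and X: "X \<in> Obj M"
  obtains K k where "is_colimit J LM Bo Ba K k"
    "is_colimit J LM (\<lambda>j. Bo j \<otimes>\<^sub>o X) (\<lambda>u. rtensor X (Ba u)) (K \<otimes>\<^sub>o X) (\<lambda>j. rtensor X (k j))"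
proof -
  interpret J: category J by (rule functorD[OF F])
  note DF = functorD(3-8)[OF F]
  note small = small_cat_obj[OF J]
  have inf: "infinite (UNIV :: 'u set)"
    using reg by (meson finite_subset subset_UNIV regular_cardinal_def)
  have FX: "is_functor J LM (\<lambda>j. Bo j \<otimes>\<^sub>o X) (\<lambda>u. rtensor X (Ba u))"
    by (rule functor_comp[OF F rtensor_functor[OF X]])
  have ob: "Bo j \<in> Obj M" if "j \<in> Obj J" for j using DF(1)[OF that] by simp
  obtain P c where P: "is_coproduct M (Obj J) Bo P c"
    using coproduct_exists[OF cocomp, of "Obj J" Bo] ob by blast
  obtain Q d where Q: "is_coproduct M (Arr J) (\<lambda>u. Bo (Dom J u)) Q d"
    using coproduct_exists[OF cocomp, of "Arr J" "\<lambda>u. Bo (Dom J u)"] ob J.dom_cod_obj by blast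
  note DP = coproductD[OF P] and DQ = coproductD[OF Q]
  note LP = loc.preserves_coproduct[OF closed[OF small(1)] P]
  note LQ = loc.preserves_coproduct[OF closed[OF small(2)] Q]
  obtain \<alpha> \<beta> where \<alpha>: "\<alpha> \<in> Arr LM" "Dom LM \<alpha> = Q" "Cod LM \<alpha> = P"
      "\<And>u. u \<in> Arr J \<Longrightarrow> \<alpha> \<cdot>\<^sub>L L (d u) = L (c (Cod J u)) \<cdot>\<^sub>L Ba u"
    and \<beta>: "\<beta> \<in> Arr LM" "Dom LM \<beta> = Q" "Cod LM \<beta> = P"
      "\<And>u. u \<in> Arr J \<Longrightarrow> \<beta> \<cdot>\<^sub>L L (d u) = L (c (Dom J u))"
    using loc.D.colimit_presentation[OF F LP LQ] by blast
  have par: "Dom LM \<alpha> = Dom LM \<beta>" "Cod LM \<alpha> = Cod LM \<beta>" using \<alpha> \<beta> by simp_all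
  obtain t x y where t: "t \<in> W" "t \<in> Arr M" "x \<in> Arr M" "y \<in> Arr M" "Dom M t = Cod LM \<beta>"
    "Dom M x = Dom LM \<beta>" "Dom M y = Dom LM \<beta>" "Cod M x = Cod M t" "Cod M y = Cod M t"
    and tx: "L t \<cdot>\<^sub>L \<alpha> = L x" "L t \<cdot>\<^sub>L \<beta> = L y" and ti: "iso LM (L t)"
    by (rule loc.left_common_denominator[OF \<alpha>(1) \<beta>(1) par])
  have "parallel M x y" using t by (simp add: parallel_def)
  then obtain q where q: "is_coequalizer M x y q" using coequalizer_exists[OF cocomp inf] by blast
  note Dq = coequalizerD[OF q]
  let ?k = "L q \<cdot>\<^sub>L L t" and ?K = "Cod M q"
  have ty: "L q \<in> Arr LM" "Dom LM (L q) = Cod M t" "Cod LM (L q) = ?K" "L t \<in> Arr LM" "Dom LM (L t) = P"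
    "Cod LM (L t) = Cod M t"
    using Dq t \<beta> by simp_all
  have k: "?k \<in> Arr LM" "Dom LM ?k = P" "Cod LM ?k = ?K" using ty by simp_all
  have "is_coequalizer LM \<alpha> \<beta> ?k"
    by (rule loc.D.coequalizer_precomp_iso[OF _ ti])
      (use loc.preserves_coequalizer[OF q] tx \<alpha>(1-3) \<beta>(1-3) ty in simp_all)
  then have col: "is_colimit J LM Bo Ba ?K (\<lambda>j. ?k \<cdot>\<^sub>L L (c j))"
    using loc.D.colimit_iff_coequalizer[OF F LP LQ \<alpha> \<beta> k(1,2)] k by simp
  let ?T = "rtensor X"
  note TP = tensor_preserves_coproduct[OF small(1) P X]
  note TQ = tensor_preserves_coproduct[OF small(2) Q X]
  have T: "?T \<alpha> \<in> Arr LM" "Dom LM (?T \<alpha>) = Q \<otimes>\<^sub>o X" "Cod LM (?T \<alpha>) = P \<otimes>\<^sub>o X"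
    "?T \<beta> \<in> Arr LM" "Dom LM (?T \<beta>) = Q \<otimes>\<^sub>o X" "Cod LM (?T \<beta>) = P \<otimes>\<^sub>o X"
    "?T ?k \<in> Arr LM" "Dom LM (?T ?k) = P \<otimes>\<^sub>o X" "Cod LM (?T ?k) = ?K \<otimes>\<^sub>o X"
    using X \<alpha>(1-3) \<beta>(1-3) k by simp_all
  have T\<alpha>: "?T \<alpha> \<cdot>\<^sub>L ?T (L (d u)) = ?T (L (c (Cod J u))) \<cdot>\<^sub>L ?T (Ba u)" if "u \<in> Arr J" for u
  proof -
    have "?T (\<alpha> \<cdot>\<^sub>L L (d u)) = ?T (L (c (Cod J u)) \<cdot>\<^sub>L Ba u)" using \<alpha>(4)[OF that] by simp
    then show ?thesis using that X \<alpha>(1-3) DP DQ DF by (simp add: rtensor_comp)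
  qed
  have T\<beta>: "?T \<beta> \<cdot>\<^sub>L ?T (L (d u)) = ?T (L (c (Dom J u)))" if "u \<in> Arr J" for u
  proof -
    have "?T (\<beta> \<cdot>\<^sub>L L (d u)) = ?T (L (c (Dom J u)))" using \<beta>(4)[OF that] by simp
    then show ?thesis using that X \<beta>(1-3) DP DQ DF by (simp add: rtensor_comp)
  qed
  have "is_coequalizer LM (?T (L x)) (?T (L y)) (?T (L q))"
    by (rule tensor_preserves_coequalizer[OF q X])
  moreover have "?T (L x) = ?T (L t) \<cdot>\<^sub>L ?T \<alpha>" "?T (L y) = ?T (L t) \<cdot>\<^sub>L ?T \<beta>"
    using tx[symmetric] ty X \<alpha>(1-3) \<beta>(1-3) by (simp_all add: rtensor_comp)
  ultimately have "is_coequalizer LM (?T (L t) \<cdot>\<^sub>L ?T \<alpha>) (?T (L t) \<cdot>\<^sub>L ?T \<beta>) (?T (L q))"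
    by simp
  then have "is_coequalizer LM (?T \<alpha>) (?T \<beta>) (?T (L q) \<cdot>\<^sub>L ?T (L t))"
    by (rule loc.D.coequalizer_precomp_iso[OF _ functor_iso[OF rtensor_functor[OF X] ti]])
      (use T ty X in simp_all)
  also have "?T (L q) \<cdot>\<^sub>L ?T (L t) = ?T ?k" using ty X by (simp add: rtensor_comp)
  finally have "is_colimit J LM (\<lambda>j. Bo j \<otimes>\<^sub>o X) (\<lambda>u. ?T (Ba u)) (Cod LM (?T ?k)) (\<lambda>j. ?T ?k \<cdot>\<^sub>L ?T (L (c j)))"
    using loc.D.colimit_iff_coequalizer[OF FX TP TQ T(1-3) T\<alpha> T(4-6) T\<beta> T(7,8)] by simp
  moreover have "?T ?k \<cdot>\<^sub>L ?T (L (c j)) = ?T (?k \<cdot>\<^sub>L L (c j))" if "j \<in> Obj J" for j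
    using that X k DP by (simp add: rtensor_comp)
  ultimately have "is_colimit J LM (\<lambda>j. Bo j \<otimes>\<^sub>o X) (\<lambda>u. ?T (Ba u)) (?K \<otimes>\<^sub>o X) (\<lambda>j. ?T (?k \<cdot>\<^sub>L L (c j)))"
    unfolding is_colimit_def is_cocone_def using T(9) by simp
  with col show ?thesis by (rule that)
qed

text \<open>Any two colimits of the diagram are isomorphic, and tensoring preserves the isomorphism.  It is
  therefore enough that \<open>localization_colimit_tensor\<close> provides one colimit that remains a colimit
  after tensoring.\<close>

lemma localization_tensor_commutes_with_colim:
  fixes J :: "('u, 'u) cat"
  assumes J: "small_cat \<kappa> J" and F: "is_functor J LM Bo Ba" and X: "X \<in> Obj M"
  shows "tensor_commutes_with_colim LM J Bo Ba X"
proof -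
  interpret J: category J by (rule functorD[OF F])
  note DF = functorD(3-8)[OF F]
  let ?T = "rtensor X"
  have FX: "is_functor J LM (\<lambda>j. Bo j \<otimes>\<^sub>o X) (\<lambda>u. ?T (Ba u))"
    by (rule functor_comp[OF F rtensor_functor[OF X]])
  have tens: "is_colimit J LM (\<lambda>j. Bo j \<otimes>\<^sub>o\<^bsub>LM\<^esub> X) (\<lambda>u. Ba u \<otimes>\<^sub>L Ident LM X) D d
      \<longleftrightarrow> is_colimit J LM (\<lambda>j. Bo j \<otimes>\<^sub>o X) (\<lambda>u. ?T (Ba u)) D d" for D d
    unfolding localization_simps(5) by (rule loc.D.colimit_arr_cong) (use DF X in \<open>simp add: tensor_ident\<close>)
  obtain K k where K: "is_colimit J LM Bo Ba K k"
    and KX: "is_colimit J LM (\<lambda>j. Bo j \<otimes>\<^sub>o X) (\<lambda>u. ?T (Ba u)) (K \<otimes>\<^sub>o X) (\<lambda>j. ?T (k j))"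
    by (rule localization_colimit_tensor[OF J F X])
  note DK = loc.D.colimitD[OF K]
  have "iso LM u" if "tensor_colim_map LM J Bo Ba X K' c D d u" for K' c D d u
  proof -
    have c: "is_colimit J LM Bo Ba K' c"
      and d: "is_colimit J LM (\<lambda>j. Bo j \<otimes>\<^sub>o X) (\<lambda>u. ?T (Ba u)) D d"
      and u: "u \<in> Arr LM" "Dom LM u = D" "Cod LM u = K' \<otimes>\<^sub>o X"
        "\<And>j. j \<in> Obj J \<Longrightarrow> u \<cdot>\<^sub>L d j = c j \<otimes>\<^sub>L Ident LM X"
      using that unfolding tensor_colim_map_def tens by (simp_all add: in_hom)
    note Dc = loc.D.colimitD[OF c]
    obtain w where w: "w \<in> Arr LM" "Dom LM w = K" "Cod LM w = K'" "\<And>j. j \<in> Obj J \<Longrightarrow> w \<cdot>\<^sub>L k j = c j"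
      by (rule loc.D.colimit_ex[OF K, of K' c]) (use c in \<open>auto simp: is_colimit_def\<close>)
    have "iso LM w" by (rule loc.D.colimit_comparison_iso[OF F K c w])
    then have iw: "iso LM (?T w)" by (rule functor_iso[OF rtensor_functor[OF X]])
    have "?T w \<cdot>\<^sub>L ?T (k j) = ?T (c j)" if "j \<in> Obj J" for j
      using rtensor_comp[of X "k j" w] that w(1-3) w(4)[OF that] X DK by simp
    then have cX: "is_colimit J LM (\<lambda>j. Bo j \<otimes>\<^sub>o X) (\<lambda>u. ?T (Ba u)) (K' \<otimes>\<^sub>o X) (\<lambda>j. ?T (c j))"
      by (rule_tac loc.D.colimit_iso[OF FX KX iw]) (use w X in simp_all)
    show ?thesis
      by (rule loc.D.colimit_comparison_iso[OF FX d cX u(1-3)]) (use u(4) Dc X in \<open>simp add: tensor_ident\<close>)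
  qed
  then show ?thesis
    unfolding tensor_commutes_with_colim_def tens using K KX by blast
qed

end

theorem theorem3p9:
  fixes V :: "('o, 'a) moncat"
    and \<kappa> :: "'u rel"
    and S Sbar :: "'a set"
    and LV :: "('o, ('o, 'a) zarr) moncat"
    and L :: "'a \<Rightarrow> ('o, 'a) zarr"
  assumes "symmetric_monoidal_category V"
    and "complete TYPE('u) V"
    and "cocomplete TYPE('u) V"
    and "regular_cardinal \<kappa>"
    and S: "S = tensor_colim_maps \<kappa> V"
    and Sbar: "Sbar = mult_closure \<kappa> V S"
    and LV: "LV = localization V Sbar"
    and L: "L = loc_arr V Sbar"
  shows
    "(preserves_small_limits \<kappa> V LV (\<lambda>A. A) L
      \<and> preserves_small_colimits \<kappa> V LV (\<lambda>A. A) L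
      \<and> symmetric_monoidal_category LV
      \<and> strict_symmetric_monoidal_functor V LV (\<lambda>A. A) L)
     \<and> (\<forall>(J :: ('u, 'u) cat) Ao Aa. \<forall>X \<in> Obj V.
          small_cat \<kappa> J \<and> is_functor J V Ao Aa \<longrightarrow>
          tensor_commutes_with_colim LV J Ao (\<lambda>u. L (Aa u)) X)
     \<and> (\<forall>(I :: ('u, 'u) cat) Bo Ba. \<forall>X \<in> Obj LV.
          small_cat \<kappa> I \<and> is_functor I LV Bo Ba \<longrightarrow>
          tensor_commutes_with_colim LV I Bo Ba X)"
proof -
  interpret V: symmetric_monoidal_category V by fact
  interpret cl: monoidal_closure V \<kappa> S
    by unfold_locales (use assms(4) S in \<open>auto simp: tensor_colim_maps_def tensor_colim_map_def in_hom\<close>)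
  interpret ms: multiplicative_system V Sbar
    unfolding Sbar by (rule cl.closure_multiplicative_system[OF assms(2,3)])
  have prod: "coproduct_closed V I Sbar" "coproduct_closed (opcat V) I Sbar"
    if I: "|I| <o \<kappa>" for I :: "'u set"
  proof -
    interpret O: category "opcat V" by (rule category_opcat[OF V.category_axioms])
    show "coproduct_closed V I Sbar"
      unfolding coproduct_closed_def
    proof (intro conjI allI impI)
      fix A assume "\<forall>i \<in> I. A i \<in> Obj V"
      then show "\<exists>P c. is_coproduct V I A P c" by (intro V.coproduct_exists[OF assms(3)]) simp
    next
      fix s m assume "\<forall>i \<in> I. s i \<in> Sbar" "is_coproduct_map V I s m"
      then show "m \<in> Sbar" using cl.closure_products[OF I, of s m] Sbar by simp
    qed
    show "coproduct_closed (opcat V) I Sbar"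
      unfolding coproduct_closed_def is_product_map_opcat[symmetric]
    proof (intro conjI allI impI)
      fix A assume "\<forall>i \<in> I. A i \<in> Obj (opcat V)"
      then show "\<exists>P c. is_coproduct (opcat V) I A P c"
        by (intro O.coproduct_exists[OF complete_opcat[OF V.category_axioms assms(2)]]) simp
    next
      fix s m assume "\<forall>i \<in> I. s i \<in> Sbar" "is_product_map V I s m"
      then show "m \<in> Sbar" using cl.closure_products[OF I, of s m] Sbar by simp
    qed
  qed
  interpret tensor_localization V Sbar \<kappa>
  proof unfold_locales
    show "tensor_colim_maps \<kappa> V \<subseteq> Sbar" using cl.closure_base S Sbar by blast
  qed (use assms(3,4) prod cl.closure_tensor Sbar in auto)
  have "preserves_small_limits \<kappa> V LV (\<lambda>A. A) L"
    unfolding preserves_small_limits_def LV L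
  proof (intro allI impI, elim conjE)
    fix J :: "('u, 'u) cat" and Fo Fa X p
    assume J: "small_cat \<kappa> J" and F: "is_functor J V Fo Fa" "is_limit J V Fo Fa X p"
    show "is_limit J (localization V Sbar) Fo (\<lambda>u. loc_arr V Sbar (Fa u)) X (\<lambda>j. loc_arr V Sbar (p j))"
      by (rule loc.preserves_limit[OF F prod(2)[OF small_cat_obj(1)[OF J]] prod(2)[OF small_cat_obj(2)[OF J]]])
  qed
  moreover have "preserves_small_colimits \<kappa> V LV (\<lambda>A. A) L"
    unfolding preserves_small_colimits_def LV L
  proof (intro allI impI, elim conjE)
    fix J :: "('u, 'u) cat" and Fo Fa X c
    assume J: "small_cat \<kappa> J" and F: "is_functor J V Fo Fa" "is_colimit J V Fo Fa X c"
    show "is_colimit J (localization V Sbar) Fo (\<lambda>u. loc_arr V Sbar (Fa u)) X (\<lambda>j. loc_arr V Sbar (c j))"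
      by (rule loc.preserves_colimit[OF F prod(1)[OF small_cat_obj(1)[OF J]] prod(1)[OF small_cat_obj(2)[OF J]]])
  qed
  moreover have "tensor_commutes_with_colim LV J Ao (\<lambda>u. L (Aa u)) X"
    if "small_cat \<kappa> J" "is_functor J V Ao Aa" "X \<in> Obj V" for J :: "('u, 'u) cat" and Ao Aa X
    using localization_tensor_commutes_with_colim[OF that(1) functor_comp[OF that(2) loc.func] that(3)]
    by (simp add: LV L)
  moreover have "tensor_commutes_with_colim LV I Bo Ba X"
    if "small_cat \<kappa> I" "is_functor I LV Bo Ba" "X \<in> Obj LV" for I :: "('u, 'u) cat" and Bo Ba X
    using localization_tensor_commutes_with_colim that by (simp add: LV)
  ultimately show ?thesis
    using localization_symmetric_monoidal localization_strict_functor by (simp add: LV L)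
qed

end
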